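(* Let $(\theta_n)_{n=1}^\infty$ be a regular sequence with $\lim_n\theta_n^{1/n}=1$. Let $X=T_M[(\mathcal F_k,\theta_k)_{k=1}^\infty]$ or $X=T_{M(m)}[(\mathcal F_k,\theta_k)_{k=1}^\infty]$ for some $m\in\mathbb N$. Then the spaces $X$ and $T[(\mathcal F_k,\theta_k)_{k=1}^\infty]$ are totally incomparable.
   Context: $\mathbb N=\{1,2,\dots\}$; $c_{00}$ is the space of finitely supported real sequences with standard basis $(e_i)$; $Ex$ is the restriction of $x$ to $E\subset\mathbb N$. For finite $E,F\subset\mathbb N$, $E<F$ means $\max E<\min F$ or one of them is empty; $n\le E$ means $n\le\min E$. Schreier families: $\mathcal F_0=\{\emptyset\}\cup\{\{n\}:n\in\mathbb N\}$ and $\mathcal F_{n+1}=\{\emptyset\}\cup\{\bigcup_{i=1}^kA_i: k\in\mathbb N,\ A_i\in\mathcal F_n,\ k\le A_1<A_2<\dots<A_k\}$. A finite sequence $(E_i)_{i=1}^d$ of nonempty finite subsets of $\mathbb N$ with $\{\min E_1,\dots,\min E_d\}\in\mathcal M$ is $\mathcal M$-admissible if $E_1<\dots<E_d$, and $\mathcal M$-allowable if the $E_i$ are pairwise disjoint. A sequence of vectors (or functionals) in $c_{00}$ is admissible/allowable if its sequence of supports is. The mixed Tsirelson space $T[(\mathcal M_k,\theta_k)_{k=1}^\infty]$ is the completion of $c_{00}$ under the norm defined implicitly by $\|x\|=\max\{\|x\|_\infty,\sup_k\theta_k\sup\{\sum_{i=1}^d\|E_ix\|:(E_i)_{i=1}^d\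 \mathcal M_k\text{-admissible}\}\}$. The modified space $T_M[(\mathcal M_k,\theta_k)_{k=1}^\infty]$ is the completion of $c_{00}$ under $\|x\|=\sup_{f\in K}\langle x,f\rangle$, where $K$ is the smallest set of finitely supported functionals containing $\pm e_n$ for all $n$ and containing $\theta_k(f_1+\dots+f_d)$ whenever $k\ge1$, $f_1,\dots,f_d\in K$ and $(f_i)_{i=1}^d$ is $\mathcal M_k$-allowable. The boundedly modified space $T_{M(m)}[(\mathcal M_k,\theta_k)_{k=1}^\infty]$ is defined in the same way, with "$\mathcal M_k$-allowable" required for $k\le m$ and "$\mathcal M_k$-admissible" required for $k\ge m+1$. A sequence $(\theta_n)_{n\ge1}$ is regular if $\theta_n\in(0,1)$ for all $n$, $\theta_n\downarrow0$, and $\theta_{n+m}\ge\theta_n\theta_m$ for all $n,m$. Two Banach spaces are totally incomparable if no infinite dimensional closed subspace of one is isomorphic to a subspace of the other. *)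

theory Defs
  imports "HOL-Analysis.Analysis"
begin

text \<open>
  The index set of all sequences is \<open>{1, 2, \<dots>}\<close>; the coordinate \<open>0\<close> of a function on
  \<^typ>\<open>nat\<close> is unused, and vectors of \<open>c00\<close> vanish there.  Finite sequences of sets or of
  functionals are lists.
\<close>

definition supp :: "(nat \<Rightarrow> real) \<Rightarrow> nat set" where
  "supp x = {i. x i \<noteq> 0}"

definition c00 :: "(nat \<Rightarrow> real) set" where
  "c00 = {x. finite (supp x) \<and> x 0 = 0}"

definition unit_vec :: "nat \<Rightarrow> nat \<Rightarrow> real" where
  "unit_vec n = (\<lambda>i. if i = n then 1 else 0)"

definition restr :: "nat set \<Rightarrow> (nat \<Rightarrow> real) \<Rightarrow> nat \<Rightarrow> real" where
  "restr E x = (\<lambda>i. if i \<in> E then x i else 0)"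

definition sup_norm :: "(nat \<Rightarrow> real) \<Rightarrow> real" where
  "sup_norm x = (SUP i\<in>{1..}. \<bar>x i\<bar>)"

text \<open>The duality pairing; used only for \<open>x\<close> of finite support.\<close>

definition pairing :: "(nat \<Rightarrow> real) \<Rightarrow> (nat \<Rightarrow> real) \<Rightarrow> real" where
  "pairing x f = (\<Sum>i\<in>supp x. x i * f i)"

definition set_less :: "nat set \<Rightarrow> nat set \<Rightarrow> bool" where
  "set_less E F \<longleftrightarrow> E = {} \<or> F = {} \<or> Max E < Min F"

text \<open>
  In the recursion step the sets \<open>A\<^sub>1 < \<dots> < A\<^sub>k\<close> are taken nonempty, so that
  \<open>k \<le> min A\<^sub>1\<close> is meaningful and the chain is increasing; the empty set is
  added separately.
\<close>

primrec schreier :: "nat \<Rightarrow> nat set set" where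
  "schreier 0 = {{}} \<union> {{n} |n. n \<ge> 1}"
| "schreier (Suc n) = {{}} \<union>
     {\<Union>(set As) |As. As \<noteq> [] \<and> (\<forall>A\<in>set As. A \<in> schreier n \<and> A \<noteq> {}) \<and>
        length As \<le> Min (hd As) \<and> sorted_wrt set_less As}"

definition minima_in :: "nat set set \<Rightarrow> nat set list \<Rightarrow> bool" where
  "minima_in M Es \<longleftrightarrow>
     Es \<noteq> [] \<and> (\<forall>E\<in>set Es. finite E \<and> E \<noteq> {} \<and> E \<subseteq> {1..}) \<and> Min ` set Es \<in> M"

definition admissible :: "nat set set \<Rightarrow> nat set list \<Rightarrow> bool" where
  "admissible M Es \<longleftrightarrow> minima_in M Es \<and> sorted_wrt set_less Es"

definition allowable :: "nat set set \<Rightarrow> nat set list \<Rightarrow> bool" where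
  "allowable M Es \<longleftrightarrow> minima_in M Es \<and> sorted_wrt (\<lambda>E F. E \<inter> F = {}) Es"

definition norm_on_c00 :: "((nat \<Rightarrow> real) \<Rightarrow> real) \<Rightarrow> bool" where
  "norm_on_c00 N \<longleftrightarrow>
     (\<forall>x\<in>c00. 0 \<le> N x \<and> (N x = 0 \<longleftrightarrow> x = (\<lambda>_. 0))) \<and>
     (\<forall>x\<in>c00. \<forall>c. N (\<lambda>i. c * x i) = \<bar>c\<bar> * N x) \<and>
     (\<forall>x\<in>c00. \<forall>y\<in>c00. N (\<lambda>i. x i + y i) \<le> N x + N y)"

text \<open>
  The implicit equation of the mixed Tsirelson norm.  If \<open>N\<close> is a norm and \<open>\<theta>\<close> is bounded,
  then for every \<open>x\<close> in \<open>c00\<close> both suprema are over sets that are bounded above, since at most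
  \<open>card (supp x)\<close> of the vectors \<open>restr E x\<close> are nonzero and they are among finitely many.
\<close>

definition mixed_tsirelson_norm ::
  "(nat \<Rightarrow> nat set set) \<Rightarrow> (nat \<Rightarrow> real) \<Rightarrow> ((nat \<Rightarrow> real) \<Rightarrow> real) \<Rightarrow> bool" where
  "mixed_tsirelson_norm M \<theta> N \<longleftrightarrow> norm_on_c00 N \<and>
     (\<forall>x\<in>c00. N x =
        max (sup_norm x)
          (SUP k\<in>{1..}. \<theta> k *
             (SUP Es\<in>{Es. admissible (M k) Es}. \<Sum>E\<leftarrow>Es. N (restr E x))))"

text \<open>
  The parameter \<open>A k\<close> is the condition on the sequence of supports of the functionals that may be
  combined with weight \<open>\<theta> k\<close>.
\<close>

inductive_set norming_set ::
  "(nat \<Rightarrow> nat set list \<Rightarrow> bool) \<Rightarrow> (nat \<Rightarrow> real) \<Rightarrow> (nat \<Rightarrow> real) set"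
  for A :: "nat \<Rightarrow> nat set list \<Rightarrow> bool" and \<theta> :: "nat \<Rightarrow> real" where
  pos_unit: "n \<ge> 1 \<Longrightarrow> unit_vec n \<in> norming_set A \<theta>"
| neg_unit: "n \<ge> 1 \<Longrightarrow> (\<lambda>i. - unit_vec n i) \<in> norming_set A \<theta>"
| combine: "k \<ge> 1 \<Longrightarrow> \<forall>f\<in>set fs. f \<in> norming_set A \<theta> \<Longrightarrow> A k (map supp fs) \<Longrightarrow>
    (\<lambda>i. \<theta> k * (\<Sum>f\<leftarrow>fs. f i)) \<in> norming_set A \<theta>"

definition norm_of_set :: "(nat \<Rightarrow> real) set \<Rightarrow> (nat \<Rightarrow> real) \<Rightarrow> real" where
  "norm_of_set K x = (SUP f\<in>K. pairing x f)"

definition modified_norm ::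
  "(nat \<Rightarrow> nat set set) \<Rightarrow> (nat \<Rightarrow> real) \<Rightarrow> (nat \<Rightarrow> real) \<Rightarrow> real" where
  "modified_norm M \<theta> = norm_of_set (norming_set (\<lambda>k. allowable (M k)) \<theta>)"

definition boundedly_modified_norm ::
  "nat \<Rightarrow> (nat \<Rightarrow> nat set set) \<Rightarrow> (nat \<Rightarrow> real) \<Rightarrow> (nat \<Rightarrow> real) \<Rightarrow> real" where
  "boundedly_modified_norm m M \<theta> =
     norm_of_set (norming_set (\<lambda>k. if k \<le> m then allowable (M k) else admissible (M k)) \<theta>)"

text \<open>
  A Banach space is represented by a closed linear subspace of a type of class
  \<^class>\<open>banach\<close>: the completions depend on \<open>\<theta>\<close> and hence cannot be types themselves.
  A completion of \<open>c00\<close> is determined up to isometric isomorphism, and, being separable, has a copy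
  inside the space of bounded sequences.
\<close>

definition completion_of_c00 :: "((nat \<Rightarrow> real) \<Rightarrow> real) \<Rightarrow> 'a::banach set \<Rightarrow> bool" where
  "completion_of_c00 N X \<longleftrightarrow>
     (\<exists>J :: (nat \<Rightarrow> real) \<Rightarrow> 'a.
        (\<forall>x\<in>c00. \<forall>y\<in>c00. J (\<lambda>i. x i + y i) = J x + J y) \<and>
        (\<forall>x\<in>c00. \<forall>c. J (\<lambda>i. c * x i) = c *\<^sub>R J x) \<and>
        (\<forall>x\<in>c00. norm (J x) = N x) \<and>
        X = closure (J ` c00))"

definition mixed_tsirelson_space ::
  "(nat \<Rightarrow> nat set set) \<Rightarrow> (nat \<Rightarrow> real) \<Rightarrow> 'a::banach set \<Rightarrow> bool" where
  "mixed_tsirelson_space M \<theta> X \<longleftrightarrow>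
     (\<exists>N. mixed_tsirelson_norm M \<theta> N \<and> completion_of_c00 N X)"

definition modified_space ::
  "(nat \<Rightarrow> nat set set) \<Rightarrow> (nat \<Rightarrow> real) \<Rightarrow> 'a::banach set \<Rightarrow> bool" where
  "modified_space M \<theta> X \<longleftrightarrow> completion_of_c00 (modified_norm M \<theta>) X"

definition boundedly_modified_space ::
  "nat \<Rightarrow> (nat \<Rightarrow> nat set set) \<Rightarrow> (nat \<Rightarrow> real) \<Rightarrow> 'a::banach set \<Rightarrow> bool" where
  "boundedly_modified_space m M \<theta> X \<longleftrightarrow> completion_of_c00 (boundedly_modified_norm m M \<theta>) X"

definition regular_seq :: "(nat \<Rightarrow> real) \<Rightarrow> bool" where
  "regular_seq \<theta> \<longleftrightarrow>
     (\<forall>n\<ge>1. 0 < \<theta> n \<and> \<theta> n < 1) \<and>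
     (\<forall>n\<ge>1. \<theta> (Suc n) \<le> \<theta> n) \<and> \<theta> \<longlonglongrightarrow> 0 \<and>
     (\<forall>n\<ge>1. \<forall>m\<ge>1. \<theta> (n + m) \<ge> \<theta> n * \<theta> m)"

definition infinite_dimensional :: "'a::real_vector set \<Rightarrow> bool" where
  "infinite_dimensional Y \<longleftrightarrow> \<not> (\<exists>B. finite B \<and> span B = Y)"

definition isomorphic_subspaces ::
  "'a::real_normed_vector set \<Rightarrow> 'b::real_normed_vector set \<Rightarrow> bool" where
  "isomorphic_subspaces Y Z \<longleftrightarrow>
     (\<exists>f g. homeomorphism Y Z f g \<and>
        (\<forall>x\<in>Y. \<forall>y\<in>Y. f (x + y) = f x + f y) \<and> (\<forall>x\<in>Y. \<forall>c. f (c *\<^sub>R x) = c *\<^sub>R f x))"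

definition embeds_inf_dim_subspace :: "'a::banach set \<Rightarrow> 'b::banach set \<Rightarrow> bool" where
  "embeds_inf_dim_subspace X W \<longleftrightarrow>
     (\<exists>Y Z. Y \<subseteq> X \<and> subspace Y \<and> closed Y \<and> infinite_dimensional Y \<and>
        Z \<subseteq> W \<and> subspace Z \<and> isomorphic_subspaces Y Z)"

definition totally_incomparable :: "'a::banach set \<Rightarrow> 'b::banach set \<Rightarrow> bool" where
  "totally_incomparable X W \<longleftrightarrow>
     \<not> embeds_inf_dim_subspace X W \<and> \<not> embeds_inf_dim_subspace W X"

end

theory Submission
  imports Defs
begin

text \<open>
  In \<open>X\<close>, any \<open>n\<close> disjointly supported vectors supported after \<open>n\<close> satisfy a lower
  \<open>\<ell>\<^sub>1\<close> estimate with constant \<open>\<theta> 1\<close>.  Every block subspace of \<open>T\<close>, in contrast, contains disjointly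
  supported vectors \<open>y 0, \<dots>, y (n - 1)\<close> of norm at least \<open>1/4\<close> whose sum has norm \<open>o(n)\<close>.  A gliding
  hump turns isomorphic infinite-dimensional subspaces into equivalent block sequences, for which the
  two facts contradict each other.

  The vectors \<open>y i\<close> are built from a sequence \<open>z\<close> of averages of rapidly increasing order and norm at
  least \<open>1/2\<close>: a functional of weight \<open>w\<close> is at most about \<open>2 * \<theta> w\<close> on all \<open>z k\<close> but one, so a
  \<open>z\<close>-average of order \<open>m\<close> has norm about \<open>\<theta> m\<close>.  On such an average, divided by \<open>\<theta> m\<close>, a tree functional
  whose order first reaches the level \<open>w0\<close> with the value \<open>v\<close> is at most about
  \<open>2 * \<theta> v * \<theta> (m - v) / \<theta> m\<close>.  As \<open>\<theta> n powr (1 / n)\<close> tends to \<open>1\<close>, there are lacunary orders \<open>m\<close> such that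
  for every \<open>v\<close> this ratio is small for all of them but one.  The nodes at level \<open>w0\<close> have successive
  ranges, so they cannot separate averages of these orders that interlace over common cells, and only
  one average counts on each range.
\<close>

section \<open>Schreier families\<close>

text \<open>The obstacle is that \<open>T\<close> also satisfies the lower l1 estimate, with the
  same constant \<open>\<theta> 1\<close>, for \<open>n\<close> successive vectors supported after
  \<open>n\<close>. Disjoint vectors whose sum is small must therefore interlace, and an upper bound
  must hold for all functionals on all of them at once. A functional that does well on one
  \<open>y i\<close> has its order in a window belonging to \<open>i\<close>, and these windows are
  disjoint. Moving from one window to another takes a new node at level \<open>w0\<close>. The first
  points of these nodes form a set of order \<open>w0 - 1\<close>, and the outer average of order
  \<open>w0\<close> over the cells gives the cells met by such a set only mass \<open>th w0\<close>.
  The price of this outer average, the step from order \<open>nn i\<close> to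
  \<open>nn i + w0\<close>, is paid in advance when the orders are chosen.

  The limit hypothesis enters through one consequence only: for fixed \<open>m\<close> and
  \<open>R \<ge> 1\<close> the numbers \<open>2 ^ k * \<theta> (m + k * R)\<close> are unbounded in
  \<open>k\<close>. It produces both the averages of norm at least \<open>1/2\<close> and the
  windows. The number \<open>n\<close> has to be fixed before the subspace, because the block
  subspace to which the construction is applied starts after \<open>n\<close>.\<close>

lemma schreier_finite: "A \<in> schreier n \<Longrightarrow> finite A"
proof (induction n arbitrary: A)
  case 0
  then show ?case by auto
next
  case (Suc n)
  then show ?case by auto
qed

lemma schreier_pos: "A \<in> schreier n \<Longrightarrow> A \<subseteq> {1..}"
proof (induction n arbitrary: A)
  case 0
  then show ?case by auto
next
  case (Suc n)
  show ?case
  proof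
    fix x assume "x \<in> A"
    then obtain B where "x \<in> B" "B \<in> schreier n" using Suc.prems by auto
    then show "x \<in> {1..}" using Suc.IH by blast
  qed
qed

lemma empty_in_schreier [simp]: "{} \<in> schreier n"
  by (cases n) auto

lemma schreier_SucI:
  assumes "A \<in> schreier n" shows "A \<in> schreier (Suc n)"
proof (cases "A = {}")
  case False
  have "1 \<le> Min A" using schreier_pos[OF assms] schreier_finite[OF assms] False by auto
  then have "A = \<Union>(set [A])" "length [A] \<le> Min (hd [A])" by auto
  then show ?thesis using assms False
    by (simp del: set_simps) (intro disjI2 exI[of _ "[A]"], auto)
qed simp

lemma schreier_mono: "m \<le> n \<Longrightarrow> A \<in> schreier m \<Longrightarrow> A \<in> schreier n"
  by (induction n rule: dec_induct) (auto simp del: schreier.simps intro: schreier_SucI)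

lemma singleton_schreier: "n \<ge> 1 \<Longrightarrow> {n} \<in> schreier k"
  by (rule schreier_mono[of 0]) auto

lemma schreier_oneI:
  assumes "finite D" "D \<subseteq> {1..}" "D \<subseteq> {card D..}"
  shows "D \<in> schreier 1"
proof (cases "D = {}")
  case False
  define ys where "ys = sorted_list_of_set D"
  have ne: "ys \<noteq> []" using assms(1) False by (simp add: ys_def)
  have "D = \<Union>(set (map (\<lambda>y. {y}) ys))" using assms(1) by (auto simp: ys_def)
  moreover have "map (\<lambda>y. {y}) ys \<noteq> []" using ne by simp
  moreover have "\<forall>A\<in>set (map (\<lambda>y. {y}) ys). A \<in> schreier 0 \<and> A \<noteq> {}"
    using assms by (auto simp: ys_def)
  moreover have "length (map (\<lambda>y. {y}) ys) \<le> Min (hd (map (\<lambda>y. {y}) ys))"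
  proof -
    have "hd ys \<in> D" using ne assms(1) hd_in_set[of ys] by (simp add: ys_def)
    then have "card D \<le> hd ys" using assms(3) by auto
    then show ?thesis using ne assms(1) by (simp add: hd_map ys_def)
  qed
  moreover have "sorted_wrt set_less (map (\<lambda>y. {y}) ys)"
    unfolding sorted_wrt_map set_less_def ys_def by simp
  ultimately show ?thesis unfolding One_nat_def schreier.simps(2) by blast
qed simp

text \<open>A point \<open>m\<close> of a set of order \<open>w\<close> may be replaced by a set of
  order \<open>s\<close> that begins at or after \<open>m\<close>, as long as the order is kept; the
  two orders then add up. The bound \<open>length Ds \<le> Min (hd Ds)\<close> survives because the
  first union begins no earlier than the first set. Every later count of orders rests on
  this.\<close>

lemma schreier_compose_elements:
  assumes "D \<in> schreier w"
    and "\<And>m. m \<in> D \<Longrightarrow> A m \<in> schreier s \<and> A m \<noteq> {} \<and> m \<le> Min (A m)"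
    and "\<And>m m'. m \<in> D \<Longrightarrow> m' \<in> D \<Longrightarrow> m < m' \<Longrightarrow> Max (A m) < Min (A m')"
  shows "(\<Union>m\<in>D. A m) \<in> schreier (w + s)"
  using assms
proof (induction w arbitrary: D)
  case 0
  then show ?case by auto
next
  case (Suc w)
  show ?case
  proof (cases "D = {}")
    case False
    then obtain Ds where Ds: "D = \<Union>(set Ds)" "Ds \<noteq> []" "\<forall>D\<in>set Ds. D \<in> schreier w \<and> D \<noteq> {}"
      "length Ds \<le> Min (hd Ds)" "sorted_wrt set_less Ds"
      using Suc.prems(1) by auto
    define U where "U D = (\<Union>m\<in>D. A m)" for D
    have finA: "finite (A m)" if "m \<in> D" for m using Suc.prems(2)[OF that] schreier_finite by auto
    have finD: "finite D'" if "D' \<in> set Ds" for D' using Ds(3) that schreier_finite by auto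
    have finU: "finite (U D')" if "D' \<in> set Ds" for D'
      unfolding U_def using finD[OF that] finA Ds(1) that by auto
    have neU: "U D' \<noteq> {}" if "D' \<in> set Ds" for D'
      using Suc.prems(2) Ds(1,3) that unfolding U_def by fastforce
    have mem: "U D' \<in> schreier (w + s)" if "D' \<in> set Ds" for D'
      unfolding U_def
    proof (rule Suc.IH)
      show "D' \<in> schreier w" using Ds(3) that by auto
      have sub: "m \<in> D" if "m \<in> D'" for m using that Ds(1) \<open>D' \<in> set Ds\<close> by auto
      show "\<And>m. m \<in> D' \<Longrightarrow> A m \<in> schreier s \<and> A m \<noteq> {} \<and> m \<le> Min (A m)"
        using Suc.prems(2) sub by blast
      show "\<And>m m'. m \<in> D' \<Longrightarrow> m' \<in> D' \<Longrightarrow> m < m' \<Longrightarrow> Max (A m) < Min (A m')"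
        using Suc.prems(3) sub by blast
    qed
    have "sorted_wrt set_less (map U Ds)"
      unfolding sorted_wrt_map
    proof (rule sorted_wrt_mono_rel[OF _ Ds(5)])
      fix x y assume xy: "x \<in> set Ds" "y \<in> set Ds" "set_less x y"
      have "Max x < Min y" using xy Ds(3) by (auto simp: set_less_def)
      have "a < b" if ab: "a \<in> U x" "b \<in> U y" for a b
      proof -
        from ab obtain m m' where m: "m \<in> x" "a \<in> A m" "m' \<in> y" "b \<in> A m'"
          unfolding U_def by auto
        have "m \<le> Max x" "Min y \<le> m'" using m finD xy by auto
        then have "m < m'" using \<open>Max x < Min y\<close> by simp
        moreover have "m \<in> D" "m' \<in> D" using m xy Ds(1) by auto
        ultimately have "Max (A m) < Min (A m')" using Suc.prems(3) by auto
        moreover have "a \<le> Max (A m)" "Min (A m') \<le> b" using m finA \<open>m \<in> D\<close> \<open>m' \<in> D\<close> by auto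
        ultimately show ?thesis by simp
      qed
      then show "set_less (U x) (U y)"
        using finU neU xy unfolding set_less_def by auto
    qed
    moreover have "length (map U Ds) \<le> Min (hd (map U Ds))"
    proof -
      have hd: "hd Ds \<in> set Ds" using Ds(2) by simp
      have "Min (hd Ds) \<le> b" if "b \<in> U (hd Ds)" for b
      proof -
        from that obtain m where m: "m \<in> hd Ds" "b \<in> A m" unfolding U_def by auto
        have mD: "m \<in> D" using m hd Ds(1) by auto
        have "Min (hd Ds) \<le> m" using m finD[OF hd] by simp
        also have "m \<le> Min (A m)" using Suc.prems(2)[OF mD] by simp
        also have "Min (A m) \<le> b" using m finA[OF mD] by simp
        finally show ?thesis .
      qed
      then have "Min (hd Ds) \<le> Min (U (hd Ds))" using finU[OF hd] neU[OF hd] by simp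
      then show ?thesis using Ds(2,4) by (simp add: hd_map)
    qed
    moreover have "(\<Union>m\<in>D. A m) = \<Union>(set (map U Ds))" using Ds(1) unfolding U_def by auto
    moreover have "map U Ds \<noteq> []" "\<forall>A\<in>set (map U Ds). A \<in> schreier (w + s) \<and> A \<noteq> {}"
      using Ds(2) mem neU by auto
    ultimately show ?thesis unfolding add_Suc schreier.simps by blast
  qed simp
qed

text \<open>Version with separate marks \<open>m i\<close>, which in the applications are minima of
  supports or left ends of blocks and cells.\<close>

lemma schreier_compose:
  assumes "inj_on m I" and "m ` I \<in> schreier w"
    and "\<And>i. i \<in> I \<Longrightarrow> A i \<in> schreier s \<and> A i \<noteq> {} \<and> m i \<le> Min (A i)"
    and "\<And>i j. i \<in> I \<Longrightarrow> j \<in> I \<Longrightarrow> m i < m j \<Longrightarrow> Max (A i) < Min (A j)"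
  shows "(\<Union>i\<in>I. A i) \<in> schreier (w + s)"
proof -
  have inv: "the_inv_into I m (m i) = i" if "i \<in> I" for i
    using assms(1) that by (simp add: the_inv_into_f_f)
  have "(\<Union>d\<in>m ` I. A (the_inv_into I m d)) \<in> schreier (w + s)"
    by (rule schreier_compose_elements[OF assms(2)]) (use assms(3,4) inv in auto)
  then show ?thesis using inv by auto
qed

lemma schreier_spread_mono:
  assumes "A \<in> schreier k" "strict_mono_on A \<phi>" "\<And>a. a \<in> A \<Longrightarrow> a \<le> \<phi> a"
  shows "\<phi> ` A \<in> schreier k"
proof -
  have "(\<Union>a\<in>A. {\<phi> a}) \<in> schreier (k + 0)"
    using assms schreier_pos[OF assms(1)]
    by (intro schreier_compose_elements) (auto simp: strict_mono_on_def, fastforce)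
  then show ?thesis by (simp add: UNION_singleton_eq_range)
qed

lemma schreier_SucE:
  assumes "A \<in> schreier (Suc n)" "A \<noteq> {}"
  obtains As where "A = \<Union>(set As)" "\<And>B. B \<in> set As \<Longrightarrow> B \<in> schreier n"
    "\<And>a. a \<in> A \<Longrightarrow> length As \<le> a" "\<And>i j. i < j \<Longrightarrow> j < length As \<Longrightarrow> Max (As ! i) < Min (As ! j)"
proof -
  from assms obtain As where As: "A = \<Union>(set As)" "As \<noteq> []" "\<forall>A\<in>set As. A \<in> schreier n \<and> A \<noteq> {}"
      "length As \<le> Min (hd As)" "sorted_wrt set_less As"
    by auto
  have fin: "finite B" if "B \<in> set As" for B using As(3) that schreier_finite by auto
  have less: "Max (As ! i) < Min (As ! j)" if "i < j" "j < length As" for i j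
  proof -
    have "set_less (As ! i) (As ! j)" using As(5) that by (simp add: sorted_wrt_nth_less)
    moreover have "As ! i \<noteq> {}" "As ! j \<noteq> {}" using As(3) that by auto
    ultimately show ?thesis by (simp add: set_less_def)
  qed
  have "length As \<le> a" if "a \<in> A" for a
  proof -
    obtain i where i: "i < length As" "a \<in> As ! i"
      using \<open>a \<in> A\<close> unfolding As(1) by (auto simp: in_set_conv_nth)
    have hd: "hd As = As ! 0" "hd As \<in> set As" using As(2) by (auto simp: hd_conv_nth)
    have "Min (As ! i) \<le> a" using fin i by auto
    moreover have "Min (hd As) \<le> Min (As ! i)"
    proof (cases "i = 0")
      case False
      have "Min (hd As) \<le> Max (hd As)" using As(3) hd fin by auto
      then show ?thesis using less[of 0 i] False i hd by simp
    qed (use hd in simp)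
    ultimately show ?thesis using As(4) by simp
  qed
  then show thesis using As(1,3) less by (intro that[of As]) auto
qed

text \<open>At most \<open>length As\<close> pieces of \<open>A\<close> meet \<open>B\<close>, and
  every point of \<open>A\<close> is at least \<open>length As\<close>. The minima of the nonempty
  traces on \<open>B\<close> thus form a set of order 1, and composing it with the traces gives
  order \<open>1 + n\<close>.\<close>

lemma schreier_hereditary: "A \<in> schreier n \<Longrightarrow> B \<subseteq> A \<Longrightarrow> B \<in> schreier n"
proof (induction n arbitrary: A B)
  case 0
  then show ?case by auto
next
  case (Suc n)
  show ?case
  proof (cases "A = {}")
    case False
    obtain As where As: "A = \<Union>(set As)" "\<And>B. B \<in> set As \<Longrightarrow> B \<in> schreier n"
      "\<And>a. a \<in> A \<Longrightarrow> length As \<le> a" "\<And>i j. i < j \<Longrightarrow> j < length As \<Longrightarrow> Max (As ! i) < Min (As ! j)"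
      using schreier_SucE[OF Suc.prems(1) False] by blast
    define I where "I = {i. i < length As \<and> As ! i \<inter> B \<noteq> {}}"
    have part: "finite (As ! i \<inter> B)" "Min (As ! i \<inter> B) \<in> As ! i \<inter> B" if "i \<in> I" for i
    proof -
      have "As ! i \<in> set As" "As ! i \<inter> B \<noteq> {}" using that by (auto simp: I_def)
      then show "finite (As ! i \<inter> B)" "Min (As ! i \<inter> B) \<in> As ! i \<inter> B"
        using schreier_finite[OF As(2)] Min_in[of "As ! i \<inter> B"] by auto
    qed
    have less: "Max (As ! i \<inter> B) < Min (As ! j \<inter> B)" if "i \<in> I" "j \<in> I" "i < j" for i j
    proof -
      have ij: "i < length As" "j < length As" using that by (auto simp: I_def)
      have "finite (As ! i)" "finite (As ! j)" using ij As(2) schreier_finite nth_mem by blast+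
      then have "Max (As ! i \<inter> B) \<le> Max (As ! i)" "Min (As ! j) \<le> Min (As ! j \<inter> B)"
        using that by (auto simp: I_def intro!: Max_mono Min_antimono)
      then show ?thesis using As(4)[OF that(3) ij(2)] by linarith
    qed
    have lt: "Min (As ! i \<inter> B) < Min (As ! j \<inter> B)" if "i \<in> I" "j \<in> I" "i < j" for i j
      using less[OF that] Max_ge[OF part(1)[OF that(1)] part(2)[OF that(1)]] by linarith
    have "(\<Union>i\<in>I. As ! i \<inter> B) \<in> schreier (1 + n)"
    proof (rule schreier_compose)
      show "inj_on (\<lambda>i. Min (As ! i \<inter> B)) I"
      proof (rule inj_onI)
        fix i j assume "i \<in> I" "j \<in> I" "Min (As ! i \<inter> B) = Min (As ! j \<inter> B)"
        then show "i = j" using lt[of i j] lt[of j i] by (cases i j rule: linorder_cases) simp_all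
      qed
      have mem: "Min (As ! i \<inter> B) \<in> A" if "i \<in> I" for i using part(2)[OF that] Suc.prems(2) by auto
      have "card ((\<lambda>i. Min (As ! i \<inter> B)) ` I) \<le> card I" by (rule card_image_le) (simp add: I_def)
      also have "\<dots> \<le> length As" using card_mono[of "{..<length As}" I] by (auto simp: I_def)
      finally show "(\<lambda>i. Min (As ! i \<inter> B)) ` I \<in> schreier 1"
        using mem schreier_pos[OF Suc.prems(1)] As(3) by (intro schreier_oneI) (auto simp: I_def intro: order_trans)
      fix i assume i: "i \<in> I"
      then have "As ! i \<in> schreier n" using As(2) by (simp add: I_def)
      then show "As ! i \<inter> B \<in> schreier n \<and> As ! i \<inter> B \<noteq> {} \<and> Min (As ! i \<inter> B) \<le> Min (As ! i \<inter> B)"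
        using Suc.IH[of "As ! i" "As ! i \<inter> B"] i by (simp add: I_def)
      fix j assume j: "j \<in> I" "Min (As ! i \<inter> B) < Min (As ! j \<inter> B)"
      have "i < j"
      proof (rule ccontr)
        assume "\<not> i < j"
        then have "i = j \<or> j < i" by linarith
        then show False using lt[OF j(1) i] j(2) by (metis order_less_asym order_less_irrefl)
      qed
      then show "Max (As ! i \<inter> B) < Min (As ! j \<inter> B)" by (rule less[OF i j(1)])
    qed
    moreover have "(\<Union>i\<in>I. As ! i \<inter> B) = B"
      using Suc.prems(2) unfolding As(1) I_def by (fastforce simp: in_set_conv_nth)
    ultimately show ?thesis by (simp del: schreier.simps)
  qed (use Suc.prems in simp)
qed

lemma strict_mono_rearrangement:
  fixes A :: "nat set"
  assumes "finite A" "inj_on \<phi> A" "\<And>a. a \<in> A \<Longrightarrow> a \<le> \<phi> a"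
  shows "\<exists>\<psi>. strict_mono_on A \<psi> \<and> \<psi> ` A = \<phi> ` A \<and> (\<forall>a\<in>A. a \<le> \<psi> a)"
  using assms
proof (induction A arbitrary: \<phi> rule: finite_linorder_max_induct)
  case empty
  then show ?case by (auto simp: strict_mono_on_def)
next
  case (insert b A)
  define M where "M = Max (\<phi> ` insert b A)"
  have M: "\<phi> a \<le> M" if "a \<in> insert b A" for a unfolding M_def using insert.hyps(1) that by (intro Max_ge) auto
  have "M \<in> \<phi> ` insert b A" unfolding M_def using insert.hyps(1) by (intro Max_in) auto
  then obtain a0 where a0: "a0 \<in> insert b A" "\<phi> a0 = M" by blast
  have bA: "b \<notin> A" using insert.hyps(2) by blast
  define \<phi>' where "\<phi>' = (\<lambda>a. if a = a0 then \<phi> b else \<phi> a)"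
  have inj: "\<phi> x = \<phi> y \<longleftrightarrow> x = y" if "x \<in> insert b A" "y \<in> insert b A" for x y
    using insert.prems(1) that by (meson inj_on_eq_iff)
  have img: "\<phi>' ` A = \<phi> ` insert b A - {M}"
  proof
    show "\<phi>' ` A \<subseteq> \<phi> ` insert b A - {M}" using inj a0 bA by (auto simp: \<phi>'_def)
    show "\<phi> ` insert b A - {M} \<subseteq> \<phi>' ` A"
    proof
      fix x assume "x \<in> \<phi> ` insert b A - {M}"
      then obtain a where a: "a \<in> insert b A" "x = \<phi> a" "a \<noteq> a0" using a0 by blast
      show "x \<in> \<phi>' ` A"
      proof (cases "a = b")
        case True
        then have "x = \<phi>' a0" "a0 \<in> A" using a a0 by (auto simp: \<phi>'_def)
        then show ?thesis by blast
      next
        case False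
        then have "x = \<phi>' a" "a \<in> A" using a by (auto simp: \<phi>'_def)
        then show ?thesis by blast
      qed
    qed
  qed
  have "inj_on \<phi>' A"
    using inj a0(1) bA by (auto simp: inj_on_def \<phi>'_def)
  moreover have "a \<le> \<phi>' a" if "a \<in> A" for a
    using insert.prems(2)[of a] insert.prems(2)[of b] insert.hyps(2) that by (auto simp: \<phi>'_def)
  ultimately obtain \<psi> where \<psi>: "strict_mono_on A \<psi>" "\<psi> ` A = \<phi>' ` A" "\<forall>a\<in>A. a \<le> \<psi> a"
    using insert.IH[of \<phi>'] by blast
  have "\<psi> a < M" if "a \<in> A" for a
  proof -
    have "\<psi> a \<in> \<phi> ` insert b A - {M}" using \<psi>(2) img that by blast
    then show ?thesis using M by fastforce
  qed
  then have "strict_mono_on (insert b A) (\<psi>(b := M))"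
    using \<psi>(1) insert.hyps(2) by (auto simp: strict_mono_on_def)
  moreover have "(\<psi>(b := M)) ` insert b A = \<phi> ` insert b A"
    using \<psi>(2) img bA \<open>M \<in> \<phi> ` insert b A\<close> by auto
  moreover have "\<forall>a\<in>insert b A. a \<le> (\<psi>(b := M)) a"
    using \<psi>(3) bA insert.prems(2)[of b] M[of b] by auto
  ultimately show ?case by blast
qed

text \<open>Monotonicity of \<open>\<phi>\<close> would be too much to ask: when disjoint sets that
  are not successive shrink, their minima move to the right and stay distinct, but may change their
  order.\<close>

lemma schreier_spread:
  assumes "A \<in> schreier k" "inj_on \<phi> A" "\<And>a. a \<in> A \<Longrightarrow> a \<le> \<phi> a"
  shows "\<phi> ` A \<in> schreier k"
proof -
  obtain \<psi> where "strict_mono_on A \<psi>" "\<psi> ` A = \<phi> ` A" "\<forall>a\<in>A. a \<le> \<psi> a"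
    using strict_mono_rearrangement[OF schreier_finite] assms by blast
  then show ?thesis using schreier_spread_mono[OF assms(1), of \<psi>] by simp
qed

section \<open>Norming sets\<close>

lemma supp_restr: "supp (restr E x) = supp x \<inter> E"
  by (auto simp: supp_def restr_def)

lemma finite_supp: "x \<in> c00 \<Longrightarrow> finite (supp x)"
  by (simp add: c00_def)

lemma supp_pos: "x \<in> c00 \<Longrightarrow> supp x \<subseteq> {1..}"
  unfolding c00_def supp_def by (auto simp: Suc_le_eq intro!: gr0I)

lemma supp_eq_empty: "supp x = {} \<longleftrightarrow> x = (\<lambda>_. 0)"
  by (auto simp: supp_def)

lemma c00_zero: "(\<lambda>_. 0) \<in> c00"
  by (auto simp: c00_def supp_def)

lemma c00_scale: "x \<in> c00 \<Longrightarrow> (\<lambda>i. c * x i) \<in> c00"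
  unfolding c00_def supp_def by (auto elim: rev_finite_subset)

lemma c00_add: "x \<in> c00 \<Longrightarrow> y \<in> c00 \<Longrightarrow> (\<lambda>i. x i + y i) \<in> c00"
  unfolding c00_def supp_def
  by (auto intro: finite_subset[of _ "{i. x i \<noteq> 0} \<union> {i. y i \<noteq> 0}"])

lemma c00_sum: "finite S \<Longrightarrow> (\<And>k. k \<in> S \<Longrightarrow> x k \<in> c00) \<Longrightarrow> (\<lambda>i. \<Sum>k\<in>S. x k i) \<in> c00"
  by (induction S rule: finite_induct) (auto simp: c00_zero c00_add)

lemma c00_lincomb: "finite S \<Longrightarrow> (\<And>k. k \<in> S \<Longrightarrow> x k \<in> c00) \<Longrightarrow> (\<lambda>i. \<Sum>k\<in>S. d k * x k i) \<in> c00"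
  using c00_sum[of S "\<lambda>k i. d k * x k i"] c00_scale by auto

lemma c00_restr: "x \<in> c00 \<Longrightarrow> restr E x \<in> c00"
  unfolding c00_def by (auto simp: supp_restr) (auto simp: restr_def)

lemma c00_unit_vec: "n \<ge> 1 \<Longrightarrow> unit_vec n \<in> c00"
  by (auto simp: c00_def supp_def unit_vec_def)

lemma pairing_superset: "finite S \<Longrightarrow> supp x \<subseteq> S \<Longrightarrow> pairing x f = (\<Sum>i\<in>S. x i * f i)"
  unfolding pairing_def by (rule sum.mono_neutral_left) (auto simp: supp_def)

lemma pairing_lincomb:
  assumes "finite S" "\<And>k. k \<in> S \<Longrightarrow> x k \<in> c00"
  shows "pairing (\<lambda>i. \<Sum>k\<in>S. d k * x k i) f = (\<Sum>k\<in>S. d k * pairing (x k) f)"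
proof -
  define U where "U = (\<Union>k\<in>S. supp (x k))"
  have fin: "finite U" using assms finite_supp by (auto simp: U_def)
  have sub: "supp (\<lambda>i. \<Sum>k\<in>S. d k * x k i) \<subseteq> U"
  proof
    fix i assume "i \<in> supp (\<lambda>i. \<Sum>k\<in>S. d k * x k i)"
    then obtain k where "k \<in> S" "d k * x k i \<noteq> 0"
      by (auto simp: supp_def elim: sum.not_neutral_contains_not_neutral)
    then show "i \<in> U" by (auto simp: U_def supp_def)
  qed
  have "pairing (\<lambda>i. \<Sum>k\<in>S. d k * x k i) f = (\<Sum>i\<in>U. (\<Sum>k\<in>S. d k * x k i) * f i)"
    by (rule pairing_superset[OF fin sub])
  also have "\<dots> = (\<Sum>k\<in>S. \<Sum>i\<in>U. d k * x k i * f i)"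
    by (simp add: sum_distrib_right sum.swap[of _ S])
  also have "\<dots> = (\<Sum>k\<in>S. d k * pairing (x k) f)"
  proof (rule sum.cong[OF refl])
    fix k assume "k \<in> S"
    then have "pairing (x k) f = (\<Sum>i\<in>U. x k i * f i)"
      by (intro pairing_superset[OF fin]) (auto simp: U_def)
    then show "(\<Sum>i\<in>U. d k * x k i * f i) = d k * pairing (x k) f"
      by (simp add: sum_distrib_left mult.assoc)
  qed
  finally show ?thesis .
qed

lemma pairing_functional_lincomb:
  "pairing x (\<lambda>i. c * (\<Sum>f\<leftarrow>fs. f i)) = c * (\<Sum>f\<leftarrow>fs. pairing x f)"
  unfolding pairing_def
  by (induction fs) (simp_all add: distrib_left sum.distrib sum_distrib_left mult.left_commute algebra_simps)

lemma pairing_restr: "x \<in> c00 \<Longrightarrow> pairing x (restr E f) = pairing (restr E x) f"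
  using pairing_superset[of "supp x" "restr E x" f] finite_supp[of x]
  unfolding supp_restr by (auto simp: pairing_def restr_def intro!: sum.cong)

lemma pairing_eq_zero: "supp x \<inter> supp f = {} \<Longrightarrow> pairing x f = 0"
  unfolding pairing_def by (rule sum.neutral) (auto simp: supp_def)

lemma restr_superset: "supp x \<subseteq> E \<Longrightarrow> restr E x = x"
  by (auto simp: restr_def supp_def fun_eq_iff)

text \<open>The norming sets of the mixed space and of both modified spaces have this property.\<close>

definition schreier_condition :: "(nat \<Rightarrow> nat set list \<Rightarrow> bool) \<Rightarrow> bool" where
  "schreier_condition A \<longleftrightarrow> (\<forall>k. A k = allowable (schreier k) \<or> A k = admissible (schreier k))"

lemma admissible_imp_allowable: "admissible M Es \<Longrightarrow> allowable M Es"
  unfolding admissible_def allowable_def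
proof (intro conjI, simp, elim conjE)
  assume m: "minima_in M Es" and s: "sorted_wrt set_less Es"
  show "sorted_wrt (\<lambda>E F. E \<inter> F = {}) Es"
  proof (rule sorted_wrt_mono_rel[OF _ s])
    fix x y assume "x \<in> set Es" "y \<in> set Es" "set_less x y"
    then have "finite x" "finite y" "Max x < Min y" using m by (auto simp: minima_in_def set_less_def)
    then show "x \<inter> y = {}" by (meson Max_ge Min_le disjoint_iff le_trans not_le)
  qed
qed

locale norming =
  fixes A :: "nat \<Rightarrow> nat set list \<Rightarrow> bool" and \<theta> :: "nat \<Rightarrow> real"
  assumes A: "schreier_condition A"
    and theta: "\<And>k. k \<ge> 1 \<Longrightarrow> 0 < \<theta> k \<and> \<theta> k < 1"
begin

abbreviation K where "K \<equiv> norming_set A \<theta>"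

lemma A_allowable: "A k Es \<Longrightarrow> allowable (schreier k) Es"
  using A admissible_imp_allowable unfolding schreier_condition_def by metis

lemma abs_le_one_and_supp:
  "f \<in> K \<Longrightarrow> (\<forall>i. \<bar>f i\<bar> \<le> 1) \<and> finite (supp f) \<and> supp f \<noteq> {} \<and> supp f \<subseteq> {1..}"
proof (induction rule: norming_set.induct)
  case (combine k fs)
  have al: "allowable (schreier k) (map supp fs)" using A_allowable combine by blast
  then have ne: "fs \<noteq> []" by (auto simp: allowable_def minima_in_def)
  have disj: "sorted_wrt (\<lambda>f g. supp f \<inter> supp g = {}) fs"
    using al by (simp add: allowable_def sorted_wrt_map)
  \<comment> \<open>Disjoint supports leave at most one nonzero summand at each coordinate. The last
    conjunct excludes cancellation, so that the support of the sum is the whole union.\<close>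
  have single: "\<exists>g. (g = 0 \<or> (\<exists>f\<in>set fs. g = f i)) \<and> (\<Sum>f\<leftarrow>fs. f i) = g \<and> (\<forall>f\<in>set fs. f i \<noteq> 0 \<longrightarrow> g \<noteq> 0)" for i
    using disj
  proof (induction fs)
    case (Cons a fs)
    show ?case
    proof (cases "a i = 0")
      case True
      then show ?thesis using Cons by auto
    next
      case False
      then have "\<forall>f\<in>set fs. f i = 0" using Cons.prems by (auto simp: supp_def)
      then have "(\<Sum>f\<leftarrow>fs. f i) = 0" by (induction fs) auto
      then show ?thesis using False by auto
    qed
  qed simp
  have le: "\<bar>\<Sum>f\<leftarrow>fs. f i\<bar> \<le> 1" for i
  proof -
    have "\<forall>f\<in>set fs. \<bar>f i\<bar> \<le> 1" using combine.IH by blast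
    then show ?thesis using single[of i] by force
  qed
  have supp: "supp (\<lambda>i. \<theta> k * (\<Sum>f\<leftarrow>fs. f i)) = (\<Union>f\<in>set fs. supp f)"
  proof -
    have "\<theta> k \<noteq> 0" using theta combine.hyps(1) by force
    then show ?thesis using single by (auto simp: supp_def) metis+
  qed
  have "\<bar>\<theta> k * (\<Sum>f\<leftarrow>fs. f i)\<bar> \<le> 1" for i
    using theta[OF combine.hyps(1)] le[of i] by (simp add: abs_mult mult_le_one)
  moreover have "finite (supp (\<lambda>i. \<theta> k * (\<Sum>f\<leftarrow>fs. f i)))" "supp (\<lambda>i. \<theta> k * (\<Sum>f\<leftarrow>fs. f i)) \<noteq> {}"
    "supp (\<lambda>i. \<theta> k * (\<Sum>f\<leftarrow>fs. f i)) \<subseteq> {1..}"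
    unfolding supp using combine.IH ne by (auto simp: subset_iff)
  ultimately show ?case by blast
qed (auto simp: unit_vec_def supp_def)

text \<open>The zero functional is not in \<open>K\<close> and lists of supports have nonempty
  entries, so zeros must be dropped and \<open>A k\<close> verified anew for the smaller supports.
  Their minima are a spread of a subset of the old minima; disjointness or succession is inherited.
  This serves both to restrict functionals and to glue nearly norming ones.\<close>

lemma filter_in_K:
  assumes k: "k \<ge> 1" and len: "length gs = length Es" and Es: "A k Es"
    and gs: "\<And>l. l < length gs \<Longrightarrow> gs ! l \<in> K \<or> gs ! l = (\<lambda>_. 0)"
    and sub: "\<And>l. l < length gs \<Longrightarrow> supp (gs ! l) \<subseteq> Es ! l"
  shows "(\<lambda>i. \<theta> k * (\<Sum>g\<leftarrow>gs. g i)) \<in> K \<or> (\<lambda>i. \<theta> k * (\<Sum>g\<leftarrow>gs. g i)) = (\<lambda>_. 0)"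
proof -
  define ps where "ps = filter (\<lambda>p. fst p \<noteq> (\<lambda>_. 0)) (zip gs Es)"
  have sum: "(\<Sum>g\<leftarrow>gs. g i) = (\<Sum>g\<leftarrow>map fst ps. g i)" for i
  proof -
    have "(\<Sum>g\<leftarrow>gs. g i) = (\<Sum>p\<leftarrow>zip gs Es. fst p i)"
      using len by (induction gs Es rule: list_induct2) auto
    also have "\<dots> = (\<Sum>p\<leftarrow>ps. fst p i)"
      unfolding ps_def by (rule sum_list_map_filter[symmetric]) auto
    finally show ?thesis by (simp add: comp_def)
  qed
  have al: "allowable (schreier k) Es" using A_allowable Es by blast
  have ps: "fst p \<in> K \<and> snd p \<in> set Es \<and> supp (fst p) \<subseteq> snd p \<and> supp (fst p) \<noteq> {}" if "p \<in> set ps" for p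
  proof -
    have "p \<in> set (zip gs Es)" "fst p \<noteq> (\<lambda>_. 0)" using that by (auto simp: ps_def)
    then obtain l where "l < length gs" "p = (gs ! l, Es ! l)" using len by (auto simp: set_zip)
    then show ?thesis using gs[of l] sub[of l] \<open>fst p \<noteq> (\<lambda>_. 0)\<close> len by (auto simp: supp_eq_empty)
  qed
  have finE: "finite E \<and> E \<noteq> {}" if "E \<in> set Es" for E
    using that al by (auto simp: allowable_def minima_in_def)
  have rel: "sorted_wrt (\<lambda>p q. R (snd p) (snd q)) ps" if "sorted_wrt R Es" for R
  proof -
    have "sorted_wrt (\<lambda>p q. R (snd p) (snd q)) (zip gs Es)"
      using that len by (auto simp: sorted_wrt_iff_nth_less)
    then show ?thesis unfolding ps_def by (rule sorted_wrt_filter)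
  qed
  show ?thesis
  proof (cases "ps = []")
    case True
    then show ?thesis using sum by simp
  next
    case False
    have dis: "sorted_wrt (\<lambda>p q. snd p \<inter> snd q = {}) ps"
      using rel[of "\<lambda>E F. E \<inter> F = {}"] al by (simp add: allowable_def)
    have dis': "snd p \<inter> snd q = {} \<or> p = q" if "p \<in> set ps" "q \<in> set ps" for p q
    proof -
      obtain i j where "i < length ps" "j < length ps" "p = ps ! i" "q = ps ! j"
        using \<open>p \<in> set ps\<close> \<open>q \<in> set ps\<close> by (auto simp: in_set_conv_nth)
      then show ?thesis using dis by (cases i j rule: linorder_cases) (auto simp: sorted_wrt_iff_nth_less)
    qed
    have minimum: "Min (snd p) \<in> snd p" "Min (supp (fst p)) \<in> supp (fst p)" "Min (snd p) \<le> Min (supp (fst p))"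
      if "p \<in> set ps" for p
      using ps[OF that] finE[of "snd p"] Min_antimono[of "supp (fst p)" "snd p"]
      by (auto simp: finite_subset intro: Min_in)
    \<comment> \<open>\<open>schreier_spread\<close> needs a map on points: \<open>pt\<close> leads
      from the minimum of a set back to its pair, and from there to the minimum of the smaller
      support.\<close>
    define pt where "pt a = (THE p. p \<in> set ps \<and> Min (snd p) = a)" for a
    have pt: "pt (Min (snd p)) = p" if "p \<in> set ps" for p
      unfolding pt_def
    proof (rule the_equality)
      fix q assume q: "q \<in> set ps \<and> Min (snd q) = Min (snd p)"
      then have "Min (snd p) \<in> snd p \<inter> snd q" using minimum(1) that by (metis IntI)
      then show "q = p" using dis'[of p q] q that by auto
    qed (use that in auto)
    have "(\<lambda>a. Min (supp (fst (pt a)))) ` (\<lambda>p. Min (snd p)) ` set ps \<in> schreier k"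
    proof (rule schreier_spread)
      have "(\<lambda>p. Min (snd p)) ` set ps \<subseteq> Min ` set Es" using ps by auto
      then show "(\<lambda>p. Min (snd p)) ` set ps \<in> schreier k"
        using al by (auto simp: allowable_def minima_in_def intro: schreier_hereditary)
      show "inj_on (\<lambda>a. Min (supp (fst (pt a)))) ((\<lambda>p. Min (snd p)) ` set ps)"
      proof (rule inj_onI, elim imageE)
        fix a b p q assume *: "a = Min (snd p)" "p \<in> set ps" "b = Min (snd q)" "q \<in> set ps"
          "Min (supp (fst (pt a))) = Min (supp (fst (pt b)))"
        then have "Min (supp (fst p)) = Min (supp (fst q))" using pt by simp
        then have "Min (supp (fst p)) \<in> snd p \<inter> snd q"
          using minimum(2) ps * by (metis IntI subset_iff)
        then show "a = b" using dis'[OF *(2,4)] *(1,3) by auto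
      qed
    qed (use pt minimum in auto)
    then have mins: "Min ` set (map supp (map fst ps)) \<in> schreier k"
      using pt by (simp add: image_image)
    have finS: "finite (supp (fst p)) \<and> supp (fst p) \<noteq> {} \<and> supp (fst p) \<subseteq> {1..}" if "p \<in> set ps" for p
      using ps[OF that] abs_le_one_and_supp by auto
    have min_in: "minima_in (schreier k) (map supp (map fst ps))"
      using mins False finS unfolding minima_in_def by auto
    have "A k (map supp (map fst ps))"
    proof (cases "A k = allowable (schreier k)")
      case True
      have "sorted_wrt (\<lambda>p q. supp (fst p) \<inter> supp (fst q) = {}) ps"
        by (rule sorted_wrt_mono_rel[OF _ dis]) (use ps in blast)
      then show ?thesis unfolding True allowable_def using min_in by (simp add: sorted_wrt_map)
    next
      case False
      then have adm: "A k = admissible (schreier k)" using A unfolding schreier_condition_def by blast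
      have less: "sorted_wrt (\<lambda>p q. set_less (snd p) (snd q)) ps"
        using rel[of set_less] Es by (simp add: adm admissible_def)
      have "sorted_wrt (\<lambda>p q. set_less (supp (fst p)) (supp (fst q))) ps"
      proof (rule sorted_wrt_mono_rel[OF _ less])
        fix p q assume pq: "p \<in> set ps" "q \<in> set ps" "set_less (snd p) (snd q)"
        have "Max (snd p) < Min (snd q)" using pq(3) ps[OF pq(1)] ps[OF pq(2)] by (auto simp: set_less_def)
        moreover have "Max (supp (fst p)) \<le> Max (snd p)"
          using ps[OF pq(1)] finE[of "snd p"] by (intro Max_mono) auto
        ultimately show "set_less (supp (fst p)) (supp (fst q))"
          using minimum(3)[OF pq(2)] by (auto simp: set_less_def)
      qed
      then show ?thesis unfolding adm admissible_def using min_in by (simp add: sorted_wrt_map)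
    qed
    then have "(\<lambda>i. \<theta> k * (\<Sum>g\<leftarrow>map fst ps. g i)) \<in> K"
      using ps by (intro norming_set.combine k) auto
    then show ?thesis using sum by simp
  qed
qed

lemma restr_in_K: "f \<in> K \<Longrightarrow> restr E f \<in> K \<or> restr E f = (\<lambda>_. 0)"
proof (induction rule: norming_set.induct)
  case (pos_unit n)
  have "restr E (unit_vec n) = (if n \<in> E then unit_vec n else (\<lambda>_. 0))"
    by (auto simp: restr_def unit_vec_def)
  then show ?case using norming_set.pos_unit[OF pos_unit] by auto
next
  case (neg_unit n)
  have "restr E (\<lambda>i. - unit_vec n i) = (if n \<in> E then (\<lambda>i. - unit_vec n i) else (\<lambda>_. 0))"
    by (auto simp: restr_def unit_vec_def)
  then show ?case using norming_set.neg_unit[OF neg_unit] by auto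
next
  case (combine k fs)
  have eq: "restr E (\<lambda>i. \<theta> k * (\<Sum>f\<leftarrow>fs. f i)) = (\<lambda>i. \<theta> k * (\<Sum>g\<leftarrow>map (restr E) fs. g i))"
  proof
    have "restr E (\<lambda>i. \<Sum>f\<leftarrow>fs. f i) t = (\<Sum>g\<leftarrow>map (restr E) fs. g t)" for t
      by (induction fs) (auto simp: restr_def)
    then show "restr E (\<lambda>i. \<theta> k * (\<Sum>f\<leftarrow>fs. f i)) t = \<theta> k * (\<Sum>g\<leftarrow>map (restr E) fs. g t)" for t
      by (metis (mono_tags, lifting) mult_zero_right restr_def)
  qed
  show ?case unfolding eq
    by (rule filter_in_K[of _ _ "map supp fs"]) (use combine in \<open>auto simp: supp_restr\<close>)
qed

lemma pairing_le_l1: "f \<in> K \<Longrightarrow> \<bar>pairing x f\<bar> \<le> (\<Sum>i\<in>supp x. \<bar>x i\<bar>)"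
  unfolding pairing_def
proof (rule order_trans[OF sum_abs sum_mono])
  fix i assume "f \<in> K"
  then show "\<bar>x i * f i\<bar> \<le> \<bar>x i\<bar>"
    using abs_le_one_and_supp[of f] by (auto simp: abs_mult intro: mult_left_le)
qed

lemma pairing_bdd: "bdd_above (pairing x ` K)"
  by (rule bdd_aboveI2[where M="\<Sum>i\<in>supp x. \<bar>x i\<bar>"]) (use pairing_le_l1 abs_le_D1 in blast)

lemma pairing_le_norm: "f \<in> K \<Longrightarrow> pairing x f \<le> norm_of_set K x"
  unfolding norm_of_set_def by (rule cSUP_upper[OF _ pairing_bdd])

lemma abs_coord_le_norm:
  assumes "x \<in> c00" shows "\<bar>x i\<bar> \<le> norm_of_set K x"
proof -
  have fin: "finite (insert j (supp x))" for j using assms finite_supp by auto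
  have u: "pairing x (unit_vec j) = x j" for j
    using pairing_superset[OF fin[of j] subset_insertI, of "unit_vec j"] fin[of j]
    by (simp add: unit_vec_def if_distrib sum.delta cong: if_cong)
  have n: "pairing x (\<lambda>i. - unit_vec j i) = - x j" for j
    using u[of j] by (simp add: pairing_def sum_negf)
  have 1: "\<bar>x j\<bar> \<le> norm_of_set K x" if "j \<ge> 1" for j
    using pairing_le_norm[OF norming_set.pos_unit[OF that], of x] pairing_le_norm[OF norming_set.neg_unit[OF that], of x] u n
    by auto
  have "x 0 = 0" using assms by (simp add: c00_def)
  show ?thesis
    using 1[of i] 1[of 1] \<open>x 0 = 0\<close> by (cases i) auto
qed

lemma norm_le_l1: "norm_of_set K x \<le> (\<Sum>i\<in>supp x. \<bar>x i\<bar>)"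
  unfolding norm_of_set_def
proof (rule cSUP_least)
  show "K \<noteq> {}" using norming_set.pos_unit[of 1 A \<theta>] by auto
qed (use pairing_le_l1 abs_le_D1 in blast)

lemma norm_approx:
  assumes "e > 0" shows "\<exists>f\<in>K. norm_of_set K x - e < pairing x f"
proof (rule ccontr)
  assume "\<not> ?thesis"
  then have "norm_of_set K x \<le> norm_of_set K x - e"
    using norming_set.pos_unit[of 1 A \<theta>] unfolding norm_of_set_def by (intro cSUP_least) auto
  then show False using assms by simp
qed

lemma norm_nonneg: "x \<in> c00 \<Longrightarrow> 0 \<le> norm_of_set K x"
  using order_trans[OF abs_ge_zero abs_coord_le_norm[of x 0]] .

lemma norm_leI: "(\<And>f. f \<in> K \<Longrightarrow> pairing x f \<le> B) \<Longrightarrow> norm_of_set K x \<le> B"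
  unfolding norm_of_set_def using norming_set.pos_unit[of 1 A \<theta>] by (intro cSUP_least) auto

lemma uminus_in_K: "f \<in> K \<Longrightarrow> (\<lambda>i. - f i) \<in> K"
proof (induction rule: norming_set.induct)
  case (combine k fs)
  have "(\<lambda>i. \<theta> k * (\<Sum>g\<leftarrow>map (\<lambda>f i. - f i) fs. g i)) \<in> K"
  proof (rule norming_set.combine)
    show "\<forall>f\<in>set (map (\<lambda>f i. - f i) fs). f \<in> K" using combine.IH by auto
    have "map supp (map (\<lambda>f i. - f i) fs) = map supp fs" by (auto simp: supp_def)
    then show "A k (map supp (map (\<lambda>f i. - f i) fs))" using combine.hyps(2) by (simp only:)
  qed (use combine.hyps in auto)
  moreover have "(\<Sum>g\<leftarrow>map (\<lambda>f i. - f i) fs. g i) = - (\<Sum>f\<leftarrow>fs. f i)" for i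
    by (induction fs) auto
  ultimately show ?case by simp
qed (auto intro: norming_set.intros)

lemma abs_pairing_le_norm: "f \<in> K \<Longrightarrow> \<bar>pairing x f\<bar> \<le> norm_of_set K x"
  using pairing_le_norm[of f x] pairing_le_norm[OF uminus_in_K, of f x]
  by (simp add: pairing_def sum_negf)

lemma norm_restr_le: "x \<in> c00 \<Longrightarrow> norm_of_set K (restr E x) \<le> norm_of_set K x"
proof (rule norm_leI)
  fix f assume x: "x \<in> c00" and "f \<in> K"
  then consider "restr E f \<in> K" | "restr E f = (\<lambda>_. 0)" using restr_in_K by blast
  then show "pairing (restr E x) f \<le> norm_of_set K x"
  proof cases
    case 2
    then have "pairing x (restr E f) = 0" by (simp add: pairing_def)
    then show ?thesis using norm_nonneg[OF x] pairing_restr[OF x] by simp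
  qed (use pairing_le_norm pairing_restr[OF x] in metis)
qed

lemma norm_lincomb_le:
  assumes "finite S" "\<And>k. k \<in> S \<Longrightarrow> x k \<in> c00"
  shows "norm_of_set K (\<lambda>i. \<Sum>k\<in>S. d k * x k i) \<le> (\<Sum>k\<in>S. \<bar>d k\<bar> * norm_of_set K (x k))"
proof (rule norm_leI)
  fix f assume f: "f \<in> K"
  have "pairing (\<lambda>i. \<Sum>k\<in>S. d k * x k i) f = (\<Sum>k\<in>S. d k * pairing (x k) f)"
    using assms by (rule pairing_lincomb)
  also have "\<dots> \<le> (\<Sum>k\<in>S. \<bar>d k\<bar> * norm_of_set K (x k))"
  proof (rule sum_mono)
    fix k assume "k \<in> S"
    have "d k * pairing (x k) f \<le> \<bar>d k\<bar> * \<bar>pairing (x k) f\<bar>"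
      by (metis abs_ge_self abs_mult)
    also have "\<dots> \<le> \<bar>d k\<bar> * norm_of_set K (x k)"
      using abs_pairing_le_norm[OF f] by (intro mult_left_mono) auto
    finally show "d k * pairing (x k) f \<le> \<bar>d k\<bar> * norm_of_set K (x k)" .
  qed
  finally show "pairing (\<lambda>i. \<Sum>k\<in>S. d k * x k i) f \<le> (\<Sum>k\<in>S. \<bar>d k\<bar> * norm_of_set K (x k))" .
qed

lemma norm_scale:
  assumes "x \<in> c00" shows "norm_of_set K (\<lambda>i. c * x i) = \<bar>c\<bar> * norm_of_set K x"
proof (cases "c = 0")
  case True
  then show ?thesis using norm_le_l1[of "\<lambda>_. 0"] norm_nonneg[OF c00_zero] by (simp add: supp_def)
next
  case False
  have le: "norm_of_set K (\<lambda>i. d * y i) \<le> \<bar>d\<bar> * norm_of_set K y" if "y \<in> c00" for d y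
    using norm_lincomb_le[of "{0::nat}" "\<lambda>_. y" "\<lambda>_. d"] that by simp
  have "norm_of_set K x = norm_of_set K (\<lambda>i. inverse c * (c * x i))"
    using False by (simp flip: mult.assoc)
  also have "\<dots> \<le> \<bar>inverse c\<bar> * norm_of_set K (\<lambda>i. c * x i)"
    using le c00_scale assms by blast
  finally have "\<bar>c\<bar> * norm_of_set K x \<le> norm_of_set K (\<lambda>i. c * x i)"
    using False by (simp add: field_simps)
  then show ?thesis using le[OF assms, of c] by simp
qed

lemma norm_pos: "x \<in> c00 \<Longrightarrow> x \<noteq> (\<lambda>_. 0) \<Longrightarrow> 0 < norm_of_set K x"
  using abs_coord_le_norm[of x] by (metis ext zero_less_abs_iff order_less_le_trans)

text \<open>Functionals that norm the pieces up to \<open>e / n\<close>, restricted to the sets of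
  \<open>Es\<close>, combine to a functional of weight \<open>\<theta> k\<close>. For admissible
  lists this is one half of the implicit equation; the same argument covers allowable lists.\<close>

lemma lower_estimate:
  assumes k: "k \<ge> 1" and Es: "A k Es" and x: "x \<in> c00"
  shows "\<theta> k * (\<Sum>E\<leftarrow>Es. norm_of_set K (restr E x)) \<le> norm_of_set K x"
proof (rule field_le_epsilon)
  fix e :: real assume e: "e > 0"
  define n where "n = length Es"
  have n: "n > 0" using A_allowable[OF Es] by (auto simp: n_def allowable_def minima_in_def)
  have "\<forall>E. \<exists>f\<in>K. norm_of_set K (restr E x) - e / n < pairing (restr E x) f"
    using norm_approx e n by simp
  then obtain f where f: "\<And>E. f E \<in> K" "\<And>E. norm_of_set K (restr E x) - e / n < pairing (restr E x) (f E)"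
    by metis
  define gs where "gs = map (\<lambda>E. restr E (f E)) Es"
  have "(\<lambda>i. \<theta> k * (\<Sum>g\<leftarrow>gs. g i)) \<in> K \<or> (\<lambda>i. \<theta> k * (\<Sum>g\<leftarrow>gs. g i)) = (\<lambda>_. 0)"
    by (rule filter_in_K[OF k _ Es]) (use f restr_in_K in \<open>auto simp: gs_def supp_restr\<close>)
  then have "pairing x (\<lambda>i. \<theta> k * (\<Sum>g\<leftarrow>gs. g i)) \<le> norm_of_set K x"
  proof
    assume "(\<lambda>i. \<theta> k * (\<Sum>g\<leftarrow>gs. g i)) = (\<lambda>_. 0)"
    then have "pairing x (\<lambda>i. \<theta> k * (\<Sum>g\<leftarrow>gs. g i)) = 0" by (simp only: pairing_def) simp
    then show ?thesis using norm_nonneg[OF x] by simp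
  qed (rule pairing_le_norm)
  moreover have "pairing x (\<lambda>i. \<theta> k * (\<Sum>g\<leftarrow>gs. g i)) = \<theta> k * (\<Sum>E\<leftarrow>Es. pairing (restr E x) (f E))"
    unfolding pairing_functional_lincomb gs_def by (simp add: comp_def pairing_restr[OF x])
  moreover have "(\<Sum>E\<leftarrow>Es. norm_of_set K (restr E x)) - e \<le> (\<Sum>E\<leftarrow>Es. pairing (restr E x) (f E))"
  proof -
    have "(\<Sum>E\<leftarrow>Es. norm_of_set K (restr E x) - e / n) \<le> (\<Sum>E\<leftarrow>Es. pairing (restr E x) (f E))"
      using f(2) by (intro sum_list_mono less_imp_le)
    moreover have "(\<Sum>E\<leftarrow>Es. norm_of_set K (restr E x) - e / n) = (\<Sum>E\<leftarrow>Es. norm_of_set K (restr E x)) - e"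
      using n by (simp add: sum_list_subtractf sum_list_triv n_def)
    ultimately show ?thesis by simp
  qed
  moreover have "0 < \<theta> k" "\<theta> k < 1" using theta[OF k] by auto
  ultimately have "\<theta> k * ((\<Sum>E\<leftarrow>Es. norm_of_set K (restr E x)) - e) \<le> norm_of_set K x"
    by (smt (verit) mult_left_mono)
  moreover have "\<theta> k * e \<le> e" using \<open>\<theta> k < 1\<close> e by simp
  ultimately show "\<theta> k * (\<Sum>E\<leftarrow>Es. norm_of_set K (restr E x)) \<le> norm_of_set K x + e"
    by (simp add: right_diff_distrib)
qed

text \<open>At most \<open>n\<close> points, all at or after \<open>n\<close>, form a set of order
  1, and allowability asks of the supports only that they be disjoint. An admissible list would have
  to be successive; this is the difference between the two spaces that the proof exploits.\<close>

lemma disjoint_lower_estimate: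
  assumes A1: "A 1 = allowable (schreier 1)" and n: "n \<ge> 1"
    and x: "\<And>i. i < n \<Longrightarrow> x i \<in> c00 \<and> supp (x i) \<noteq> {} \<and> supp (x i) \<subseteq> {n..}"
    and dis: "\<And>i j. i < j \<Longrightarrow> j < n \<Longrightarrow> supp (x i) \<inter> supp (x j) = {}"
  shows "\<theta> 1 * (\<Sum>i<n. norm_of_set K (x i)) \<le> norm_of_set K (\<lambda>t. \<Sum>i<n. x i t)"
proof -
  define S where "S = (\<lambda>t. \<Sum>i<n. x i t)"
  have Sc: "S \<in> c00" unfolding S_def using x by (intro c00_sum) auto
  define Es where "Es = map (\<lambda>i. supp (x i)) [0..<n]"
  have "Min ` set Es \<in> schreier 1"
  proof -
    have "Min ` set Es \<subseteq> {n..}" using x finite_supp unfolding Es_def by fastforce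
    moreover have "card (Min ` set Es) \<le> n"
      using card_image_le[of "set Es" Min] card_length[of Es] by (simp add: Es_def)
    ultimately show ?thesis using n by (intro schreier_oneI) auto
  qed
  then have "A 1 Es"
    unfolding A1 allowable_def minima_in_def
    using x n finite_supp supp_pos dis by (auto simp: Es_def sorted_wrt_iff_nth_less)
  moreover have "restr (supp (x i)) S = x i" if "i < n" for i
  proof
    fix t
    have "x j t = 0" if "x i t \<noteq> 0" "j < n" "j \<noteq> i" for j
      using dis[of i j] dis[of j i] that \<open>i < n\<close> by (cases "i < j") (auto simp: supp_def)
    then have "S t = x i t" if "x i t \<noteq> 0"
      unfolding S_def using \<open>i < n\<close> that sum.remove[of "{..<n}" i "\<lambda>j. x j t"] by (simp add: sum.neutral)
    then show "restr (supp (x i)) S t = x i t" by (auto simp: restr_def supp_def)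
  qed
  then have "(\<Sum>E\<leftarrow>Es. norm_of_set K (restr E S)) = (\<Sum>i<n. norm_of_set K (x i))"
    by (simp add: Es_def comp_def interv_sum_list_conv_sum_set_nat atLeast0LessThan)
  ultimately show ?thesis using lower_estimate[of 1 Es S] Sc by (simp add: S_def)
qed

end

section \<open>The mixed Tsirelson norm\<close>

lemma sum_list_disjoint_le:
  fixes a :: "nat \<Rightarrow> real"
  assumes "sorted_wrt (\<lambda>E F. E \<inter> F = {}) Es" "finite S" "\<And>i. a i \<ge> 0"
  shows "(\<Sum>E\<leftarrow>Es. \<Sum>i\<in>S \<inter> E. a i) \<le> sum a S"
  using assms(1,2)
proof (induction Es arbitrary: S)
  case Nil
  then show ?case using assms(3) by (simp add: sum_nonneg)
next
  case (Cons E Es)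
  have "(\<Sum>F\<leftarrow>Es. \<Sum>i\<in>S \<inter> F. a i) = (\<Sum>F\<leftarrow>Es. \<Sum>i\<in>(S - E) \<inter> F. a i)"
  proof (rule arg_cong[where f=sum_list], rule map_cong[OF refl])
    fix F assume "F \<in> set Es"
    then have "S \<inter> F = (S - E) \<inter> F" using Cons.prems by auto
    then show "(\<Sum>i\<in>S \<inter> F. a i) = (\<Sum>i\<in>(S - E) \<inter> F. a i)" by simp
  qed
  also have "\<dots> \<le> sum a (S - E)" using Cons by auto
  finally have "(\<Sum>F\<leftarrow>E # Es. \<Sum>i\<in>S \<inter> F. a i) \<le> sum a (S \<inter> E) + sum a (S - E)" by simp
  also have "\<dots> = sum a S"
    using sum.Int_Diff[OF Cons.prems(2), of a E] by simp
  finally show ?case .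
qed

lemma admissible_singleton: "admissible (schreier k) [{1}]"
  using singleton_schreier[of 1 k] by (auto simp: admissible_def minima_in_def)

lemma schreier_condition_admissible: "schreier_condition (\<lambda>k. admissible (schreier k))"
  by (simp add: schreier_condition_def)

locale tsirelson =
  fixes \<theta> :: "nat \<Rightarrow> real" and N :: "(nat \<Rightarrow> real) \<Rightarrow> real"
  assumes reg: "regular_seq \<theta>" and N: "mixed_tsirelson_norm schreier \<theta> N"
begin

sublocale norming "\<lambda>k. admissible (schreier k)" \<theta>
  by unfold_locales (use reg schreier_condition_admissible in \<open>auto simp: regular_seq_def\<close>)

lemma N_nonneg: "x \<in> c00 \<Longrightarrow> 0 \<le> N x"
  and N_zero: "N (\<lambda>_. 0) = 0"
  and N_scale: "x \<in> c00 \<Longrightarrow> N (\<lambda>i. c * x i) = \<bar>c\<bar> * N x"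
  and N_add: "x \<in> c00 \<Longrightarrow> y \<in> c00 \<Longrightarrow> N (\<lambda>i. x i + y i) \<le> N x + N y"
  using N c00_zero by (auto simp: mixed_tsirelson_norm_def norm_on_c00_def)

lemma N_sum: "finite S \<Longrightarrow> (\<And>k. k \<in> S \<Longrightarrow> x k \<in> c00) \<Longrightarrow> N (\<lambda>i. \<Sum>k\<in>S. x k i) \<le> (\<Sum>k\<in>S. N (x k))"
proof (induction S rule: finite_induct)
  case (insert a S)
  have "N (\<lambda>i. x a i + (\<Sum>k\<in>S. x k i)) \<le> N (x a) + N (\<lambda>i. \<Sum>k\<in>S. x k i)"
    using insert by (intro N_add c00_sum) auto
  then show ?case using insert by simp
qed (simp add: N_zero)

text \<open>Its sum over the support bounds every sum in the implicit equation, by the triangle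
  inequality and disjointness. Hence the suprema there are over bounded sets and do dominate their
  members.\<close>

definition weight :: "(nat \<Rightarrow> real) \<Rightarrow> nat \<Rightarrow> real" where
  "weight x i = \<bar>x i\<bar> * N (unit_vec i)"

lemma N_restr_le:
  assumes x: "x \<in> c00" shows "N (restr E x) \<le> (\<Sum>i\<in>supp x \<inter> E. weight x i)"
proof -
  have eq: "restr E x = (\<lambda>t. \<Sum>i\<in>supp x \<inter> E. x i * unit_vec i t)"
    using finite_supp[OF x]
    by (auto simp: fun_eq_iff restr_def unit_vec_def if_distrib sum.delta supp_def cong: if_cong)
  have u: "unit_vec i \<in> c00" if "i \<in> supp x" for i
    using that supp_pos[OF x] by (intro c00_unit_vec) auto
  have "N (restr E x) \<le> (\<Sum>i\<in>supp x \<inter> E. N (\<lambda>t. x i * unit_vec i t))"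
    unfolding eq using finite_supp[OF x] u by (intro N_sum) (auto intro: c00_scale)
  also have "\<dots> = (\<Sum>i\<in>supp x \<inter> E. weight x i)"
    using u by (intro sum.cong) (auto simp: N_scale weight_def)
  finally show ?thesis .
qed

lemma weight_nonneg: "x \<in> c00 \<Longrightarrow> weight x i \<ge> 0"
  using N_nonneg[OF c00_unit_vec[of i]] by (cases "i = 0") (auto simp: weight_def c00_def)

lemma N_sum_list_le:
  assumes "x \<in> c00" "admissible M Es"
  shows "(\<Sum>E\<leftarrow>Es. N (restr E x)) \<le> (\<Sum>i\<in>supp x. weight x i)"
proof -
  have "(\<Sum>E\<leftarrow>Es. N (restr E x)) \<le> (\<Sum>E\<leftarrow>Es. \<Sum>i\<in>supp x \<inter> E. weight x i)"
    using N_restr_le[OF assms(1)] by (intro sum_list_mono)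
  also have "\<dots> \<le> (\<Sum>i\<in>supp x. weight x i)"
    using admissible_imp_allowable[OF assms(2)] weight_nonneg[OF assms(1)] finite_supp[OF assms(1)]
    by (intro sum_list_disjoint_le) (auto simp: allowable_def)
  finally show ?thesis .
qed

lemma N_eq:
  "x \<in> c00 \<Longrightarrow> N x = max (sup_norm x)
     (SUP k\<in>{1..}. \<theta> k * (SUP Es\<in>{Es. admissible (schreier k) Es}. \<Sum>E\<leftarrow>Es. N (restr E x)))"
  using N unfolding mixed_tsirelson_norm_def by blast

lemma inner_bdd:
  "x \<in> c00 \<Longrightarrow> bdd_above ((\<lambda>Es. \<Sum>E\<leftarrow>Es. N (restr E x)) ` {Es. admissible (schreier k) Es})"
  using N_sum_list_le by (intro bdd_aboveI2) auto

lemma inner_le: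
  "x \<in> c00 \<Longrightarrow> (SUP Es\<in>{Es. admissible (schreier k) Es}. \<Sum>E\<leftarrow>Es. N (restr E x)) \<le> (\<Sum>i\<in>supp x. weight x i)"
  by (rule cSUP_least) (use admissible_singleton N_sum_list_le in auto)

lemma N_lower:
  assumes x: "x \<in> c00" and k: "k \<ge> 1" and Es: "admissible (schreier k) Es"
  shows "\<theta> k * (\<Sum>E\<leftarrow>Es. N (restr E x)) \<le> N x"
proof -
  let ?W = "\<Sum>i\<in>supp x. weight x i"
  let ?I = "\<lambda>k. SUP Es\<in>{Es. admissible (schreier k) Es}. \<Sum>E\<leftarrow>Es. N (restr E x)"
  have W: "?W \<ge> 0" using weight_nonneg[OF x] by (simp add: sum_nonneg)
  have bdd: "bdd_above ((\<lambda>k. \<theta> k * ?I k) ` {1..})"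
  proof (rule bdd_aboveI2[where M="?W"])
    fix k :: nat assume "k \<in> {1..}"
    then have t: "0 < \<theta> k" "\<theta> k < 1" using theta by auto
    have "\<theta> k * ?I k \<le> \<theta> k * ?W" using inner_le[OF x] t by (intro mult_left_mono) auto
    also have "\<dots> \<le> ?W" using t W by (intro mult_left_le_one_le) auto
    finally show "\<theta> k * ?I k \<le> ?W" .
  qed
  have "\<theta> k * (\<Sum>E\<leftarrow>Es. N (restr E x)) \<le> \<theta> k * ?I k"
    using theta[OF k] Es by (intro mult_left_mono cSUP_upper inner_bdd x) auto
  also have "\<dots> \<le> (SUP k\<in>{1..}. \<theta> k * ?I k)" using k by (intro cSUP_upper bdd) auto
  also have "\<dots> \<le> N x" unfolding N_eq[OF x] by simp
  finally show ?thesis .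
qed

lemma N_upper:
  assumes x: "x \<in> c00" and c: "\<And>i. \<bar>x i\<bar> \<le> B"
    and l: "\<And>k Es. k \<ge> 1 \<Longrightarrow> admissible (schreier k) Es \<Longrightarrow> \<theta> k * (\<Sum>E\<leftarrow>Es. N (restr E x)) \<le> B"
  shows "N x \<le> B"
proof -
  have "sup_norm x \<le> B" unfolding sup_norm_def using c by (intro cSUP_least) auto
  moreover have "(SUP k\<in>{1..}. \<theta> k * (SUP Es\<in>{Es. admissible (schreier k) Es}. \<Sum>E\<leftarrow>Es. N (restr E x))) \<le> B"
  proof (rule cSUP_least)
    fix k :: nat assume "k \<in> {1..}"
    then have k: "k \<ge> 1" and t: "\<theta> k > 0" using theta by auto
    have "(SUP Es\<in>{Es. admissible (schreier k) Es}. \<Sum>E\<leftarrow>Es. N (restr E x)) \<le> B / \<theta> k"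
      using l[OF k] t admissible_singleton by (intro cSUP_least) (auto simp: field_simps)
    then show "\<theta> k * (SUP Es\<in>{Es. admissible (schreier k) Es}. \<Sum>E\<leftarrow>Es. N (restr E x)) \<le> B"
      using t by (simp add: field_simps)
  qed auto
  ultimately show ?thesis unfolding N_eq[OF x] by simp
qed

lemma abs_coord_le_N:
  assumes x: "x \<in> c00" shows "\<bar>x i\<bar> \<le> N x"
proof -
  have "bdd_above ((\<lambda>i. \<bar>x i\<bar>) ` {1..})"
  proof (rule bdd_aboveI2)
    fix i show "\<bar>x i\<bar> \<le> (\<Sum>j\<in>supp x. \<bar>x j\<bar>)"
      using member_le_sum[of i "supp x" "\<lambda>j. \<bar>x j\<bar>"] finite_supp[OF x]
      by (cases "i \<in> supp x") (auto simp: supp_def sum_nonneg)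
  qed
  then have "\<bar>x i\<bar> \<le> sup_norm x" if "i \<ge> 1" for i
    unfolding sup_norm_def using that by (intro cSUP_upper) auto
  moreover have "sup_norm x \<le> N x" using N_eq[OF x] by simp
  moreover have "x 0 = 0" using x by (simp add: c00_def)
  ultimately show ?thesis using N_nonneg[OF x] by (cases i) (auto, metis One_nat_def Suc_le_mono le0 order_trans)
qed

lemma pairing_le_N: "f \<in> K \<Longrightarrow> x \<in> c00 \<Longrightarrow> pairing x f \<le> N x"
proof (induction arbitrary: x rule: norming_set.induct)
  case (pos_unit n)
  have "pairing x (unit_vec n) = x n"
    using pairing_superset[of "insert n (supp x)" x "unit_vec n"] finite_supp[OF pos_unit(2)]
    by (simp add: unit_vec_def if_distrib sum.delta subset_insertI cong: if_cong)
  then show ?case using abs_coord_le_N[OF pos_unit(2), of n] by auto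
next
  case (neg_unit n)
  have "pairing x (\<lambda>i. - unit_vec n i) = - x n"
    using pairing_superset[of "insert n (supp x)" x "\<lambda>i. - unit_vec n i"] finite_supp[OF neg_unit(2)]
    by (simp add: unit_vec_def if_distrib sum.delta subset_insertI cong: if_cong)
  then show ?case using abs_coord_le_N[OF neg_unit(2), of n] by auto
next
  case (combine k fs)
  have "pairing x (\<lambda>i. \<theta> k * (\<Sum>f\<leftarrow>fs. f i)) = \<theta> k * (\<Sum>f\<leftarrow>fs. pairing x f)"
    by (rule pairing_functional_lincomb)
  also have "(\<Sum>f\<leftarrow>fs. pairing x f) \<le> (\<Sum>f\<leftarrow>fs. N (restr (supp f) x))"
  proof (rule sum_list_mono)
    fix f assume "f \<in> set fs"
    then have "pairing (restr (supp f) x) f \<le> N (restr (supp f) x)"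
      using combine.IH c00_restr[OF combine.prems] by auto
    then show "pairing x f \<le> N (restr (supp f) x)"
      using pairing_restr[OF combine.prems, of "supp f" f] by (simp add: restr_superset)
  qed
  also have "\<theta> k * (\<Sum>f\<leftarrow>fs. N (restr (supp f) x)) \<le> N x"
    using N_lower[OF combine.prems combine.hyps] by (simp add: comp_def)
  finally show ?case using theta[OF combine.hyps(1)] by simp
qed

text \<open>Induction on the size of the support. The induction hypothesis is silent about a list in
  which one set contains the whole support, but such a list contributes at most
  \<open>\<theta> 1 * N x\<close>. So \<open>N x\<close> is bounded by the maximum of
  \<open>norm_of_set K x\<close> and \<open>\<theta> 1 * N x\<close>, and the latter is below
  \<open>N x\<close> unless \<open>N x = 0\<close>.\<close>

lemma N_le_norm: "x \<in> c00 \<Longrightarrow> N x \<le> norm_of_set K x"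
proof (induction "card (supp x)" arbitrary: x rule: less_induct)
  case less
  note x = less.prems
  define B where "B = max (norm_of_set K x) (\<theta> 1 * N x)"
  have t1: "\<theta> k \<le> \<theta> 1" if "k \<ge> 1" for k
    using that reg by (induction k rule: dec_induct) (auto simp: regular_seq_def intro: order_trans)
  have "N x \<le> B"
  proof (rule N_upper[OF x])
    show "\<bar>x i\<bar> \<le> B" for i using abs_coord_le_norm[OF x] by (simp add: B_def le_max_iff_disj)
    fix k Es assume k: "k \<ge> (1::nat)" and Es: "admissible (schreier k) Es"
    show "\<theta> k * (\<Sum>E\<leftarrow>Es. N (restr E x)) \<le> B"
    proof (cases "\<exists>E\<in>set Es. supp x \<subseteq> E")
      case True
      have "(\<Sum>E\<leftarrow>Es. N (restr E x)) \<le> N x"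
      proof -
        have "sorted_wrt (\<lambda>E F. E \<inter> F = {}) Es"
          using admissible_imp_allowable[OF Es] by (simp add: allowable_def)
        then show ?thesis using True
        proof (induction Es)
          case (Cons E Es)
          have z: "N (restr F x) = 0" if "supp x \<inter> F = {}" for F
            using that N_zero supp_restr[of F x] supp_eq_empty[of "restr F x"] by simp
          show ?case
          proof (cases "supp x \<subseteq> E")
            case True
            have "N (restr F x) = 0" if "F \<in> set Es" for F
              using Cons.prems(1) True that by (intro z) auto
            then have "(\<Sum>F\<leftarrow>Es. N (restr F x)) = 0" by (induction Es) auto
            then show ?thesis using True by (simp add: restr_superset)
          next
            case False
            then obtain F where F: "F \<in> set Es" "supp x \<subseteq> F" using Cons.prems by auto
            then have "supp x \<inter> E = {}" using Cons.prems(1) by auto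
            then show ?thesis using Cons F z by auto
          qed
        qed simp
      qed
      then have "\<theta> k * (\<Sum>E\<leftarrow>Es. N (restr E x)) \<le> \<theta> k * N x"
        using theta[OF k] by (intro mult_left_mono) auto
      also have "\<dots> \<le> \<theta> 1 * N x" using t1[OF k] N_nonneg[OF x] by (rule mult_right_mono)
      finally show ?thesis by (simp add: B_def)
    next
      case False
      have "(\<Sum>E\<leftarrow>Es. N (restr E x)) \<le> (\<Sum>E\<leftarrow>Es. norm_of_set K (restr E x))"
      proof (rule sum_list_mono)
        fix E assume "E \<in> set Es"
        then have "supp (restr E x) \<subset> supp x" using False by (auto simp: supp_restr)
        then have "card (supp (restr E x)) < card (supp x)" using finite_supp[OF x] psubset_card_mono by blast
        then show "N (restr E x) \<le> norm_of_set K (restr E x)" using less.hyps c00_restr[OF x] by blast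
      qed
      then have "\<theta> k * (\<Sum>E\<leftarrow>Es. N (restr E x)) \<le> \<theta> k * (\<Sum>E\<leftarrow>Es. norm_of_set K (restr E x))"
        using theta[OF k] by (intro mult_left_mono) auto
      also have "\<dots> \<le> norm_of_set K x" by (rule lower_estimate[OF k Es x])
      finally show ?thesis by (simp add: B_def)
    qed
  qed
  moreover have "\<theta> 1 * N x < N x \<or> N x = 0" using theta[of 1] N_nonneg[OF x] by auto
  ultimately show ?case using norm_nonneg[OF x] by (auto simp: B_def max_def split: if_splits)
qed

text \<open>The implicit equation thus has at most one solution, and upper bounds in
  \<open>T\<close> may be proved by following the tree of a functional.\<close>

lemma N_eq_norm_of_set: "x \<in> c00 \<Longrightarrow> N x = norm_of_set K x"
  using N_le_norm norm_leI[of x "N x"] pairing_le_N by (intro antisym) auto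

end

section \<open>Special convex combinations\<close>

text \<open>The part of a convex combination of blocks that a set \<open>H\<close> of points can
  disturb, where block \<open>j\<close> occupies \<open>{p j..q j}\<close>. Hitting any point of the
  interval counts, since a node of a tree may begin in the middle of a block.\<close>

definition hit_mass :: "(nat \<Rightarrow> nat) \<Rightarrow> (nat \<Rightarrow> nat) \<Rightarrow> (nat \<Rightarrow> real) \<Rightarrow> nat set \<Rightarrow> real" where
  "hit_mass p q c H = (\<Sum>j\<in>supp c. c j * of_bool ({p j..q j} \<inter> H \<noteq> {}))"

text \<open>The special convex combinations of order \<open>M\<close>, in a version for blocks: the
  left ends carry the order, whereas smallness refers to whole intervals. Because of the strict
  \<open>M' < M\<close>, the exceptional sets for averages of order \<open>n\<close> are later kept
  of order \<open>n - 1\<close>.\<close>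

definition special_comb ::
  "(nat \<Rightarrow> nat) \<Rightarrow> (nat \<Rightarrow> nat) \<Rightarrow> nat \<Rightarrow> real \<Rightarrow> nat \<Rightarrow> (nat \<Rightarrow> real) \<Rightarrow> bool" where
  "special_comb p q M e m c \<longleftrightarrow> finite (supp c) \<and> (\<forall>j. c j \<ge> 0) \<and> supp c \<subseteq> {m..} \<and> sum c (supp c) = 1 \<and>
     p ` supp c \<in> schreier M \<and> (\<forall>M'<M. \<forall>H\<in>schreier M'. hit_mass p q c H \<le> e)"

definition interlaced :: "(nat \<Rightarrow> nat) \<Rightarrow> (nat \<Rightarrow> nat) \<Rightarrow> bool" where
  "interlaced p q \<longleftrightarrow> 1 \<le> p 0 \<and> (\<forall>j. p j \<le> q j \<and> q j < p (Suc j))"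

lemma interlaced_less: "interlaced p q \<Longrightarrow> i < j \<Longrightarrow> q i < p j"
proof (induction j)
  case (Suc j)
  then show ?case
    by (cases "i = j") (auto simp: interlaced_def intro: order.strict_trans2[OF _ less_imp_le]
      dest!: less_antisym, metis less_le_trans less_imp_le)
qed simp

lemma interlaced_strict_mono: "interlaced p q \<Longrightarrow> strict_mono p"
  by (rule strict_mono_Suc_iff[THEN iffD2]) (auto simp: interlaced_def intro: le_less_trans)

lemma interlaced_ge: "interlaced p q \<Longrightarrow> j < p j"
proof (induction j)
  case (Suc j)
  then have "p j < p (Suc j)" using interlaced_strict_mono by (simp add: strict_mono_Suc_iff)
  then show ?case using Suc by simp
qed (auto simp: interlaced_def)

lemma hit_mass_superset:
  "finite S \<Longrightarrow> supp c \<subseteq> S \<Longrightarrow> hit_mass p q c H = (\<Sum>j\<in>S. c j * of_bool ({p j..q j} \<inter> H \<noteq> {}))"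
  unfolding hit_mass_def by (rule sum.mono_neutral_left) (auto simp: supp_def)

lemma sum_supp_superset: "finite S \<Longrightarrow> supp c \<subseteq> S \<Longrightarrow> sum c (supp c) = sum c S"
  by (rule sum.mono_neutral_left) (auto simp: supp_def)

lemma hit_mass_le_sum: "(\<And>j. c j \<ge> 0) \<Longrightarrow> hit_mass p q c H \<le> sum c (supp c)"
  unfolding hit_mass_def by (rule sum_mono) auto

lemma hit_mass_Union_le:
  assumes "\<And>j. c j \<ge> 0"
  shows "hit_mass p q c (\<Union>(set As)) \<le> (\<Sum>A\<leftarrow>As. hit_mass p q c A)"
proof (induction As)
  case Nil
  then show ?case by (simp add: hit_mass_def)
next
  case (Cons A As)
  have "hit_mass p q c (A \<union> B) \<le> hit_mass p q c A + hit_mass p q c B" for B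
    unfolding hit_mass_def sum.distrib[symmetric] using assms
    by (intro sum_mono) (auto simp: Int_Un_distrib)
  from this[of "\<Union>(set As)"] show ?case using Cons.IH by simp
qed

text \<open>A plain average of \<open>K\<close> successive combinations of order \<open>M\<close>.
  Let \<open>H\<close> begin before the end of cell \<open>s0\<close> and not earlier. Cells before
  \<open>s0\<close> are not hit; cell \<open>s0\<close> may be hit completely, which costs
  \<open>1 / K \<le> e / 2\<close>. Beyond it \<open>H\<close> splits into at most
  \<open>min H \<le> q (mm s)\<close> sets of lower order, each hitting mass at most
  \<open>e / (2 * q (mm s))\<close>, so such a cell is hit with mass at most \<open>e / 2\<close>.
  The condition \<open>K \<le> mm 0\<close> puts the \<open>K\<close> left ends of the cells into a
  set of order 1.\<close>

lemma special_comb_step: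
  assumes pq: "interlaced p q" and e: "e > 0" and K: "2 / e \<le> real K" "K \<le> mm 0" "K \<ge> 1"
    and cc: "\<And>s. special_comb p q M (e / (2 * q (mm s))) (mm s) (cc s)"
    and lt: "\<And>s. supp (cc s) \<subseteq> {..<mm (Suc s)}"
  shows "special_comb p q (Suc M) e (mm 0) (\<lambda>j. (\<Sum>s<K. cc s j) / K)" (is "special_comb _ _ _ _ _ ?c")
proof -
  have nn: "cc s j \<ge> 0" for s j using cc by (simp add: special_comb_def)
  have rng: "supp (cc s) \<subseteq> {mm s..<mm (Suc s)}" for s using cc[of s] lt[of s] by (auto simp: special_comb_def)
  have fin: "finite (supp (cc s))" for s using cc by (simp add: special_comb_def)
  have one: "sum (cc s) (supp (cc s)) = 1" for s using cc by (simp add: special_comb_def)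
  then have ne: "supp (cc s) \<noteq> {}" for s by (metis sum.empty zero_neq_one)
  have "mm s < mm (Suc s)" for s using rng[of s] ne[of s] by fastforce
  then have sm: "strict_mono mm" by (simp add: strict_mono_Suc_iff)
  have pm: "strict_mono p" using pq by (rule interlaced_strict_mono)
  have qlt: "q i < p j" if "i < j" for i j using interlaced_less pq that by blast
  have supp_c: "supp ?c = (\<Union>s<K. supp (cc s))"
    using K(3) nn by (auto simp: supp_def sum_nonneg_eq_0_iff)
  have finc: "finite (supp ?c)" unfolding supp_c using fin by auto
  have sub: "supp (cc s) \<subseteq> supp ?c" if "s < K" for s using that supp_c by auto
  have sum_c: "sum ?c (supp ?c) = 1"
  proof -
    have "sum ?c (supp ?c) = (\<Sum>s<K. sum (cc s) (supp ?c)) / K"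
      by (simp add: sum_divide_distrib sum.swap[of _ "{..<K}"] flip: sum_divide_distrib)
    also have "(\<Sum>s<K. sum (cc s) (supp ?c)) = (\<Sum>s<K. 1)"
      using sum_supp_superset[OF finc sub] one by (intro sum.cong) auto
    finally show ?thesis using K(3) by simp
  qed
  have mass: "hit_mass p q ?c H = (\<Sum>s<K. hit_mass p q (cc s) H) / K" for H
  proof -
    have "hit_mass p q ?c H = (\<Sum>s<K. \<Sum>j\<in>supp ?c. cc s j * of_bool ({p j..q j} \<inter> H \<noteq> {})) / K"
      unfolding hit_mass_def sum_divide_distrib
      by (subst sum.swap) (auto simp: sum_distrib_right sum_divide_distrib intro!: sum.cong)
    also have "\<dots> = (\<Sum>s<K. hit_mass p q (cc s) H) / K"
      using hit_mass_superset[OF finc sub] by simp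
    finally show ?thesis .
  qed
  have "p ` supp ?c \<in> schreier (1 + M)"
  proof -
    have "(\<Union>s\<in>{..<K}. p ` supp (cc s)) \<in> schreier (1 + M)"
    proof (rule schreier_compose)
      show "inj_on (\<lambda>s. p (mm s)) {..<K}"
        using sm pm by (auto simp: inj_on_def strict_mono_eq)
      then have "card ((\<lambda>s. p (mm s)) ` {..<K}) = K" by (simp add: card_image)
      moreover have "K \<le> p (mm s)" for s
        using K(2) interlaced_ge[OF pq, of "mm s"] strict_mono_leD[OF sm, of 0 s] by simp
      ultimately show "(\<lambda>s. p (mm s)) ` {..<K} \<in> schreier 1"
        using K(3) by (intro schreier_oneI) (auto intro: order_trans)
      fix s
      have "p (mm s) \<le> p j" if "j \<in> supp (cc s)" for j
        using rng[of s] that strict_mono_leD[OF pm] by auto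
      then show "p ` supp (cc s) \<in> schreier M \<and> p ` supp (cc s) \<noteq> {} \<and> p (mm s) \<le> Min (p ` supp (cc s))"
        using cc[of s] ne[of s] by (auto simp: special_comb_def)
      fix s' assume "p (mm s) < p (mm s')"
      then have "s < s'" using sm pm by (simp add: strict_mono_less)
      then have "mm (Suc s) \<le> mm s'" using strict_mono_leD[OF sm] by simp
      then have "p j < p j'" if "j \<in> supp (cc s)" "j' \<in> supp (cc s')" for j j'
        using rng[of s] rng[of s'] that pm by (force simp: strict_mono_less)
      then show "Max (p ` supp (cc s)) < Min (p ` supp (cc s'))" using fin ne by auto
    qed
    then show ?thesis unfolding supp_c by (simp add: image_UN)
  qed
  moreover have "hit_mass p q ?c H \<le> e" if M': "M' < Suc M" and H: "H \<in> schreier M'" for M' H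
  proof (cases "\<exists>s h. h \<in> H \<and> h < p (mm (Suc s))")
    case False
    have "hit_mass p q (cc s) H = 0" for s
    proof -
      have "{p j..q j} \<inter> H = {}" if "j \<in> supp (cc s)" for j
      proof -
        have "q j < p (mm (Suc s))" using rng[of s] that qlt[of j "mm (Suc s)"] by auto
        moreover have "p (mm (Suc s)) \<le> h" if "h \<in> H" for h using False that not_less by blast
        ultimately show ?thesis by fastforce
      qed
      then show ?thesis by (simp add: hit_mass_def)
    qed
    then show ?thesis using mass e by simp
  next
    case True
    define s0 where "s0 = (LEAST s. \<exists>h\<in>H. h < p (mm (Suc s)))"
    have ex: "\<exists>s. \<exists>h\<in>H. h < p (mm (Suc s))" using True by blast
    obtain h where h: "h \<in> H" "h < p (mm (Suc s0))" using LeastI_ex[OF ex] by (auto simp: s0_def)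
    have before: "hit_mass p q (cc s) H = 0" if "s < s0" for s
    proof -
      have "\<not> (\<exists>h\<in>H. h < p (mm (Suc s)))" using not_less_Least[of s] that by (auto simp: s0_def)
      then have "{p j..q j} \<inter> H = {}" if "j \<in> supp (cc s)" for j
      proof -
        have "q j < p (mm (Suc s))" using rng[of s] \<open>j \<in> supp (cc s)\<close> qlt[of j "mm (Suc s)"] by auto
        moreover have "p (mm (Suc s)) \<le> h" if "h \<in> H" for h
          using \<open>\<not> (\<exists>h\<in>H. h < p (mm (Suc s)))\<close> that not_less by blast
        ultimately show ?thesis by fastforce
      qed
      then show ?thesis by (simp add: hit_mass_def)
    qed
    have at: "hit_mass p q (cc s) H \<le> 1" for s
      using hit_mass_le_sum[of "cc s", OF nn] one by metis
    have after: "hit_mass p q (cc s) H \<le> e / 2" if "s0 < s" for s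
    proof -
      have "mm (Suc s0) \<le> mm s" using strict_mono_leD[OF sm] that by simp
      then have hs: "h < p (mm s)" using h(2) strict_mono_leD[OF pm] order_less_le_trans by blast
      show ?thesis
      proof (cases M')
        case 0
        then have "H = {h}" using H h by auto
        then have "{p j..q j} \<inter> H = {}" if "j \<in> supp (cc s)" for j
          using hs rng[of s] that strict_mono_leD[OF pm, of "mm s" j] by auto
        then show ?thesis using e by (simp add: hit_mass_def)
      next
        case (Suc M'')
        then have "H \<in> schreier (Suc M'')" "H \<noteq> {}" using H h(1) by (auto simp del: schreier.simps)
        then obtain As where As: "H = \<Union>(set As)" "\<And>B. B \<in> set As \<Longrightarrow> B \<in> schreier M''"
          "\<And>a. a \<in> H \<Longrightarrow> length As \<le> a" "\<And>i j. i < j \<Longrightarrow> j < length As \<Longrightarrow> Max (As ! i) < Min (As ! j)"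
          by (rule schreier_SucE) blast
        have "p (mm s) \<le> q (mm s)" using pq by (simp add: interlaced_def)
        then have q: "length As \<le> q (mm s)" "q (mm s) > 0" using As(3)[OF h(1)] hs by linarith+
        have "hit_mass p q (cc s) H \<le> (\<Sum>A\<leftarrow>As. hit_mass p q (cc s) A)"
          unfolding As(1) by (rule hit_mass_Union_le) (rule nn)
        also have "\<dots> \<le> (\<Sum>A\<leftarrow>As. e / (2 * q (mm s)))"
          using As(2) cc[of s] Suc M' by (intro sum_list_mono) (auto simp: special_comb_def)
        also have "\<dots> = length As * (e / (2 * q (mm s)))" by (simp add: sum_list_triv)
        also have "\<dots> \<le> q (mm s) * (e / (2 * q (mm s)))"
          using q e by (intro mult_right_mono) auto
        also have "\<dots> = e / 2" using q by simp
        finally show ?thesis .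
      qed
    qed
    have "(\<Sum>s<K. hit_mass p q (cc s) H) \<le> (\<Sum>s<K. e / 2 + of_bool (s = s0))"
    proof (rule sum_mono)
      fix s
      show "hit_mass p q (cc s) H \<le> e / 2 + of_bool (s = s0)"
        using before[of s] at[of s] after[of s] e by (cases s s0 rule: linorder_cases) auto
    qed
    also have "\<dots> = K * (e / 2) + (\<Sum>s<K. of_bool (s = s0))" by (simp add: sum.distrib)
    also have "(\<Sum>s<K. of_bool (s = s0)) \<le> (1::real)"
      by (simp add: of_bool_def sum.delta)
    also have "K * (e / 2) + 1 \<le> K * e" using K(1) e by (simp add: field_simps)
    finally show ?thesis unfolding mass using K(3) by (simp add: field_simps)
  qed
  moreover have "supp ?c \<subseteq> {mm 0..}"
  proof -
    have "mm 0 \<le> mm s" for s using strict_mono_leD[OF sm, of 0 s] by simp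
    then have "supp (cc s) \<subseteq> {mm 0..}" for s using rng[of s] by (meson atLeastLessThan_iff atLeast_iff order_trans subset_iff)
    then show ?thesis unfolding supp_c by blast
  qed
  ultimately show ?thesis unfolding special_comb_def using finc sum_c nn
    by (auto intro!: divide_nonneg_nonneg sum_nonneg)
qed

text \<open>The tolerance of a cell depends on its starting point. In the successive choice the
  start is therefore fixed first, beyond the support of the preceding combination, and the
  combination of lower order is taken afterwards.\<close>

lemma special_comb_exists:
  assumes pq: "interlaced p q" and "e > 0"
  shows "\<exists>c. special_comb p q M e m c"
  using assms(2)
proof (induction M arbitrary: e m)
  case 0
  have "p m \<ge> 1" using interlaced_ge[OF pq, of m] by simp
  then have "special_comb p q 0 e m (\<lambda>j. of_bool (j = m))"
    by (auto simp: special_comb_def supp_def)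
  then show ?case by blast
next
  case (Suc M)
  obtain K :: nat where K: "2 / e \<le> real K" "K \<ge> 1"
    by (metis One_nat_def Suc_leI linorder_le_cases nat_le_real_less of_nat_0_less_iff real_arch_simple order_trans
      less_one not_le of_nat_le_iff)
  have ppos: "q j \<ge> 1" for j
  proof -
    have "j < p j" "p j \<le> q j" using interlaced_ge[OF pq] pq by (auto simp: interlaced_def)
    then show ?thesis by linarith
  qed
  define P where "P = (\<lambda>(s::nat) (x::nat \<times> (nat \<Rightarrow> real)). max m K \<le> fst x \<and>
    special_comb p q M (e / (2 * q (fst x))) (fst x) (snd x))"
  have ex: "\<exists>x. P s x \<and> fst x = m'" if "m' \<ge> max m K" for s m'
  proof -
    have "e / (2 * q m') > 0" using Suc.prems ppos[of m'] by simp
    then obtain c where "special_comb p q M (e / (2 * q m')) m' c" using Suc.IH by blast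
    then show ?thesis using that unfolding P_def by (intro exI[of _ "(m', c)"]) auto
  qed
  have "\<exists>f. \<forall>s. P s (f s) \<and> supp (snd (f s)) \<subseteq> {..<fst (f (Suc s))}"
  proof (rule dependent_nat_choice)
    show "\<exists>x. P 0 x" using ex[of "max m K" 0] by blast
    fix x s assume "P s x"
    then have fin: "finite (supp (snd x))" by (simp add: P_def special_comb_def)
    then obtain b where b: "\<forall>j\<in>supp (snd x). j < b" by (meson finite_nat_set_iff_bounded)
    obtain y where "P (Suc s) y" "fst y = max b (max m K)" using ex[of "max b (max m K)" "Suc s", OF max.cobounded2] by blast
    then show "\<exists>y. P (Suc s) y \<and> supp (snd x) \<subseteq> {..<fst y}" using b
      by (intro exI[of _ y]) auto
  qed
  then obtain f where f: "\<And>s. P s (f s)" "\<And>s. supp (snd (f s)) \<subseteq> {..<fst (f (Suc s))}" by blast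
  have "special_comb p q (Suc M) e (fst (f 0)) (\<lambda>j. (\<Sum>s<K. snd (f s) j) / K)"
    by (rule special_comb_step[OF pq Suc.prems K(1) _ K(2)])
      (use f in \<open>auto simp: P_def\<close>)
  moreover have "m \<le> fst (f 0)" using f(1)[of 0] by (simp add: P_def)
  ultimately have "special_comb p q (Suc M) e m (\<lambda>j. (\<Sum>s<K. snd (f s) j) / K)"
    unfolding special_comb_def by (meson atLeast_subset_iff order_trans)
  then show ?case by blast
qed

section \<open>Weighted functionals\<close>

lemma admissible_separated:
  assumes "admissible M Es"
  shows "distinct Es" "\<And>E F. E \<in> set Es \<Longrightarrow> F \<in> set Es \<Longrightarrow> E \<noteq> F \<Longrightarrow> Max E < Min F \<or> Max F < Min E"
proof -
  have s: "sorted_wrt set_less Es" and ne: "\<And>E. E \<in> set Es \<Longrightarrow> finite E \<and> E \<noteq> {}"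
    using assms by (auto simp: admissible_def minima_in_def)
  have lt: "Max (Es ! i) < Min (Es ! j)" if "i < j" "j < length Es" for i j
  proof -
    have "set_less (Es ! i) (Es ! j)" using s that by (simp add: sorted_wrt_nth_less)
    then show ?thesis using ne[of "Es ! i"] ne[of "Es ! j"] that by (auto simp: set_less_def)
  qed
  have "Es ! i \<noteq> Es ! j" if "i < j" "j < length Es" for i j
  proof
    assume "Es ! i = Es ! j"
    then have "Max (Es ! j) < Min (Es ! j)" using lt[OF that] by simp
    moreover have "Min (Es ! j) \<le> Max (Es ! j)" using ne[of "Es ! j"] that by auto
    ultimately show False by simp
  qed
  then show "distinct Es" unfolding distinct_conv_nth by (metis nat_neq_iff)
  fix E F assume "E \<in> set Es" "F \<in> set Es" "E \<noteq> F"
  then obtain i j where "i < length Es" "j < length Es" "E = Es ! i" "F = Es ! j" by (metis in_set_conv_nth)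
  then show "Max E < Min F \<or> Max F < Min E"
    using lt \<open>E \<noteq> F\<close> by (cases i j rule: linorder_cases) auto
qed

text \<open>Admissible lists as sets: the order is determined by the minima, and unions of families
  over many blocks are easier to form.\<close>

definition admissible_family :: "nat \<Rightarrow> nat set set \<Rightarrow> bool" where
  "admissible_family k \<E> \<longleftrightarrow> finite \<E> \<and> \<E> \<noteq> {} \<and> (\<forall>E\<in>\<E>. finite E \<and> E \<noteq> {} \<and> E \<subseteq> {1..}) \<and>
     Min ` \<E> \<in> schreier k \<and> (\<forall>E\<in>\<E>. \<forall>F\<in>\<E>. E \<noteq> F \<longrightarrow> Max E < Min F \<or> Max F < Min E)"

lemma admissible_family_list:
  assumes "admissible_family k \<E>"
  obtains Es where "set Es = \<E>" "distinct Es" "admissible (schreier k) Es"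
proof -
  obtain Fs where Fs: "set Fs = \<E>" "distinct Fs"
    using assms finite_distinct_list[of \<E>] by (auto simp: admissible_family_def)
  define Es where "Es = sort_key Min Fs"
  have Es: "set Es = \<E>" "distinct Es" "sorted (map Min Es)" using Fs by (auto simp: Es_def)
  have "set_less (Es ! i) (Es ! j)" if "i < j" "j < length Es" for i j
  proof -
    have in': "Es ! i \<in> \<E>" "Es ! j \<in> \<E>" using that Es(1) by auto
    have "Es ! i \<noteq> Es ! j" using Es(2) that by (simp add: nth_eq_iff_index_eq)
    then have "Max (Es ! i) < Min (Es ! j) \<or> Max (Es ! j) < Min (Es ! i)"
      using assms in' unfolding admissible_family_def by meson
    moreover have "Min (Es ! i) \<le> Min (Es ! j)"
      using sorted_nth_mono[OF Es(3), of i j] that by simp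
    moreover have "Min (Es ! j) \<le> Max (Es ! j)" using assms in' by (auto simp: admissible_family_def)
    ultimately show ?thesis by (auto simp: set_less_def)
  qed
  then have "sorted_wrt set_less Es" by (simp add: sorted_wrt_iff_nth_less)
  then have "admissible (schreier k) Es"
    using assms Es unfolding admissible_def minima_in_def admissible_family_def by auto
  then show thesis using that Es by blast
qed

context tsirelson begin

abbreviation nrm where "nrm \<equiv> norm_of_set K"

lemma lower_estimate_family:
  assumes "k \<ge> 1" "admissible_family k \<E>" "x \<in> c00"
  shows "\<theta> k * (\<Sum>E\<in>\<E>. nrm (restr E x)) \<le> nrm x"
proof -
  obtain Es where "set Es = \<E>" "distinct Es" "admissible (schreier k) Es"
    using admissible_family_list assms(2) by blast
  then show ?thesis using lower_estimate[OF assms(1) _ assms(3)]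
    by (metis sum_list_distinct_conv_sum_set)
qed

text \<open>A functional in \<open>K\<close> may arise with several weights and from several lists,
  hence a relation that carries the children \<open>fs\<close> along.\<close>

definition of_weight :: "nat \<Rightarrow> (nat \<Rightarrow> real) \<Rightarrow> (nat \<Rightarrow> real) list \<Rightarrow> bool" where
  "of_weight w f fs \<longleftrightarrow> w \<ge> 1 \<and> (\<forall>g\<in>set fs. g \<in> K) \<and> admissible (schreier w) (map supp fs) \<and>
     f = (\<lambda>i. \<theta> w * (\<Sum>g\<leftarrow>fs. g i))"

lemma of_weight_in_K: "of_weight w f fs \<Longrightarrow> f \<in> K"
  unfolding of_weight_def by (auto intro: norming_set.combine)

lemma supp_facts: "f \<in> K \<Longrightarrow> finite (supp f) \<and> supp f \<noteq> {} \<and> supp f \<subseteq> {1..}"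
  using abs_le_one_and_supp by blast

lemma of_weight_separated:
  assumes "of_weight w f fs"
  shows "distinct fs" "inj_on supp (set fs)"
    "\<And>g h. g \<in> set fs \<Longrightarrow> h \<in> set fs \<Longrightarrow> g \<noteq> h \<Longrightarrow> Max (supp g) < Min (supp h) \<or> Max (supp h) < Min (supp g)"
proof -
  have adm: "admissible (schreier w) (map supp fs)" using assms by (simp add: of_weight_def)
  show d: "distinct fs" and inj: "inj_on supp (set fs)"
    using admissible_separated(1)[OF adm] by (auto simp: distinct_map)
  show "\<And>g h. g \<in> set fs \<Longrightarrow> h \<in> set fs \<Longrightarrow> g \<noteq> h \<Longrightarrow> Max (supp g) < Min (supp h) \<or> Max (supp h) < Min (supp g)"
    using admissible_separated(2)[OF adm] inj by (metis imageI inj_on_contraD set_map)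
qed

lemma of_weight_pairing:
  assumes "of_weight w f fs" shows "pairing x f = \<theta> w * (\<Sum>g\<in>set fs. pairing x g)"
  using assms of_weight_separated(1)[OF assms] pairing_functional_lincomb[of x "\<theta> w" fs]
  by (simp add: of_weight_def sum_list_distinct_conv_sum_set)

lemma of_weight_child: "of_weight w f fs \<Longrightarrow> g \<in> set fs \<Longrightarrow> g \<in> K"
  by (simp add: of_weight_def)

lemma Min_le_Max_supp: "f \<in> K \<Longrightarrow> Min (supp f) \<le> Max (supp f)"
  using supp_facts[of f] by (meson Max_ge Min_in)

lemma of_weight_less:
  assumes f: "of_weight w f fs" and gh: "g \<in> set fs" "h \<in> set fs" "Min (supp g) < Min (supp h)"
  shows "Max (supp g) < Min (supp h)"
proof -
  have "g \<noteq> h" using gh(3) by auto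
  then show ?thesis
    using of_weight_separated(3)[OF f gh(1,2)] Min_le_Max_supp[OF of_weight_child[OF f gh(1)]]
      Min_le_Max_supp[OF of_weight_child[OF f gh(2)]] gh(3) by linarith
qed

lemma of_weight_inj_Min:
  assumes f: "of_weight w f fs" shows "inj_on (\<lambda>g. Min (supp g)) (set fs)"
proof (rule inj_onI, rule ccontr)
  fix g h assume gh: "g \<in> set fs" "h \<in> set fs" "Min (supp g) = Min (supp h)" "g \<noteq> h"
  then show False
    using of_weight_separated(3)[OF f gh(1,2,4)] Min_le_Max_supp[OF of_weight_child[OF f gh(1)]]
      Min_le_Max_supp[OF of_weight_child[OF f gh(2)]] by linarith
qed

lemma of_weight_value:
  assumes f: "of_weight w f fs" and g: "g \<in> set fs" "g i \<noteq> 0"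
  shows "f i = \<theta> w * g i"
proof -
  have "h i = 0" if h: "h \<in> set fs" "h \<noteq> g" for h
  proof (rule ccontr)
    assume "h i \<noteq> 0"
    then have "i \<in> supp h" "i \<in> supp g" using g(2) by (auto simp: supp_def)
    moreover have "finite (supp h)" "finite (supp g)" using supp_facts of_weight_child[OF f] h(1) g(1) by blast+
    ultimately have "i \<le> Max (supp h)" "i \<le> Max (supp g)" "Min (supp h) \<le> i" "Min (supp g) \<le> i" by auto
    then show False using of_weight_separated(3)[OF f h(1) g(1) h(2)] by linarith
  qed
  then have "(\<Sum>g\<in>set fs. g i) = g i"
    using g by (subst sum.remove[of _ g]) (auto intro!: sum.neutral)
  then show ?thesis
    using f of_weight_separated(1)[OF f] by (simp add: of_weight_def sum_list_distinct_conv_sum_set)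
qed

lemma of_weight_zero:
  assumes f: "of_weight w f fs" and 0: "\<And>g. g \<in> set fs \<Longrightarrow> g i = 0" shows "f i = 0"
proof -
  have "(\<Sum>g\<in>set fs. g i) = 0" using 0 by (intro sum.neutral) auto
  then show ?thesis
    using f of_weight_separated(1)[OF f] by (simp add: of_weight_def sum_list_distinct_conv_sum_set)
qed

lemma of_weight_supp:
  assumes f: "of_weight w f fs" shows "supp f = (\<Union>g\<in>set fs. supp g)"
proof -
  have "\<theta> w \<noteq> 0" using f theta[of w] by (auto simp: of_weight_def)
  then have "f i \<noteq> 0 \<longleftrightarrow> (\<exists>g\<in>set fs. g i \<noteq> 0)" for i
    using of_weight_value[OF f] of_weight_zero[OF f] by (metis mult_eq_0_iff)
  then show ?thesis by (auto simp: supp_def)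
qed

lemma of_weight_abs_le:
  assumes f: "of_weight w f fs" shows "\<bar>f i\<bar> \<le> \<theta> w"
proof -
  have w: "\<theta> w > 0" using f theta[of w] by (auto simp: of_weight_def)
  show ?thesis
  proof (cases "\<exists>g\<in>set fs. g i \<noteq> 0")
    case True
    then obtain g where g: "g \<in> set fs" "g i \<noteq> 0" by blast
    then have "\<bar>g i\<bar> \<le> 1" using abs_le_one_and_supp of_weight_child[OF f] by blast
    then show ?thesis using of_weight_value[OF f g] w by (simp add: abs_mult)
  next
    case False
    then show ?thesis using of_weight_zero[OF f, of i] w by auto
  qed
qed

lemma of_weight_range:
  assumes f: "of_weight w f fs" and g: "g \<in> set fs"
  shows "{Min (supp g)..Max (supp g)} \<subseteq> {Min (supp f)..Max (supp f)}"
proof -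
  have "supp g \<subseteq> supp f" using of_weight_supp[OF f] g by auto
  then show ?thesis
    using supp_facts[OF of_weight_child[OF f g]] supp_facts[OF of_weight_in_K[OF f]]
      Min_antimono[of "supp g" "supp f"] Max_mono[of "supp g" "supp f"] by auto
qed

lemma of_weight_Min:
  assumes f: "of_weight w f fs" shows "\<exists>g\<in>set fs. Min (supp g) = Min (supp f)"
proof -
  have ff: "finite (supp f)" "supp f \<noteq> {}" using supp_facts[OF of_weight_in_K[OF f]] by auto
  obtain g where g: "g \<in> set fs" "Min (supp f) \<in> supp g" using Min_in[OF ff] of_weight_supp[OF f] by auto
  have "Min (supp g) \<le> Min (supp f)" using g supp_facts[OF of_weight_child[OF f g(1)]] by simp
  moreover have "Min (supp f) \<le> Min (supp g)"
    using of_weight_supp[OF f] g(1) supp_facts[OF of_weight_child[OF f g(1)]] ff by (intro Min_antimono) auto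
  ultimately show ?thesis using g(1) by (intro bexI[of _ g]) auto
qed

text \<open>Children that meet \<open>x\<close> but do not begin in \<open>{a..b}\<close> begin
  before \<open>a\<close> and reach up to \<open>a\<close>; successive supports allow only one such
  child. So a functional splits a block only if the block contains the minimum of a child, and these
  minima form a set of order \<open>w\<close>.\<close>

lemma of_weight_single_child:
  assumes f: "of_weight w f fs" and x: "supp x \<subseteq> {a..b}"
    and no: "\<And>g. g \<in> set fs \<Longrightarrow> Min (supp g) \<notin> {a..b}"
  shows "pairing x f = 0 \<or>
    (\<exists>g\<in>set fs. Min (supp g) < a \<and> a \<le> Max (supp g) \<and> pairing x f = \<theta> w * pairing x g)"
proof (cases "\<exists>g\<in>set fs. pairing x g \<noteq> 0")
  case False
  then show ?thesis using of_weight_pairing[OF f] by simp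
next
  case True
  then obtain g where g: "g \<in> set fs" "pairing x g \<noteq> 0" by blast
  have range: "Min (supp h) < a \<and> a \<le> Max (supp h)" if h: "h \<in> set fs" "pairing x h \<noteq> 0" for h
  proof -
    obtain i where i: "i \<in> supp x" "i \<in> supp h" using pairing_eq_zero[of x h] h(2) by blast
    have fin: "finite (supp h)" using f h supp_facts by (auto simp: of_weight_def)
    have "Min (supp h) \<le> i" "i \<le> Max (supp h)" using i fin by auto
    then show ?thesis using i x no[OF h(1)] by fastforce
  qed
  have "pairing x h = 0" if "h \<in> set fs" "h \<noteq> g" for h
  proof (rule ccontr)
    assume "pairing x h \<noteq> 0"
    then show False
      using range[OF that(1)] range[OF g] of_weight_separated(3)[OF f that(1) g(1) that(2)] by linarith
  qed
  then have "(\<Sum>g\<in>set fs. pairing x g) = pairing x g"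
    using g by (subst sum.remove[of _ g]) (auto intro!: sum.neutral)
  then show ?thesis using of_weight_pairing[OF f] g range[OF g] by auto
qed

lemma of_weight_minima:
  assumes "of_weight w f fs" shows "(\<lambda>g. Min (supp g)) ` set fs \<in> schreier w"
  using assms by (simp add: of_weight_def admissible_def minima_in_def image_image)

lemma of_weight_compose:
  assumes f: "of_weight w f fs" and I: "I \<subseteq> set fs"
    and G: "\<And>g. g \<in> I \<Longrightarrow> G g \<in> schreier s \<and> G g \<noteq> {} \<and> G g \<subseteq> {Min (supp g)..Max (supp g)}"
  shows "(\<Union>g\<in>I. G g) \<in> schreier (w + s)"
proof (rule schreier_compose)
  show "inj_on (\<lambda>g. Min (supp g)) I" using of_weight_inj_Min[OF f] I by (rule inj_on_subset)
  show "(\<lambda>g. Min (supp g)) ` I \<in> schreier w"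
    by (rule schreier_hereditary[OF of_weight_minima[OF f] image_mono[OF I]])
  have rng: "Min (G g) \<in> {Min (supp g)..Max (supp g)}" "Max (G g) \<in> {Min (supp g)..Max (supp g)}" if "g \<in> I" for g
    using G[OF that] schreier_finite Min_in Max_in by blast+
  fix g assume g: "g \<in> I"
  show "G g \<in> schreier s \<and> G g \<noteq> {} \<and> Min (supp g) \<le> Min (G g)"
    using G[OF g] rng(1)[OF g] by simp
  fix h assume h: "h \<in> I" "Min (supp g) < Min (supp h)"
  have "Max (supp g) < Min (supp h)" using of_weight_less[OF f _ _ h(2)] g h(1) I by blast
  then show "Max (G g) < Min (G h)" using rng(2)[OF g] rng(1)[OF h(1)] by simp
qed

text \<open>The blocks containing the minimum of a child have total mass at most \<open>e\<close>,
  since the minima form a set of order \<open>w < M\<close>. On every other block a single child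
  acts, and contributes at most \<open>\<theta> w\<close>.\<close>

lemma average_weight_le:
  assumes pq: "interlaced p q"
    and v: "\<And>j. v j \<in> c00 \<and> supp (v j) \<subseteq> {p j..q j} \<and> nrm (v j) \<le> 1"
    and c: "special_comb p q M e m c" and w: "w < M" and f: "of_weight w f fs"
  shows "\<bar>pairing (\<lambda>i. \<Sum>j\<in>supp c. c j * v j i) f\<bar> \<le> \<theta> w + e"
proof -
  have fin: "finite (supp c)" and nn: "\<And>j. c j \<ge> 0" and one: "sum c (supp c) = 1"
    using c by (auto simp: special_comb_def)
  have t: "\<theta> w > 0" using f theta by (auto simp: of_weight_def)
  define H where "H = (\<lambda>g. Min (supp g)) ` set fs"
  have mass: "hit_mass p q c H \<le> e"
    using c w of_weight_minima[OF f] by (auto simp: special_comb_def H_def)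
  have le1: "\<bar>pairing (v j) g\<bar> \<le> 1" if "g \<in> K" for j g
    using abs_pairing_le_norm[OF that, of "v j"] v[of j] by linarith
  have each: "\<bar>pairing (v j) f\<bar> \<le> \<theta> w + of_bool ({p j..q j} \<inter> H \<noteq> {})" for j
  proof (cases "{p j..q j} \<inter> H = {}")
    case True
    have "pairing (v j) f = 0 \<or> (\<exists>g\<in>set fs. Min (supp g) < p j \<and> p j \<le> Max (supp g) \<and> pairing (v j) f = \<theta> w * pairing (v j) g)"
      by (rule of_weight_single_child[OF f]) (use v True in \<open>auto simp: H_def\<close>)
    then show ?thesis
    proof
      assume "\<exists>g\<in>set fs. Min (supp g) < p j \<and> p j \<le> Max (supp g) \<and> pairing (v j) f = \<theta> w * pairing (v j) g"
      then obtain g where g: "g \<in> set fs" "pairing (v j) f = \<theta> w * pairing (v j) g" by blast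
      have "g \<in> K" using g f by (simp add: of_weight_def)
      then show ?thesis using g(2) t le1[of g j] True by (simp add: abs_mult)
    qed (use t in simp)
  next
    case False
    then show ?thesis using le1[OF of_weight_in_K[OF f], of j] t by simp
  qed
  have "pairing (\<lambda>i. \<Sum>j\<in>supp c. c j * v j i) f = (\<Sum>j\<in>supp c. c j * pairing (v j) f)"
    using fin v by (intro pairing_lincomb) auto
  also have "\<bar>\<dots>\<bar> \<le> (\<Sum>j\<in>supp c. \<bar>c j * pairing (v j) f\<bar>)" by (rule sum_abs)
  also have "\<dots> \<le> (\<Sum>j\<in>supp c. c j * \<theta> w + c j * of_bool ({p j..q j} \<inter> H \<noteq> {}))"
  proof (rule sum_mono)
    fix j
    have "\<bar>c j * pairing (v j) f\<bar> = c j * \<bar>pairing (v j) f\<bar>" using nn[of j] by (simp add: abs_mult)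
    also have "\<dots> \<le> c j * (\<theta> w + of_bool ({p j..q j} \<inter> H \<noteq> {}))" by (rule mult_left_mono[OF each nn])
    finally show "\<bar>c j * pairing (v j) f\<bar> \<le> c j * \<theta> w + c j * of_bool ({p j..q j} \<inter> H \<noteq> {})"
      by (simp only: distrib_left)
  qed
  also have "\<dots> = \<theta> w + hit_mass p q c H"
    by (simp add: sum.distrib hit_mass_def sum_distrib_right[symmetric] one)
  finally show ?thesis using mass by simp
qed

end

text \<open>Stands for the linear span of a block sequence: besides linearity it asks for nonzero
  vectors arbitrarily far out, which is what the successive choices of blocks use.\<close>

definition tail_rich :: "(nat \<Rightarrow> real) set \<Rightarrow> bool" where
  "tail_rich Y \<longleftrightarrow> Y \<subseteq> c00 \<and> (\<forall>x\<in>Y. \<forall>y\<in>Y. (\<lambda>i. x i + y i) \<in> Y) \<and> (\<forall>x\<in>Y. \<forall>c. (\<lambda>i. c * x i) \<in> Y) \<and>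
     (\<forall>m. \<exists>x\<in>Y. x \<noteq> (\<lambda>_. 0) \<and> supp x \<subseteq> {m..})"

lemma tail_rich_lincomb:
  assumes "tail_rich Y" "finite S" "\<And>k. k \<in> S \<Longrightarrow> x k \<in> Y"
  shows "(\<lambda>i. \<Sum>k\<in>S. d k * x k i) \<in> Y"
  using assms(2,3)
proof (induction S rule: finite_induct)
  case empty
  obtain y where "y \<in> Y" using assms(1) by (auto simp: tail_rich_def)
  then have "(\<lambda>i. 0 * y i) \<in> Y" using assms(1) unfolding tail_rich_def by blast
  then show ?case by simp
next
  case (insert k S)
  have "(\<lambda>i. d k * x k i) \<in> Y" using assms(1) insert.prems[of k] unfolding tail_rich_def by auto
  moreover have "(\<lambda>i. \<Sum>k\<in>S. d k * x k i) \<in> Y" using insert by auto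
  moreover have "\<forall>x\<in>Y. \<forall>y\<in>Y. (\<lambda>i. x i + y i) \<in> Y" using assms(1) unfolding tail_rich_def by auto
  ultimately have "(\<lambda>i. d k * x k i + (\<Sum>k\<in>S. d k * x k i)) \<in> Y" by (simp only: Ball_def)
  then show ?case using insert by simp
qed

section \<open>Averages of large norm\<close>

lemma restr_block_sum:
  assumes pq: "interlaced p q" and v: "\<And>j. supp (v j) \<subseteq> {p j..q j}"
    and S: "finite S" "s \<in> S" and E: "E \<subseteq> {p s..q s}"
  shows "restr E (\<lambda>i. \<Sum>j\<in>S. c j * v j i) = (\<lambda>i. c s * restr E (v s) i)"
proof
  fix i
  show "restr E (\<lambda>i. \<Sum>j\<in>S. c j * v j i) i = c s * restr E (v s) i"
  proof (cases "i \<in> E")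
    case True
    have "v j i = 0" if "j \<noteq> s" for j
    proof (rule ccontr)
      assume "v j i \<noteq> 0"
      then have "i \<in> {p j..q j}" using v[of j] by (auto simp: supp_def)
      moreover have "i \<in> {p s..q s}" using True E by auto
      ultimately show False
        using interlaced_less[OF pq, of j s] interlaced_less[OF pq, of s j] that
        by (cases j s rule: linorder_cases) auto
    qed
    then have "(\<Sum>j\<in>S. c j * v j i) = c s * v s i"
      using S by (subst sum.remove[of _ s]) (auto intro!: sum.neutral)
    then show ?thesis using True by (simp add: restr_def)
  qed (simp add: restr_def)
qed

lemma interlaced_supports:
  assumes "\<And>s. finite (supp (v s)) \<and> supp (v s) \<noteq> {} \<and> supp (v s) \<subseteq> {1..}"
    and "\<And>s. supp (v (Suc s)) \<subseteq> {Suc (Max (supp (v s)))..}"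
  shows "interlaced (\<lambda>s. Min (supp (v s))) (\<lambda>s. Max (supp (v s)))"
proof -
  have "Min (supp (v s)) \<in> supp (v s)" for s using assms(1)[of s] Min_in by blast
  then have "1 \<le> Min (supp (v s)) \<and> Suc (Max (supp (v s))) \<le> Min (supp (v (Suc s)))" for s
    using assms(1)[of s] assms(2)[of s] by (meson atLeast_iff subsetD)
  moreover have "Min (supp (v s)) \<le> Max (supp (v s))" for s
    using assms(1)[of s] by auto
  ultimately show ?thesis by (auto simp: interlaced_def Suc_le_eq)
qed

lemma nonzero_supp: "x \<in> c00 \<Longrightarrow> x \<noteq> (\<lambda>_. 0) \<Longrightarrow> finite (supp x) \<and> supp x \<noteq> {} \<and> supp x \<subseteq> {1..}"
  using finite_supp supp_pos supp_eq_empty by blast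

locale tsirelson_root = tsirelson +
  assumes root: "(\<lambda>n. \<theta> n powr (1 / real n)) \<longlonglongrightarrow> 1"
begin

lemma theta_antimono: "1 \<le> m \<Longrightarrow> m \<le> n \<Longrightarrow> \<theta> n \<le> \<theta> m"
proof (induction n)
  case (Suc n)
  then show ?case
  proof (cases "m = Suc n")
    case False
    then have "\<theta> (Suc n) \<le> \<theta> n" using reg Suc.prems unfolding regular_seq_def by simp
    then show ?thesis using Suc False by simp
  qed simp
qed simp

lemma theta_eventually_ge:
  assumes "0 < r" "r < 1" shows "\<exists>n0\<ge>1. \<forall>n\<ge>n0. r ^ n \<le> \<theta> n"
proof -
  have "eventually (\<lambda>n. r < \<theta> n powr (1 / real n)) sequentially"
    using order_tendstoD(1)[OF root assms(2)] .
  then obtain n0 where n0: "\<And>n. n \<ge> n0 \<Longrightarrow> r < \<theta> n powr (1 / real n)"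
    by (auto simp: eventually_sequentially)
  have "r ^ n \<le> \<theta> n" if "n \<ge> max n0 1" for n
  proof -
    have n: "n \<ge> 1" "n \<ge> n0" using that by auto
    have "r ^ n \<le> (\<theta> n powr (1 / real n)) ^ n"
      using n0[OF n(2)] assms by (intro power_mono) auto
    also have "\<dots> = \<theta> n"
      using theta[OF n(1)] n(1) by (simp add: powr_realpow[symmetric] powr_powr)
    finally show ?thesis .
  qed
  then show ?thesis by (intro exI[of _ "max n0 1"]) auto
qed

text \<open>\<open>\<theta>\<close> cannot lose a factor 2 on every stretch of length
  \<open>R\<close>. With \<open>r ^ R = 3/4\<close>, eventually
  \<open>\<theta> n \<ge> r ^ n\<close>, so \<open>2 ^ k * \<theta> (m + k * R)\<close> grows at
  least like \<open>(3/2) ^ k\<close>.\<close>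

lemma not_geometric:
  assumes "R \<ge> 1" "C > 0" shows "\<exists>k\<ge>1. C < 2 ^ k * \<theta> (m + k * R)"
proof -
  define r where "r = root R (3/4::real)"
  have r: "0 < r" "r < 1" "r ^ R = 3/4" using assms(1) by (auto simp: r_def)
  obtain n0 where n0: "\<forall>n\<ge>n0. r ^ n \<le> \<theta> n" "n0 \<ge> 1" using theta_eventually_ge[OF r(1,2)] by blast
  obtain k0 :: nat where k0: "C / r ^ m < (3/2) ^ k0" using real_arch_pow[of "3/2" "C / r ^ m"] by auto
  define k where "k = max k0 n0"
  have "k * 1 \<le> k * R" using assms(1) by (intro mult_left_mono) auto
  then have "n0 \<le> m + k * R" by (simp add: k_def)
  then have "r ^ (m + k * R) \<le> \<theta> (m + k * R)" using n0 by blast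
  moreover have "r ^ (m + k * R) = r ^ m * (3/4) ^ k" by (simp only: power_add mult.commute[of k] power_mult r(3))
  ultimately have "2 ^ k * (r ^ m * (3/4) ^ k) \<le> 2 ^ k * \<theta> (m + k * R)" by simp
  moreover have "2 ^ k * (r ^ m * (3/4) ^ k) = r ^ m * (3/2::real) ^ k" 
    by (simp add: power_mult_distrib[symmetric] mult.left_commute)
  moreover have "(3/2::real) ^ k0 \<le> (3/2) ^ k" by (intro power_increasing) (auto simp: k_def)
  moreover have "C < r ^ m * (3/2) ^ k0" using k0 r by (simp add: field_simps)
  moreover have "r ^ m * (3/2) ^ k0 \<le> r ^ m * (3/2) ^ k" using calculation(3) r by simp
  ultimately have "C < 2 ^ k * \<theta> (m + k * R)" by linarith
  moreover have "k \<ge> 1" using n0(2) by (simp add: k_def)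
  ultimately show ?thesis by blast
qed

text \<open>James' argument: if averages of order \<open>M + 1\<close> always had norm below \<open>1/2\<close>, then iterating them
  \<open>k\<close> times would give \<open>\<theta>\<close> at \<open>k * (M + 1)\<close> at most \<open>2\<^sup>-\<^sup>k\<close>.\<close>

lemma james_average:
  assumes Y: "tail_rich Y"
  shows "\<exists>z\<in>Y. supp z \<subseteq> {m..} \<and> 1 / 2 \<le> nrm z \<and> nrm z \<le> 1 \<and>
    (\<forall>w f fs. w \<le> M \<longrightarrow> of_weight w f fs \<longrightarrow> \<bar>pairing z f\<bar> \<le> 2 * \<theta> w)"
proof (rule ccontr)
  assume neg: "\<not> ?thesis"
  define R where "R = M + 1"
  \<comment> \<open>The claim to be iterated: a normalized vector beyond \<open>m'\<close> with a
    family of order \<open>k * R\<close> over which its norms add up to at least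
    \<open>2 ^ k\<close>. The family is carried along because the final contradiction applies the
    lower estimate to it.\<close>
  define good where "good k m' v \<E> \<longleftrightarrow> v \<in> Y \<and> supp v \<subseteq> {m'..} \<and> nrm v = 1 \<and>
    admissible_family (k * R) \<E> \<and> (\<forall>E\<in>\<E>. E \<subseteq> supp v) \<and> 2 ^ k \<le> (\<Sum>E\<in>\<E>. nrm (restr E v))" for k m' v \<E>
  have Yc: "x \<in> c00" if "x \<in> Y" for x using Y that by (auto simp: tail_rich_def)
  have normalize: "(\<lambda>i. (1 / nrm x) * x i) \<in> Y \<and> nrm (\<lambda>i. (1 / nrm x) * x i) = 1 \<and>
      supp (\<lambda>i. (1 / nrm x) * x i) = supp x" if x: "x \<in> Y" "x \<noteq> (\<lambda>_. 0)" for x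
  proof -
    have pos: "nrm x > 0" using norm_pos Yc x by blast
    have "nrm (\<lambda>i. (1 / nrm x) * x i) = 1" using norm_scale[OF Yc[OF x(1)], of "1 / nrm x"] pos by simp
    moreover have "(\<lambda>i. (1 / nrm x) * x i) \<in> Y" using Y x unfolding tail_rich_def by blast
    moreover have "supp (\<lambda>i. (1 / nrm x) * x i) = supp x" using pos by (auto simp: supp_def)
    ultimately show ?thesis by blast
  qed
  have ex: "\<exists>v \<E>. good k m' v \<E>" if "m' \<ge> m" for k m'
    using that
  proof (induction k arbitrary: m')
    case 0
    obtain x where x: "x \<in> Y" "x \<noteq> (\<lambda>_. 0)" "supp x \<subseteq> {m'..}" using Y unfolding tail_rich_def by blast
    define v where "v = (\<lambda>i. (1 / nrm x) * x i)"
    have v: "v \<in> Y" "nrm v = 1" "supp v = supp x" using normalize[OF x(1,2)] by (auto simp: v_def)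
    have s: "finite (supp v)" "supp v \<noteq> {}" "supp v \<subseteq> {1..}" using v x nonzero_supp[OF Yc[OF x(1)] x(2)] by auto
    then have "1 \<le> Min (supp v)" using Min_in by blast
    then have "Min (supp v) \<in> {1..}" by simp
    then have "good 0 m' v {supp v}"
      using v x s singleton_schreier[of "Min (supp v)" 0]
      by (auto simp: good_def admissible_family_def restr_superset simp del: schreier.simps)
    then show ?case by blast
  next
    case (Suc k)
    define P where "P = (\<lambda>(s::nat) x. good k m' (fst x) (snd x))"
    have "\<exists>f. \<forall>s. P s (f s) \<and> supp (fst (f (Suc s))) \<subseteq> {Suc (Max (supp (fst (f s))))..}"
    proof (rule dependent_nat_choice)
      show "\<exists>x. P 0 x" using Suc unfolding P_def by fastforce
      fix x s assume "P s x"
      have "m \<le> max m' (Suc (Max (supp (fst x))))" using Suc.prems by simp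
      then obtain v \<E> where "good k (max m' (Suc (Max (supp (fst x))))) v \<E>" using Suc.IH by blast
      then show "\<exists>y. P (Suc s) y \<and> supp (fst y) \<subseteq> {Suc (Max (supp (fst x)))..}"
        unfolding P_def good_def by (intro exI[of _ "(v, \<E>)"]) auto
    qed
    then obtain f where f: "\<And>s. P s (f s)" "\<And>s. supp (fst (f (Suc s))) \<subseteq> {Suc (Max (supp (fst (f s))))..}"
      by blast
    define v where "v s = fst (f s)" for s
    define \<E> where "\<E> s = snd (f s)" for s
    have good: "good k m' (v s) (\<E> s)" for s using f(1)[of s] by (simp add: P_def v_def \<E>_def)
    have vY: "v s \<in> Y" and vn: "nrm (v s) = 1" and vs: "supp (v s) \<subseteq> {m'..}" for s
      using good[of s] by (auto simp: good_def)
    have vc: "v s \<in> c00" for s using vY Yc by blast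
    have v0: "v s \<noteq> (\<lambda>_. 0)" for s
      using vn[of s] norm_le_l1[of "\<lambda>_. 0"] by (auto simp: supp_def)
    have vsupp: "finite (supp (v s)) \<and> supp (v s) \<noteq> {} \<and> supp (v s) \<subseteq> {1..}" for s
      using nonzero_supp[OF vc v0] .
    define p where "p s = Min (supp (v s))" for s
    define q where "q s = Max (supp (v s))" for s
    have pq: "interlaced p q" unfolding p_def q_def
      by (rule interlaced_supports) (use vsupp f(2) v_def in auto)
    have sub: "supp (v s) \<subseteq> {p s..q s}" for s using vsupp[of s] by (auto simp: p_def q_def)
    \<comment> \<open>With this tolerance \<open>\<theta> w + e \<le> 2 * \<theta> w\<close> for all
      weights \<open>w \<le> M\<close>; the \<open>max\<close> keeps away from the index 0, where
      \<open>\<theta>\<close> is not constrained.\<close>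
    define e where "e = \<theta> (max 1 M)"
    have e: "e > 0" using theta by (simp add: e_def)
    obtain c where c: "special_comb p q R e 0 c" using special_comb_exists[OF pq e] by blast
    have cfin: "finite (supp c)" and cnn: "\<And>s. c s \<ge> 0" and c1: "sum c (supp c) = 1"
      using c by (auto simp: special_comb_def)
    define z where "z = (\<lambda>i. \<Sum>s\<in>supp c. c s * v s i)"
    have zY: "z \<in> Y" unfolding z_def by (rule tail_rich_lincomb[OF Y cfin vY])
    have zsupp: "supp z \<subseteq> {m'..}"
    proof
      fix i assume "i \<in> supp z"
      then obtain s where "c s * v s i \<noteq> 0"
        unfolding z_def supp_def by (auto elim: sum.not_neutral_contains_not_neutral)
      then show "i \<in> {m'..}" using vs[of s] by (auto simp: supp_def)
    qed
    have "nrm z \<le> (\<Sum>s\<in>supp c. \<bar>c s\<bar> * nrm (v s))"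
      unfolding z_def by (rule norm_lincomb_le[OF cfin vc])
    also have "\<dots> = 1" using cnn c1 vn by simp
    finally have z1: "nrm z \<le> 1" .
    have zw: "\<bar>pairing z f\<bar> \<le> 2 * \<theta> w" if w: "w \<le> M" and fs: "of_weight w f fs" for w f fs
    proof -
      have w1: "w \<ge> 1" using fs by (simp add: of_weight_def)
      have "\<bar>pairing z f\<bar> \<le> \<theta> w + e"
        unfolding z_def using w vc sub vn by (intro average_weight_le[OF pq _ c _ fs]) (auto simp: R_def)
      moreover have "e \<le> \<theta> w" unfolding e_def using w1 w by (intro theta_antimono) auto
      ultimately show ?thesis by simp
    qed
    \<comment> \<open>All other requirements on an average hold for \<open>z\<close>, so
      \<open>neg\<close> forces its norm below \<open>1/2\<close>. Normalizing \<open>z\<close> then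
      more than doubles the norms of its pieces, which is the gain from \<open>2 ^ k\<close> to
      \<open>2 ^ Suc k\<close>.\<close>
    have zhalf: "nrm z < 1 / 2"
    proof (rule ccontr)
      assume "\<not> nrm z < 1 / 2"
      then have "1 / 2 \<le> nrm z" by simp
      moreover have "supp z \<subseteq> {m..}" using zsupp Suc.prems by (meson atLeast_subset_iff order_trans)
      ultimately show False using neg zY z1 zw by blast
    qed
    have restr_z: "restr E z = (\<lambda>i. c s * restr E (v s) i)" if "s \<in> supp c" "E \<subseteq> {p s..q s}" for s E
      unfolding z_def by (rule restr_block_sum[OF pq sub cfin that])
    obtain s0 where s0: "s0 \<in> supp c" using c1 by (cases "supp c = {}") auto
    have "c s0 = nrm (restr (supp (v s0)) z)"
      using restr_z[OF s0 sub] norm_scale[OF vc, of "c s0" s0] cnn vn by (simp add: restr_superset)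
    moreover have "c s0 > 0" using s0 cnn[of s0] by (simp add: supp_def)
    ultimately have zpos: "nrm z > 0" using norm_restr_le[OF Yc[OF zY]] by (metis order_less_le_trans)
    then have z0: "z \<noteq> (\<lambda>_. 0)" using norm_le_l1[of "\<lambda>_. 0"] by (auto simp: supp_def)
    define \<E>' where "\<E>' = (\<Union>s\<in>supp c. \<E> s)"
    have fam: "admissible_family (k * R) (\<E> s)" "\<forall>E\<in>\<E> s. E \<subseteq> supp (v s)"
      "2 ^ k \<le> (\<Sum>E\<in>\<E> s. nrm (restr E (v s)))" for s
      using good[of s] unfolding good_def by iprover+
    have E1: "finite (\<E> s)" "\<E> s \<noteq> {}" "Min ` \<E> s \<in> schreier (k * R)" for s
      using fam(1)[of s] unfolding admissible_family_def by iprover+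
    have E3: "finite E \<and> E \<noteq> {} \<and> E \<subseteq> {1..} \<and> E \<subseteq> supp (v s)" if "E \<in> \<E> s" for s E
      using fam(1,2)[of s] that unfolding admissible_family_def by simp
    have E5: "Max E < Min F \<or> Max F < Min E" if "E \<in> \<E> s" "F \<in> \<E> s" "E \<noteq> F" for s E F
    proof -
      have "\<forall>E\<in>\<E> s. \<forall>F\<in>\<E> s. E \<noteq> F \<longrightarrow> Max E < Min F \<or> Max F < Min E"
        using fam(1)[of s] unfolding admissible_family_def by iprover
      then show ?thesis using that by blast
    qed
    have rng: "p s \<le> Min E \<and> Min E \<le> Max E \<and> Max E \<le> q s" if "E \<in> \<E> s" for s E
      using E3[OF that] sub[of s] vsupp[of s] by (auto simp: p_def q_def)
    have sep: "Max E < Min F" if "E \<in> \<E> s" "F \<in> \<E> t" "s < t" for E F s t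
      using rng[OF that(1)] rng[OF that(2)] interlaced_less[OF pq that(3)] by linarith
    have "admissible_family (Suc k * R) \<E>'"
      unfolding admissible_family_def
    proof (intro conjI ballI impI)
      show "finite \<E>'" "\<E>' \<noteq> {}" using cfin E1(1,2) s0 by (auto simp: \<E>'_def)
      show "\<And>E. E \<in> \<E>' \<Longrightarrow> finite E" "\<And>E. E \<in> \<E>' \<Longrightarrow> E \<noteq> {}" "\<And>E. E \<in> \<E>' \<Longrightarrow> E \<subseteq> {1..}"
        using E3 by (fastforce simp: \<E>'_def)+
      show "Max E < Min F \<or> Max F < Min E" if "E \<in> \<E>'" "F \<in> \<E>'" "E \<noteq> F" for E F
      proof -
        obtain s t where st: "E \<in> \<E> s" "F \<in> \<E> t" using \<open>E \<in> \<E>'\<close> \<open>F \<in> \<E>'\<close> by (auto simp: \<E>'_def)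
        then show ?thesis using sep[of E s F t] sep[of F t E s] E5[of E s F] \<open>E \<noteq> F\<close>
          by (cases s t rule: linorder_cases) auto
      qed
      have "(\<Union>s\<in>supp c. Min ` \<E> s) \<in> schreier (R + k * R)"
      proof (rule schreier_compose)
        show "inj_on p (supp c)" using interlaced_strict_mono[OF pq] strict_mono_on_imp_inj_on
          by (meson inj_on_subset strict_mono_imp_inj_on subset_UNIV)
        show "p ` supp c \<in> schreier R" using c by (simp add: special_comb_def)
        fix s
        show "Min ` \<E> s \<in> schreier (k * R) \<and> Min ` \<E> s \<noteq> {} \<and> p s \<le> Min (Min ` \<E> s)"
          using E1[of s] rng by auto
        fix t assume "p s < p t"
        then have "s < t" using interlaced_strict_mono[OF pq] by (simp add: strict_mono_less)
        then have "Min x < Min y" if "x \<in> \<E> s" "y \<in> \<E> t" for x y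
          using sep[OF that] rng[OF that(1)] by linarith
        then show "Max (Min ` \<E> s) < Min (Min ` \<E> t)" using E1(1,2) by auto
      qed
      then show "Min ` \<E>' \<in> schreier (Suc k * R)" by (simp add: \<E>'_def image_UN)
    qed
    moreover have "2 ^ k \<le> (\<Sum>E\<in>\<E>'. nrm (restr E z))"
    proof -
      have "(\<Sum>E\<in>\<E>'. nrm (restr E z)) = (\<Sum>s\<in>supp c. \<Sum>E\<in>\<E> s. nrm (restr E z))"
        unfolding \<E>'_def
      proof (rule sum.UNION_disjoint[OF cfin])
        show "\<forall>i\<in>supp c. finite (\<E> i)" using E1(1) by blast
        have "\<E> s \<inter> \<E> t = {}" if "s < t" for s t
        proof (rule ccontr)
          assume "\<E> s \<inter> \<E> t \<noteq> {}"
          then obtain D where "D \<in> \<E> s" "D \<in> \<E> t" by blast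
          then show False using sep[OF _ _ that] rng by (meson less_le_trans not_less)
        qed
        then show "\<forall>i\<in>supp c. \<forall>j\<in>supp c. i \<noteq> j \<longrightarrow> \<E> i \<inter> \<E> j = {}"
          by (metis inf_commute nat_neq_iff)
      qed
      also have "\<dots> = (\<Sum>s\<in>supp c. c s * (\<Sum>E\<in>\<E> s. nrm (restr E (v s))))"
      proof (rule sum.cong[OF refl])
        fix s assume s: "s \<in> supp c"
        have "nrm (restr E z) = c s * nrm (restr E (v s))" if "E \<in> \<E> s" for E
        proof -
          have "E \<subseteq> {p s..q s}" using E3[OF that] sub by blast
          then show ?thesis using restr_z[OF s] norm_scale[OF c00_restr[OF vc], of "c s" E s] cnn by simp
        qed
        then show "(\<Sum>E\<in>\<E> s. nrm (restr E z)) = c s * (\<Sum>E\<in>\<E> s. nrm (restr E (v s)))"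
          by (simp add: sum_distrib_left)
      qed
      also have "\<dots> \<ge> (\<Sum>s\<in>supp c. c s * 2 ^ k)"
        using cnn fam(3) by (intro sum_mono mult_left_mono) auto
      finally show ?thesis using c1 by (simp flip: sum_distrib_right)
    qed
    moreover have Esub: "E \<subseteq> supp z" if "E \<in> \<E>'" for E
    proof -
      obtain s where s: "s \<in> supp c" "E \<in> \<E> s" using \<open>E \<in> \<E>'\<close> by (auto simp: \<E>'_def)
      have "supp (v s) \<subseteq> supp z"
      proof
        fix i assume i: "i \<in> supp (v s)"
        have "z i = c s * v s i" using fun_cong[OF restr_z[OF s(1) sub], of i] i by (simp add: restr_def)
        then show "i \<in> supp z" using i s by (auto simp: supp_def)
      qed
      then show ?thesis using E3[OF s(2)] by blast
    qed
    define v' where "v' = (\<lambda>i. (1 / nrm z) * z i)"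
    have v': "v' \<in> Y" "nrm v' = 1" "supp v' = supp z" using normalize[OF zY z0] by (auto simp: v'_def)
    have "(\<Sum>E\<in>\<E>'. nrm (restr E v')) = (\<Sum>E\<in>\<E>'. nrm (restr E z)) / nrm z"
    proof -
      have "nrm (restr E v') = nrm (restr E z) / nrm z" for E
      proof -
        have "restr E v' = (\<lambda>i. (1 / nrm z) * restr E z i)" by (auto simp: restr_def v'_def)
        then show ?thesis using norm_scale[OF c00_restr[OF Yc[OF zY]], of "1 / nrm z" E] zpos by simp
      qed
      then show ?thesis by (simp add: sum_divide_distrib)
    qed
    moreover have "2 ^ Suc k \<le> (2::real) ^ k / nrm z" using zhalf zpos by (simp add: field_simps)
    ultimately have "2 ^ Suc k \<le> (\<Sum>E\<in>\<E>'. nrm (restr E v'))"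
      using zpos by (smt (verit) divide_right_mono)
    then have "good (Suc k) m' v' \<E>'"
      unfolding good_def using v' zsupp \<open>admissible_family (Suc k * R) \<E>'\<close> Esub by auto
    then show ?case by blast
  qed
  obtain k where k: "k \<ge> 1" "1 < 2 ^ k * \<theta> (0 + k * R)" using not_geometric[of R 1 0] by (auto simp: R_def)
  obtain v \<E> where g: "good k m v \<E>" using ex by blast
  have kR: "k * R \<ge> 1" using k(1) by (simp add: R_def)
  have "\<theta> (k * R) * 2 ^ k \<le> \<theta> (k * R) * (\<Sum>E\<in>\<E>. nrm (restr E v))"
    using g theta[OF kR] by (intro mult_left_mono) (auto simp: good_def)
  also have "\<dots> \<le> nrm v" by (rule lower_estimate_family[OF kR]) (use g Yc in \<open>auto simp: good_def\<close>)
  also have "\<dots> = 1" using g by (simp add: good_def)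
  finally show False using k(2) by (simp add: mult.commute)
qed

text \<open>The index at which the bound may fail depends on \<open>f\<close>; the statement for
  pairs says that there is at most one, without naming it.\<close>

definition rapid :: "real \<Rightarrow> (nat \<Rightarrow> nat \<Rightarrow> real) \<Rightarrow> bool" where
  "rapid \<delta> z \<longleftrightarrow> (\<forall>w f fs. of_weight w f fs \<longrightarrow>
     (\<forall>k l. k < l \<longrightarrow> \<bar>pairing (z k) f\<bar> \<le> 2 * \<theta> w + \<delta> \<or> \<bar>pairing (z l) f\<bar> \<le> 2 * \<theta> w + \<delta>))"

text \<open>\<open>z l\<close> is an average of order \<open>j l\<close>, chosen so large that
  \<open>\<theta> (j l)\<close> times the l1 norm of any earlier vector is at most
  \<open>\<delta>\<close>. Weights up to \<open>j l\<close> are small on \<open>z l\<close> by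
  \<open>james_average\<close>. A functional of larger weight has coefficients at most
  \<open>\<theta> (j l)\<close> and is therefore at most \<open>\<delta>\<close> on all earlier
  vectors.\<close>

lemma rapid_exists:
  assumes Y: "tail_rich Y" and \<delta>: "\<delta> > 0"
  shows "\<exists>z. (\<forall>k. z k \<in> Y \<and> 1 / 2 \<le> nrm (z k) \<and> nrm (z k) \<le> 1) \<and> rapid \<delta> z \<and>
    (\<forall>k. supp (z (Suc k)) \<subseteq> {Suc (Max (supp (z k)))..})"
proof -
  define l1 :: "(nat \<Rightarrow> real) \<Rightarrow> real" where "l1 x = (\<Sum>i\<in>supp x. \<bar>x i\<bar>)" for x
  \<comment> \<open>the state is \<open>(z, j, b)\<close>: the vector, the order up to which it is an average, and a bound
    for the \<open>\<ell>\<^sub>1\<close> norms so far\<close>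
  define P where "P = (\<lambda>(k::nat) (s :: (nat \<Rightarrow> real) \<times> nat \<times> real). case s of (z, j, b) \<Rightarrow>
    z \<in> Y \<and> 1 / 2 \<le> nrm z \<and> nrm z \<le> 1 \<and> j \<ge> 1 \<and> l1 z \<le> b \<and>
    (\<forall>w f fs. w \<le> j \<longrightarrow> of_weight w f fs \<longrightarrow> \<bar>pairing z f\<bar> \<le> 2 * \<theta> w))"
  define Q where "Q = (\<lambda>(s :: (nat \<Rightarrow> real) \<times> nat \<times> real) s'. case s of (z, j, b) \<Rightarrow> case s' of (z', j', b') \<Rightarrow>
    supp z' \<subseteq> {Suc (Max (supp z))..} \<and> \<theta> j' * b \<le> \<delta> \<and> b \<le> b')"
  have l1: "l1 x \<ge> 0" for x unfolding l1_def by (simp add: sum_nonneg)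
  have "\<exists>S. \<forall>k. P k (S k) \<and> Q (S k) (S (Suc k))"
  proof (rule dependent_nat_choice)
    obtain z where "z \<in> Y" "1 / 2 \<le> nrm z \<and> nrm z \<le> 1"
      "\<forall>w f fs. w \<le> 1 \<longrightarrow> of_weight w f fs \<longrightarrow> \<bar>pairing z f\<bar> \<le> 2 * \<theta> w"
      using james_average[OF Y, of 0 1] by blast
    then show "\<exists>x. P 0 x" by (intro exI[of _ "(z, 1, l1 z)"]) (auto simp: P_def)
    fix x k assume "P k x"
    obtain z j b where x: "x = (z, j, b)" by (cases x)
    have b: "b \<ge> 0" using \<open>P k x\<close> l1[of z] by (auto simp: P_def x)
    have "\<delta> / (b + 1) > 0" using \<delta> b by simp
    moreover have "\<theta> \<longlonglongrightarrow> 0" using reg by (simp add: regular_seq_def)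
    ultimately have "eventually (\<lambda>n. \<theta> n < \<delta> / (b + 1)) sequentially" by (simp add: order_tendstoD(2))
    then obtain n0 where n0: "\<And>n. n \<ge> n0 \<Longrightarrow> \<theta> n < \<delta> / (b + 1)" by (auto simp: eventually_sequentially)
    define j' where "j' = max 1 n0"
    have th: "\<theta> j' * b \<le> \<delta>"
    proof -
      have "\<theta> j' * b \<le> \<delta> / (b + 1) * b" using n0[of j'] b by (intro mult_right_mono) (auto simp: j'_def)
      also have "\<dots> \<le> \<delta>" using b \<delta> by (simp add: field_simps)
      finally show ?thesis .
    qed
    obtain z' where "z' \<in> Y" "supp z' \<subseteq> {Suc (Max (supp z))..}" "1 / 2 \<le> nrm z' \<and> nrm z' \<le> 1"
      "\<forall>w f fs. w \<le> j' \<longrightarrow> of_weight w f fs \<longrightarrow> \<bar>pairing z' f\<bar> \<le> 2 * \<theta> w"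
      using james_average[OF Y, of "Suc (Max (supp z))" j'] by blast
    then show "\<exists>y. P (Suc k) y \<and> Q x y"
      using th by (intro exI[of _ "(z', j', max b (l1 z'))"]) (auto simp: P_def Q_def x j'_def)
  qed
  then obtain S where S: "\<And>k. P k (S k)" "\<And>k. Q (S k) (S (Suc k))" by blast
  define z where "z k = fst (S k)" for k
  define j where "j k = fst (snd (S k))" for k
  define b where "b k = snd (snd (S k))" for k
  have z: "z k \<in> Y" "1 / 2 \<le> nrm (z k)" "nrm (z k) \<le> 1" "j k \<ge> 1" "l1 (z k) \<le> b k"
    "\<And>w f fs. w \<le> j k \<Longrightarrow> of_weight w f fs \<Longrightarrow> \<bar>pairing (z k) f\<bar> \<le> 2 * \<theta> w"
    "supp (z (Suc k)) \<subseteq> {Suc (Max (supp (z k)))..}" "\<theta> (j (Suc k)) * b k \<le> \<delta>" "b k \<le> b (Suc k)" for k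
    using S(1)[of k] S(2)[of k] by (auto simp: P_def Q_def z_def j_def b_def split: prod.splits)
  have bmono: "b k \<le> b l" if "k \<le> l" for k l using lift_Suc_mono_le[of b, OF z(9) that] .
  have small: "\<theta> (j l) * l1 (z k) \<le> \<delta>" if "k < l" for k l
  proof -
    obtain l' where l': "l = Suc l'" "k \<le> l'" using \<open>k < l\<close> by (cases l) auto
    have "l1 (z k) \<le> b l'" using z(5)[of k] bmono[OF l'(2)] by simp
    then have "\<theta> (j l) * l1 (z k) \<le> \<theta> (j l) * b l'" using theta[OF z(4)[of l]] by (intro mult_left_mono) auto
    then show ?thesis using z(8)[of l'] l' by simp
  qed
  have "rapid \<delta> z"
    unfolding rapid_def
  proof (intro allI impI)
    fix w f fs and k l :: nat assume f: "of_weight w f fs" and kl: "k < l"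
    have w: "w \<ge> 1" using f by (simp add: of_weight_def)
    show "\<bar>pairing (z k) f\<bar> \<le> 2 * \<theta> w + \<delta> \<or> \<bar>pairing (z l) f\<bar> \<le> 2 * \<theta> w + \<delta>"
    proof (cases "w \<le> j l")
      case True
      then show ?thesis using z(6)[OF _ f, of l] \<delta> by auto
    next
      case False
      have "\<bar>pairing (z k) f\<bar> \<le> \<theta> w * l1 (z k)"
      proof -
        have "\<bar>pairing (z k) f\<bar> \<le> (\<Sum>i\<in>supp (z k). \<bar>z k i * f i\<bar>)" unfolding pairing_def by (rule sum_abs)
        also have "\<dots> \<le> (\<Sum>i\<in>supp (z k). \<theta> w * \<bar>z k i\<bar>)"
          using of_weight_abs_le[OF f] by (intro sum_mono) (simp add: abs_mult mult.commute mult_right_mono)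
        finally show ?thesis by (simp add: l1_def sum_distrib_left)
      qed
      also have "\<theta> w * l1 (z k) \<le> \<theta> (j l) * l1 (z k)"
        using False l1 z(4)[of l] by (intro mult_right_mono theta_antimono) auto
      also have "\<dots> \<le> \<delta>" by (rule small[OF kl])
      finally show ?thesis using theta[OF w] by auto
    qed
  qed
  then show ?thesis using z by blast
qed

text \<open>With \<open>th 0 = 1\<close> submultiplicativity also covers the root of a tree, which has order \<open>0\<close>.\<close>

definition th :: "nat \<Rightarrow> real" where "th n = (if n = 0 then 1 else \<theta> n)"

lemma th_eq [simp]: "n \<ge> 1 \<Longrightarrow> th n = \<theta> n"
  by (simp add: th_def)

lemma th_0 [simp]: "th 0 = 1"
  by (simp add: th_def)

lemma th_pos: "0 < th n" and th_le_1: "th n \<le> 1"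
  using theta[of n] by (auto simp: th_def)

lemma th_antimono: "m \<le> n \<Longrightarrow> th n \<le> th m"
  using theta_antimono[of m n] theta[of n] by (cases "m = 0") (auto simp: th_def intro: less_imp_le)

lemma th_mult_le: "th a * th b \<le> th (a + b)"
  using reg by (cases "a = 0"; cases "b = 0") (auto simp: th_def regular_seq_def)

lemma th_mult_diff_le: "th w * th (n - w) \<le> th n"
proof (cases "w \<le> n")
  case True
  then show ?thesis using th_mult_le[of w "n - w"] by simp
next
  case False
  then show ?thesis using th_antimono[of n w] by simp
qed

end

section \<open>Trees of functionals\<close>

locale rapid_blocks = tsirelson_root +
  fixes z :: "nat \<Rightarrow> nat \<Rightarrow> real" and p q :: "nat \<Rightarrow> nat" and \<delta> :: real
  assumes pq: "interlaced p q" and \<delta>: "\<delta> > 0" and rapid: "rapid \<delta> z"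
    and z: "\<And>k. z k \<in> c00 \<and> supp (z k) \<subseteq> {p k..q k} \<and> nrm (z k) \<le> 1"
begin

text \<open>Bounds for \<open>f\<close> on all blocks except those that meet one of two small sets: \<open>G1\<close> holds the
  minima of the nodes of the tree of \<open>f\<close> at order \<open>n\<close>, \<open>G2\<close> a point of the exceptional block of
  each of these nodes.\<close>

definition controlled :: "nat \<Rightarrow> (nat \<Rightarrow> real) \<Rightarrow> (nat \<Rightarrow> real) \<Rightarrow> bool" where
  "controlled n f B \<longleftrightarrow> (\<exists>G1 G2. G1 \<in> schreier (n - 1) \<and> G2 \<in> schreier (n - 1) \<and>
     G1 \<subseteq> {Min (supp f)..Max (supp f)} \<and> G2 \<subseteq> {Min (supp f)..Max (supp f)} \<and> Min (supp f) \<in> G1 \<and>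
     (\<forall>k. {p k..q k} \<inter> (G1 \<union> G2) = {} \<longrightarrow> \<bar>pairing (z k) f\<bar> \<le> B k))"

lemma controlled_mono: "controlled n f B \<Longrightarrow> (\<And>k. B k \<le> B' k) \<Longrightarrow> controlled n f B'"
  unfolding controlled_def by (meson order_trans)

lemma controlled_leaf:
  assumes "j \<ge> 1" "supp f = {j}" "\<And>k. B k \<ge> 0" shows "controlled n f B"
  unfolding controlled_def
proof (intro exI conjI allI impI)
  show "{j} \<in> schreier (n - 1)" using assms(1) by (rule singleton_schreier)
  fix k assume k: "{p k..q k} \<inter> ({j} \<union> {}) = {}"
  have "supp (z k) \<inter> supp f = {}" using z[of k] k assms(2) by auto
  then show "\<bar>pairing (z k) f\<bar> \<le> B k" using pairing_eq_zero assms(3) by simp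
qed (use assms in auto)

text \<open>The exceptional sets of the children, of order \<open>n - w - 1\<close>, lie in
  successive ranges and are joined along the minima of the children, of order \<open>w\<close>:
  together they have order \<open>n - 1\<close>. A block that avoids them contains no minimum of a
  child, so one child acts on it alone.\<close>

lemma controlled_of_weight:
  assumes f: "of_weight w f fs" and wn: "w < n"
    and B: "\<And>g. g \<in> set fs \<Longrightarrow> controlled (n - w) g (B g)"
    and B': "\<And>g k. g \<in> set fs \<Longrightarrow> Min (supp g) < p k \<Longrightarrow> p k \<le> Max (supp g) \<Longrightarrow> \<theta> w * B g k \<le> B' k"
      "\<And>k. B' k \<ge> 0"
  shows "controlled n f B'"
proof -
  define Pr where "Pr g G1 G2 \<longleftrightarrow> G1 \<in> schreier (n - w - 1) \<and> G2 \<in> schreier (n - w - 1) \<and>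
     G1 \<subseteq> {Min (supp g)..Max (supp g)} \<and> G2 \<subseteq> {Min (supp g)..Max (supp g)} \<and> Min (supp g) \<in> G1 \<and>
     (\<forall>k. {p k..q k} \<inter> (G1 \<union> G2) = {} \<longrightarrow> \<bar>pairing (z k) g\<bar> \<le> B g k)" for g G1 G2
  have "\<forall>g\<in>set fs. \<exists>G1 G2. Pr g G1 G2"
    using B unfolding controlled_def Pr_def by blast
  then obtain G1 G2 where GG: "\<forall>g\<in>set fs. Pr g (G1 g) (G2 g)" by metis
  have G: "g \<in> set fs \<Longrightarrow> G1 g \<in> schreier (n - w - 1)"
    "g \<in> set fs \<Longrightarrow> G2 g \<in> schreier (n - w - 1)"
    "g \<in> set fs \<Longrightarrow> G1 g \<subseteq> {Min (supp g)..Max (supp g)}"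
    "g \<in> set fs \<Longrightarrow> G2 g \<subseteq> {Min (supp g)..Max (supp g)}"
    "g \<in> set fs \<Longrightarrow> Min (supp g) \<in> G1 g"
    "g \<in> set fs \<Longrightarrow> {p k..q k} \<inter> (G1 g \<union> G2 g) = {} \<Longrightarrow> \<bar>pairing (z k) g\<bar> \<le> B g k" for g k
    using bspec[OF GG] unfolding Pr_def by blast+
  have w: "w \<ge> 1" "\<theta> w > 0" using f theta by (auto simp: of_weight_def)
  have union: "(\<Union>g\<in>I. G g) \<in> schreier (n - 1)"
    if "I \<subseteq> set fs" "\<And>g. g \<in> I \<Longrightarrow> G g \<in> schreier (n - w - 1) \<and> G g \<noteq> {} \<and> G g \<subseteq> {Min (supp g)..Max (supp g)}"
    for I G
    using of_weight_compose[OF f that] wn by simp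
  define H1 where "H1 = (\<Union>g\<in>set fs. G1 g)"
  define H2 where "H2 = (\<Union>g\<in>{g \<in> set fs. G2 g \<noteq> {}}. G2 g)"
  have H2: "H2 = (\<Union>g\<in>set fs. G2 g)" by (auto simp: H2_def)
  show ?thesis
    unfolding controlled_def
  proof (intro exI conjI allI impI)
    show "H1 \<in> schreier (n - 1)" unfolding H1_def
    proof (rule union)
      fix g assume "g \<in> set fs"
      then show "G1 g \<in> schreier (n - w - 1) \<and> G1 g \<noteq> {} \<and> G1 g \<subseteq> {Min (supp g)..Max (supp g)}"
        using G(1,3,5)[of g] by blast
    qed simp
    show "H2 \<in> schreier (n - 1)" unfolding H2_def using G(2,4) by (intro union) auto
    show "H1 \<subseteq> {Min (supp f)..Max (supp f)}" "H2 \<subseteq> {Min (supp f)..Max (supp f)}"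
      unfolding H1_def H2 using G(3,4) of_weight_range[OF f] by blast+
    show "Min (supp f) \<in> H1" using of_weight_Min[OF f] G(5) by (force simp: H1_def)
    fix k assume k: "{p k..q k} \<inter> (H1 \<union> H2) = {}"
    have kg: "{p k..q k} \<inter> (G1 g \<union> G2 g) = {}" if "g \<in> set fs" for g
      using k that unfolding H1_def H2 by blast
    have "pairing (z k) f = 0 \<or> (\<exists>g\<in>set fs. Min (supp g) < p k \<and> p k \<le> Max (supp g) \<and> pairing (z k) f = \<theta> w * pairing (z k) g)"
    proof (rule of_weight_single_child[OF f])
      show "supp (z k) \<subseteq> {p k..q k}" using z[of k] by blast
      show "Min (supp g) \<notin> {p k..q k}" if "g \<in> set fs" for g using kg[OF that] G(5)[OF that] by blast
    qed
    then show "\<bar>pairing (z k) f\<bar> \<le> B' k"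
    proof
      assume "\<exists>g\<in>set fs. Min (supp g) < p k \<and> p k \<le> Max (supp g) \<and> pairing (z k) f = \<theta> w * pairing (z k) g"
      then obtain g where g: "g \<in> set fs" "Min (supp g) < p k" "p k \<le> Max (supp g)"
        "pairing (z k) f = \<theta> w * pairing (z k) g" by blast
      have "\<bar>pairing (z k) f\<bar> = \<theta> w * \<bar>pairing (z k) g\<bar>" using g(4) w by (simp add: abs_mult)
      also have "\<dots> \<le> \<theta> w * B g k" using G(6)[OF g(1) kg[OF g(1)]] w by (intro mult_left_mono) auto
      also have "\<dots> \<le> B' k" by (rule B'(1)[OF g(1-3)])
      finally show ?thesis .
    qed (use B'(2) in simp)
  qed
qed

text \<open>While \<open>w < n\<close>, the bound comes from the children at the remaining order
  \<open>n - w\<close>. Once \<open>w \<ge> n\<close> the descent stops: \<open>th (n - w)\<close>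
  is \<open>th 0 = 1\<close>, and rapidity leaves at most one bad block, which is excluded by
  putting a point common to it and to the support of \<open>f\<close> into the second exceptional
  set.\<close>

lemma controlled_weight:
  assumes f: "of_weight w f fs" and n: "n \<ge> 1"
    and IH: "\<And>g. w < n \<Longrightarrow> g \<in> K \<Longrightarrow> controlled (n - w) g (\<lambda>_. 2 * th (n - w) + \<delta>)"
  shows "controlled n f (\<lambda>_. 2 * th w * th (n - w) + \<delta>)"
proof (cases "w < n")
  case True
  have w: "w \<ge> 1" using f by (simp add: of_weight_def)
  show ?thesis
  proof (rule controlled_of_weight[OF f True])
    show "controlled (n - w) g (\<lambda>_. 2 * th (n - w) + \<delta>)" if "g \<in> set fs" for g
      using IH True f that by (auto simp: of_weight_def)
    have "\<theta> w * \<delta> \<le> \<delta>" using theta[OF w] \<delta> by simp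
    then show "\<theta> w * (2 * th (n - w) + \<delta>) \<le> 2 * th w * th (n - w) + \<delta>" using w by (simp add: algebra_simps)
    show "0 \<le> 2 * th w * th (n - w) + \<delta>" using \<delta> th_pos[of w] th_pos[of "n - w"] by (simp add: less_imp_le)
  qed
next
  case False
  have w: "w \<ge> 1" using f by (simp add: of_weight_def)
  have ff: "finite (supp f)" "supp f \<noteq> {}" "supp f \<subseteq> {1..}" using supp_facts[OF of_weight_in_K[OF f]] by auto
  have minf: "1 \<le> Min (supp f)" using Min_in[OF ff(1,2)] ff(3) by auto
  show ?thesis
  proof (cases "\<exists>k. \<bar>pairing (z k) f\<bar> > 2 * \<theta> w + \<delta>")
    case True
    then obtain k0 where k0: "\<bar>pairing (z k0) f\<bar> > 2 * \<theta> w + \<delta>" by blast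
    have other: "\<bar>pairing (z k) f\<bar> \<le> 2 * \<theta> w + \<delta>" if "k \<noteq> k0" for k
      using rapid f k0 that unfolding rapid_def by (metis linorder_neqE_nat not_less)
    have "pairing (z k0) f \<noteq> 0" using k0 theta[OF w] \<delta> by auto
    then obtain i where i: "i \<in> supp (z k0)" "i \<in> supp f" using pairing_eq_zero by blast
    show ?thesis unfolding controlled_def
    proof (intro exI conjI allI impI)
      show "{Min (supp f)} \<in> schreier (n - 1)" using minf by (rule singleton_schreier)
      show "{i} \<in> schreier (n - 1)" using i ff(3) by (intro singleton_schreier) auto
      show "{Min (supp f)} \<subseteq> {Min (supp f)..Max (supp f)}" using ff by simp
      show "{i} \<subseteq> {Min (supp f)..Max (supp f)}" using i ff by simp
      fix k assume k: "{p k..q k} \<inter> ({Min (supp f)} \<union> {i}) = {}"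
      then have "k \<noteq> k0" using i z[of k0] by auto
      then show "\<bar>pairing (z k) f\<bar> \<le> 2 * th w * th (n - w) + \<delta>"
        using other[of k] False w by simp
    qed simp
  next
    case none: False
    show ?thesis unfolding controlled_def
    proof (intro exI conjI allI impI)
      show "{Min (supp f)} \<in> schreier (n - 1)" using minf by (rule singleton_schreier)
      show "{} \<in> schreier (n - 1)" by simp
      show "{Min (supp f)} \<subseteq> {Min (supp f)..Max (supp f)}" using ff by simp
      fix k
      show "\<bar>pairing (z k) f\<bar> \<le> 2 * th w * th (n - w) + \<delta>"
        using none False w by (auto simp: not_less)
    qed auto
  qed
qed

lemma K_cases [consumes 1, case_names leaf weight]:
  assumes "f \<in> K"
  obtains j where "j \<ge> 1" "supp f = {j}" | w fs where "of_weight w f fs"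
  using assms
proof (cases rule: norming_set.cases)
  case (combine k fs)
  then have "of_weight k f fs" by (auto simp: of_weight_def)
  then show thesis using that by blast
qed (auto simp: supp_def unit_vec_def intro: that)

text \<open>By regularity the product \<open>th w * th (n - w)\<close> never exceeds
  \<open>th n\<close>. This is the upper bound behind the norm of averages of order
  \<open>n\<close>; \<open>order_profile\<close> keeps the product instead.\<close>

lemma controlled_order: "n \<ge> 1 \<Longrightarrow> f \<in> K \<Longrightarrow> controlled n f (\<lambda>_. 2 * th n + \<delta>)"
proof (induction n arbitrary: f rule: less_induct)
  case (less n)
  from less.prems(2) show ?case
  proof (cases rule: K_cases)
    case (leaf j)
    then show ?thesis using \<delta> th_pos[of n] by (intro controlled_leaf[of j]) auto
  next
    case (weight w fs)
    have "w \<ge> 1" using weight by (simp add: of_weight_def)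
    then have "controlled n f (\<lambda>_. 2 * th w * th (n - w) + \<delta>)"
      using less.IH by (intro controlled_weight[OF weight less.prems(1)]) auto
    then show ?thesis by (rule controlled_mono) (use th_mult_diff_le[of w n] in \<open>simp add: mult.assoc\<close>)
  qed
qed

text \<open>The step function \<open>v\<close> records the order at which the tree of \<open>f\<close> first reaches order \<open>w0\<close>; its
  jumps lie in the set \<open>D\<close> of minima of the nodes of that level.\<close>

lemma order_profile:
  assumes "w0 \<ge> 1" "f \<in> K"
  shows "\<exists>D v. D \<in> schreier (w0 - 1) \<and> D \<subseteq> {Min (supp f)..Max (supp f)} \<and> Min (supp f) \<in> D \<and>
    (\<forall>x. w0 \<le> v x) \<and> (\<forall>a b. a \<le> b \<longrightarrow> {a<..b} \<inter> D = {} \<longrightarrow> v a = v b) \<and>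
    (\<forall>n\<ge>w0. controlled n f (\<lambda>k. 2 * th (v (p k)) * th (n - v (p k)) + \<delta>))"
  using assms
proof (induction w0 arbitrary: f rule: less_induct)
  case (less w0)
  have ff: "finite (supp f)" "supp f \<noteq> {}" "supp f \<subseteq> {1..}" using supp_facts[OF less.prems(2)] by auto
  have minf: "1 \<le> Min (supp f)" using Min_in[OF ff(1,2)] ff(3) by auto
  have nonneg: "0 \<le> 2 * th a * th b + \<delta>" for a b
    using \<delta> th_pos[of a] th_pos[of b] by (simp add: less_imp_le)
  \<comment> \<open>At a leaf, or when the root alone reaches level \<open>w0\<close>, the profile
    is constant and \<open>D\<close> is just the minimum of the support.\<close>
  have const: "?case" if v: "v \<ge> w0" and c: "\<And>n. n \<ge> w0 \<Longrightarrow> controlled n f (\<lambda>_. 2 * th v * th (n - v) + \<delta>)" for v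
    by (rule exI[of _ "{Min (supp f)}"], rule exI[of _ "\<lambda>_. v"])
      (use ff v c singleton_schreier[OF minf, of "w0 - 1"] in auto)
  from less.prems(2) show ?case
  proof (cases rule: K_cases)
    case (leaf j)
    then show ?thesis using nonneg by (intro const[of w0] controlled_leaf[of j]) auto
  next
    case (weight w fs)
    have w: "w \<ge> 1" using weight by (simp add: of_weight_def)
    have gK: "g \<in> K" if "g \<in> set fs" for g using weight that by (simp add: of_weight_def)
    show ?thesis
    proof (cases "w0 \<le> w")
      case True
      then show ?thesis
        using less.prems controlled_order by (intro const[of w] controlled_weight[OF weight]) auto
    next
      case False
      then have ww: "w < w0" "w0 - w < w0" "w0 - w \<ge> 1" using w by auto
      define Pr where "Pr g D v \<longleftrightarrow> D \<in> schreier (w0 - w - 1) \<and> D \<subseteq> {Min (supp g)..Max (supp g)} \<and> Min (supp g) \<in> D \<and>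
        (\<forall>x. w0 - w \<le> v x) \<and> (\<forall>a b. a \<le> b \<longrightarrow> {a<..b} \<inter> D = {} \<longrightarrow> v a = v b) \<and>
        (\<forall>n\<ge>w0 - w. controlled n g (\<lambda>k. 2 * th (v (p k)) * th (n - v (p k)) + \<delta>))" for g D v
      have "\<forall>g\<in>set fs. \<exists>D v. Pr g D v"
        using less.IH[OF ww(2,3)] gK unfolding Pr_def by blast
      then obtain D v where DD: "\<forall>g\<in>set fs. Pr g (D g) (v g)" by metis
      have D: "g \<in> set fs \<Longrightarrow> D g \<in> schreier (w0 - w - 1)"
        "g \<in> set fs \<Longrightarrow> D g \<subseteq> {Min (supp g)..Max (supp g)}"
        "g \<in> set fs \<Longrightarrow> Min (supp g) \<in> D g"
        "g \<in> set fs \<Longrightarrow> w0 - w \<le> v g x"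
        "g \<in> set fs \<Longrightarrow> a \<le> b \<Longrightarrow> {a<..b} \<inter> D g = {} \<Longrightarrow> v g a = v g b"
        "g \<in> set fs \<Longrightarrow> n \<ge> w0 - w \<Longrightarrow> controlled n g (\<lambda>k. 2 * th (v g (p k)) * th (n - v g (p k)) + \<delta>)"
        for g x a b n
        using bspec[OF DD] unfolding Pr_def by blast+
      define below where "below x = {g \<in> set fs. Min (supp g) \<le> x}" for x
      define sel where "sel x = (SOME g. g \<in> below x \<and> (\<forall>h\<in>below x. Min (supp h) \<le> Min (supp g)))" for x
      have sel: "sel x \<in> below x \<and> (\<forall>h\<in>below x. Min (supp h) \<le> Min (supp (sel x)))" if "below x \<noteq> {}" for x
      proof -
        have "finite ((\<lambda>g. Min (supp g)) ` below x)" by (simp add: below_def)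
        then have "Max ((\<lambda>g. Min (supp g)) ` below x) \<in> (\<lambda>g. Min (supp g)) ` below x" using that by (intro Max_in) auto
        then obtain g where "g \<in> below x" "Min (supp g) = Max ((\<lambda>g. Min (supp g)) ` below x)" by auto
        then have "g \<in> below x \<and> (\<forall>h\<in>below x. Min (supp h) \<le> Min (supp g))"
          using \<open>finite ((\<lambda>g. Min (supp g)) ` below x)\<close> by simp
        then show ?thesis
          using someI_ex[of "\<lambda>g. g \<in> below x \<and> (\<forall>h\<in>below x. Min (supp h) \<le> Min (supp g))"]
          unfolding sel_def by blast
      qed
      define V where "V x = (if below x = {} then w0 else w + v (sel x) x)" for x
      define DD where "DD = (\<Union>g\<in>set fs. D g)"
      have "DD \<in> schreier (w + (w0 - w - 1))"
        unfolding DD_def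
      proof (rule of_weight_compose[OF weight order_refl])
        fix g assume "g \<in> set fs"
        then show "D g \<in> schreier (w0 - w - 1) \<and> D g \<noteq> {} \<and> D g \<subseteq> {Min (supp g)..Max (supp g)}"
          using D(1-3)[of g] by blast
      qed
      moreover have "w + (w0 - w - 1) = w0 - 1" using ww by simp
      ultimately have DDs: "DD \<in> schreier (w0 - 1)" by simp
      have DDr: "DD \<subseteq> {Min (supp f)..Max (supp f)}"
        unfolding DD_def using D(2) of_weight_range[OF weight] by blast
      have DDm: "Min (supp f) \<in> DD" using of_weight_Min[OF weight] D(3) by (force simp: DD_def)
      have V0: "w0 \<le> V x" for x
      proof (cases "below x = {}")
        case False
        then have "w0 - w \<le> v (sel x) x" using sel[OF False] by (intro D(4)) (simp add: below_def)
        then show ?thesis using False by (simp add: V_def)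
      qed (simp add: V_def)
      \<comment> \<open>No child begins in \<open>{a<..b}\<close>, so both points select the same
        child, and the profile of that child does not jump in between. The interval is open at
        \<open>a\<close> because a child beginning at \<open>a\<close> is already selected
        there.\<close>
      have Vstep: "V a = V b" if ab: "a \<le> b" and none: "{a<..b} \<inter> DD = {}" for a b
      proof -
        have "Min (supp g) \<in> DD" if "g \<in> set fs" for g using D(3)[OF that] that by (auto simp: DD_def)
        then have "Min (supp g) \<le> a" if "g \<in> set fs" "Min (supp g) \<le> b" for g
          using none that by (metis disjoint_iff greaterThanAtMost_iff not_le)
        then have eq: "below a = below b" using ab by (auto simp: below_def intro: order_trans)
        then have seq: "sel a = sel b" by (simp add: sel_def)
        show ?thesis
        proof (cases "below a = {}")
          case False
          have s: "sel a \<in> set fs" using sel[OF False] by (simp add: below_def)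
          then have "{a<..b} \<inter> D (sel a) = {}" using none by (auto simp: DD_def)
          then have "v (sel a) a = v (sel a) b" using D(5)[OF s ab] by blast
          then show ?thesis using False eq seq by (simp add: V_def)
        qed (use eq in \<open>simp add: V_def\<close>)
      qed
      have "controlled n f (\<lambda>k. 2 * th (V (p k)) * th (n - V (p k)) + \<delta>)" if n: "n \<ge> w0" for n
      proof (rule controlled_of_weight[OF weight])
        show "w < n" using ww n by simp
        show "controlled (n - w) g (\<lambda>k. 2 * th (v g (p k)) * th (n - w - v g (p k)) + \<delta>)" if "g \<in> set fs" for g
          using n that by (intro D(6)) auto
        show "0 \<le> 2 * th (V (p k)) * th (n - V (p k)) + \<delta>" for k by (rule nonneg)
        fix g k assume g: "g \<in> set fs" and k: "Min (supp g) < p k" "p k \<le> Max (supp g)"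
        have gb: "g \<in> below (p k)" using g k by (simp add: below_def)
        then have bne: "below (p k) \<noteq> {}" by auto
        have s: "sel (p k) \<in> set fs" "Min (supp (sel (p k))) \<le> p k" "Min (supp g) \<le> Min (supp (sel (p k)))"
          using sel[OF bne] gb by (auto simp: below_def)
        \<comment> \<open>A child beginning after \<open>g\<close> begins after
          \<open>Max (supp g)\<close>, hence after \<open>p k\<close>, and cannot be the one
          selected at \<open>p k\<close>.\<close>
        have "\<not> Min (supp g) < Min (supp (sel (p k)))"
          using of_weight_less[OF weight g s(1)] s(2) k(2) by linarith
        then have "Min (supp (sel (p k))) = Min (supp g)" using s(3) by linarith
        then have "sel (p k) = g" by (rule inj_onD[OF of_weight_inj_Min[OF weight] _ s(1) g])
        then have V: "V (p k) = w + v g (p k)" using bne by (simp add: V_def)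
        have "\<theta> w * th (v g (p k)) \<le> th (w + v g (p k))" using th_mult_le[of w "v g (p k)"] w by simp
        then have "\<theta> w * th (v g (p k)) * th (n - w - v g (p k)) \<le> th (w + v g (p k)) * th (n - w - v g (p k))"
          using th_pos by (intro mult_right_mono) (auto intro: less_imp_le)
        moreover have "\<theta> w * \<delta> \<le> \<delta>" using theta[OF w] \<delta> by simp
        ultimately show "\<theta> w * (2 * th (v g (p k)) * th (n - w - v g (p k)) + \<delta>) \<le> 2 * th (V (p k)) * th (n - V (p k)) + \<delta>"
          unfolding V by (simp add: algebra_simps)
      qed
      then show ?thesis using DDs DDr DDm V0 Vstep by blast
    qed
  qed
qed

end

section \<open>Interlaced layers\<close>

lemma mixture:
  fixes a :: "nat \<Rightarrow> real" and C :: "nat \<Rightarrow> nat \<Rightarrow> real"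
  assumes T: "finite T" "\<And>t. a t \<ge> 0" and C: "\<And>t. finite (supp (C t))" "\<And>t k. C t k \<ge> 0"
  defines "b \<equiv> \<lambda>k. \<Sum>t\<in>T. a t * C t k"
  shows "finite (supp b)" "\<And>k. b k \<ge> 0" "supp b \<subseteq> (\<Union>t\<in>T. supp (C t))"
    "(\<Sum>k\<in>supp b. b k * h k) = (\<Sum>t\<in>T. a t * (\<Sum>k\<in>supp (C t). C t k * h k))"
proof -
  define U where "U = (\<Union>t\<in>T. supp (C t))"
  have fin: "finite U" using T C by (auto simp: U_def)
  show sub: "supp b \<subseteq> (\<Union>t\<in>T. supp (C t))"
    unfolding b_def supp_def by (auto elim!: sum.not_neutral_contains_not_neutral)
  then show "finite (supp b)" using fin finite_subset by (auto simp: U_def)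
  show "\<And>k. b k \<ge> 0" unfolding b_def using T C by (simp add: sum_nonneg)
  have "(\<Sum>k\<in>supp b. b k * h k) = (\<Sum>k\<in>U. b k * h k)"
    using sub fin by (intro sum.mono_neutral_left) (auto simp: U_def supp_def)
  also have "\<dots> = (\<Sum>t\<in>T. \<Sum>k\<in>U. a t * C t k * h k)"
    unfolding b_def by (simp add: sum_distrib_right sum.swap[of _ T])
  also have "\<dots> = (\<Sum>t\<in>T. a t * (\<Sum>k\<in>supp (C t). C t k * h k))"
  proof (rule sum.cong[OF refl])
    fix t assume t: "t \<in> T"
    have "(\<Sum>k\<in>supp (C t). C t k * h k) = (\<Sum>k\<in>U. C t k * h k)"
      using t fin by (intro sum.mono_neutral_left) (auto simp: U_def supp_def)
    then show "(\<Sum>k\<in>U. a t * C t k * h k) = a t * (\<Sum>k\<in>supp (C t). C t k * h k)"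
      by (simp add: sum_distrib_left mult.assoc)
  qed
  finally show "(\<Sum>k\<in>supp b. b k * h k) = (\<Sum>t\<in>T. a t * (\<Sum>k\<in>supp (C t). C t k * h k))" .
qed

section \<open>Lacunary orders with disjoint windows\<close>

context tsirelson_root begin

text \<open>Otherwise \<open>\<theta>\<close> would more than halve on every stretch of length
  \<open>2 * L\<close>, against \<open>not_geometric\<close>.\<close>

lemma ratio:
  assumes "L \<ge> 1" shows "\<exists>n>L. \<theta> (n - L) \<le> 2 * \<theta> (n + L)"
proof (rule ccontr)
  assume "\<not> ?thesis"
  then have dec: "2 * \<theta> (n + L) < \<theta> (n - L)" if "n > L" for n using that by (auto simp: not_le)
  have "2 ^ k * \<theta> (1 + k * (2 * L)) \<le> 1" for k
  proof (induction k)
    case 0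
    then show ?case using theta[of 1] by simp
  next
    case (Suc k)
    have "2 * \<theta> ((1 + k * (2 * L) + L) + L) < \<theta> ((1 + k * (2 * L) + L) - L)" by (rule dec) simp
    then have "2 * \<theta> (1 + Suc k * (2 * L)) \<le> \<theta> (1 + k * (2 * L))" by (simp add: algebra_simps)
    then have "2 ^ k * (2 * \<theta> (1 + Suc k * (2 * L))) \<le> 2 ^ k * \<theta> (1 + k * (2 * L))"
      by (rule mult_left_mono) simp
    then have "2 ^ k * (2 * \<theta> (1 + Suc k * (2 * L))) \<le> 1" using Suc by linarith
    then show ?case by (simp only: power_Suc mult.assoc mult.left_commute[of 2])
  qed
  moreover obtain k where "1 < 2 ^ k * \<theta> (1 + k * (2 * L))" using not_geometric[of "2 * L" 1 1] assms by auto
  ultimately show False by (meson not_less)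
qed

text \<open>\<open>L i\<close> and \<open>L (Suc i)\<close> bound the window of order
  \<open>nn i\<close>. For \<open>v\<close> between \<open>w0\<close> and \<open>L i\<close> the
  ratio \<open>th v * th (nn i - v) / th (nn i)\<close> is small because
  \<open>th (nn i - L i)\<close> is comparable with \<open>th (nn i)\<close>; for
  \<open>v \<ge> L (Suc i)\<close> it is small because \<open>th v\<close> already is. The
  comparison is with \<open>th (nn i + w0)\<close> because the layers, averaged over the cells, have
  order \<open>nn i + w0\<close>, and their lower bound uses that weight.\<close>

lemma orders_exist:
  assumes w0: "w0 \<ge> 1"
  shows "\<exists>nn L. \<forall>i. w0 \<le> L i \<and> L i < nn i \<and> th (nn i - L i) \<le> 2 * th (nn i + w0) \<and>
    nn i \<le> L (Suc i) \<and> th (L (Suc i)) \<le> th w0 * th (nn i)"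
proof -
  define P where "P = (\<lambda>(i::nat) s. w0 \<le> fst s \<and> fst s < snd s \<and> th (snd s - fst s) \<le> 2 * th (snd s + w0))"
  define Q where "Q = (\<lambda>(s :: nat \<times> nat) (s' :: nat \<times> nat). snd s \<le> fst s' \<and> th (fst s') \<le> th w0 * th (snd s))"
  have ex: "\<exists>n. P i (L, n)" if "L \<ge> w0" for L i
  proof -
    have "L \<ge> 1" using that w0 by linarith
    then obtain n where n: "n > L" "\<theta> (n - L) \<le> 2 * \<theta> (n + L)" using ratio by blast
    have "th (n + L) \<le> th (n + w0)" using that by (intro th_antimono) simp
    then have "th (n - L) \<le> 2 * th (n + w0)" using n by simp
    then show ?thesis using n that by (auto simp: P_def)
  qed
  have "\<exists>f. \<forall>i. P i (f i) \<and> Q (f i) (f (Suc i))"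
  proof (rule dependent_nat_choice)
    show "\<exists>x. P 0 x" using ex[of w0 0] by blast
    fix x :: "nat \<times> nat" and i assume "P i x"
    have "\<theta> \<longlonglongrightarrow> 0" using reg by (simp add: regular_seq_def)
    moreover have "th w0 * th (snd x) > 0" using th_pos by simp
    ultimately have "eventually (\<lambda>n. \<theta> n < th w0 * th (snd x)) sequentially" by (simp add: order_tendstoD(2))
    then obtain n0 where n0: "\<And>n. n \<ge> n0 \<Longrightarrow> \<theta> n < th w0 * th (snd x)" by (auto simp: eventually_sequentially)
    define L where "L = max (max n0 w0) (snd x)"
    have "L \<ge> 1" "L \<ge> n0" using w0 by (auto simp: L_def)
    then have "th L \<le> th w0 * th (snd x)" using n0[of L] by simp
    moreover have "w0 \<le> L" by (simp add: L_def)
    moreover obtain n where "P (Suc i) (L, n)" using ex[OF \<open>w0 \<le> L\<close>, of "Suc i"] by blast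
    ultimately show "\<exists>y. P (Suc i) y \<and> Q x y" by (intro exI[of _ "(L, n)"]) (auto simp: Q_def L_def)
  qed
  then obtain f where "\<And>i. P i (f i)" "\<And>i. Q (f i) (f (Suc i))" by blast
  then show ?thesis
    by (intro exI[of _ "\<lambda>i. snd (f i)"] exI[of _ "\<lambda>i. fst (f i)"]) (simp add: P_def Q_def)
qed

end

text \<open>\<open>n\<close> interlacing layers over common cells: the \<open>t\<close>-th cell consists of special combinations
  \<open>c (t * n + i)\<close> of order \<open>nn i\<close> for \<open>i < n\<close>, and a special combination \<open>a\<close> of order \<open>w0\<close> averages
  over the cells.  Every union of few intervals carries almost the same part of each layer.\<close>

locale layers = rapid_blocks +
  fixes w0 n :: nat and nn L :: "nat \<Rightarrow> nat" and mm :: "nat \<Rightarrow> nat" and c :: "nat \<Rightarrow> nat \<Rightarrow> real" and a :: "nat \<Rightarrow> real"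
  assumes w0: "w0 \<ge> 1" and n: "n \<ge> 1"
    and nn: "\<And>i. w0 \<le> L i" "\<And>i. L i < nn i" "\<And>i. th (nn i - L i) \<le> 2 * th (nn i + w0)"
      "\<And>i. nn i \<le> L (Suc i)" "\<And>i. th (L (Suc i)) \<le> th w0 * th (nn i)"
    and \<delta>_le: "\<And>i. i < n \<Longrightarrow> \<delta> \<le> th w0 * th (nn i)"
    and zhalf: "\<And>k. 1 / 2 \<le> nrm (z k)" and p_Min: "\<And>k. p k = Min (supp (z k))"
    and c: "\<And>l. special_comb p q (nn (l mod n)) \<delta> (mm l) (c l)" "\<And>l. supp (c l) \<subseteq> {..<mm (Suc l)}"
    and a: "special_comb (\<lambda>t. p (mm (t * n))) (\<lambda>t. q (mm (Suc t * n) - 1)) w0 (th w0) 0 a"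
begin

abbreviation P where "P t \<equiv> p (mm (t * n))"
abbreviation Q where "Q t \<equiv> q (mm (Suc t * n) - 1)"

definition b :: "nat \<Rightarrow> nat \<Rightarrow> real" where
  "b i = (\<lambda>k. \<Sum>t\<in>supp a. a t * c (t * n + i) k)"

definition y :: "nat \<Rightarrow> nat \<Rightarrow> real" where
  "y i = (\<lambda>x. \<Sum>k\<in>supp (b i). (b i k / th (nn i)) * z k x)"

lemma a_facts: "finite (supp a)" "a t \<ge> 0" "sum a (supp a) = 1" "P ` supp a \<in> schreier w0"
  using a by (auto simp: special_comb_def)

lemma a_hit:
  assumes "D \<in> schreier (w0 - 1)" shows "hit_mass P Q a D \<le> th w0"
proof -
  have "\<forall>M'<w0. \<forall>H\<in>schreier M'. hit_mass P Q a H \<le> th w0"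
    using a unfolding special_comb_def by blast
  moreover have "w0 - 1 < w0" using w0 by simp
  ultimately show ?thesis using assms by blast
qed

lemma c_facts: "finite (supp (c l))" "c l k \<ge> 0" "sum (c l) (supp (c l)) = 1" "p ` supp (c l) \<in> schreier (nn (l mod n))"
  "M' < nn (l mod n) \<Longrightarrow> H \<in> schreier M' \<Longrightarrow> hit_mass p q (c l) H \<le> \<delta>"
  using c(1)[of l] by (auto simp: special_comb_def)

lemma c_range: "supp (c l) \<subseteq> {mm l..<mm (Suc l)}"
  using c(1)[of l] c(2)[of l] by (auto simp: special_comb_def)

lemma c_nonempty: "supp (c l) \<noteq> {}"
  using c_facts(3)[of l] by (metis sum.empty zero_neq_one)

lemma mm_strict_mono: "strict_mono mm"
  unfolding strict_mono_Suc_iff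
proof
  fix l
  obtain k where "k \<in> supp (c l)" using c_nonempty by blast
  then show "mm l < mm (Suc l)" using c_range[of l] by force
qed

lemma p_mono: "i \<le> j \<Longrightarrow> p i \<le> p j"
  using interlaced_strict_mono[OF pq] strict_mono_leD by blast

lemma p_le_q: "p k \<le> q k"
  using pq by (simp add: interlaced_def)

lemma q_mono: "i \<le> j \<Longrightarrow> q i \<le> q j"
  using interlaced_less[OF pq, of i j] p_le_q[of j] by (cases "i = j") auto

lemma cell_range:
  assumes "i < n" "k \<in> supp (c (t * n + i))" shows "P t \<le> p k" "q k \<le> Q t"
proof -
  have "mm (t * n) \<le> mm (t * n + i)" "mm (Suc (t * n + i)) \<le> mm (Suc t * n)"
    using assms(1) strict_mono_leD[OF mm_strict_mono] by auto
  moreover have "mm (t * n + i) \<le> k" "k < mm (Suc (t * n + i))" using c_range[of "t * n + i"] assms(2) by auto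
  ultimately have "mm (t * n) \<le> k" "k \<le> mm (Suc t * n) - 1" by linarith+
  then show "P t \<le> p k" "q k \<le> Q t" using p_mono q_mono by auto
qed

lemma layer_mod: "i < n \<Longrightarrow> (t * n + i) mod n = i"
  by simp

lemma b_facts:
  shows "finite (supp (b i))" "b i k \<ge> 0" "supp (b i) \<subseteq> (\<Union>t\<in>supp a. supp (c (t * n + i)))"
    "(\<Sum>k\<in>supp (b i). b i k * h k) = (\<Sum>t\<in>supp a. a t * (\<Sum>k\<in>supp (c (t * n + i)). c (t * n + i) k * h k))"
  using mixture[of "supp a" a "\<lambda>t. c (t * n + i)"] a_facts(1,2) c_facts(1,2)
  unfolding b_def by blast+

lemma b_sum: "sum (b i) (supp (b i)) = 1"
  using b_facts(4)[of i "\<lambda>_. 1"] c_facts(3) a_facts(3) by simp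

lemma b_hit:
  assumes "i < n" "G \<in> schreier (nn i - 1)" shows "hit_mass p q (b i) G \<le> \<delta>"
proof -
  have "nn i - 1 < nn i" using nn(2)[of i] by simp
  then have le: "hit_mass p q (c (t * n + i)) G \<le> \<delta>" for t
    using c_facts(5)[of "nn i - 1" "t * n + i" G] assms layer_mod by simp
  have "hit_mass p q (b i) G = (\<Sum>t\<in>supp a. a t * hit_mass p q (c (t * n + i)) G)"
    unfolding hit_mass_def by (rule b_facts(4))
  also have "\<dots> \<le> (\<Sum>t\<in>supp a. a t * \<delta>)" using le a_facts(2) by (intro sum_mono mult_left_mono) auto
  finally show ?thesis using a_facts(3) by (simp flip: sum_distrib_right)
qed

lemma supp_y: "supp (y i) \<subseteq> (\<Union>k\<in>supp (b i). supp (z k))"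
proof
  fix x assume "x \<in> supp (y i)"
  then obtain k where "k \<in> supp (b i)" "b i k / th (nn i) * z k x \<noteq> 0"
    unfolding y_def supp_def by (auto elim: sum.not_neutral_contains_not_neutral)
  then show "x \<in> (\<Union>k\<in>supp (b i). supp (z k))" by (auto simp: supp_def)
qed

lemma y_c00: "y i \<in> c00"
  unfolding y_def using b_facts(1) z by (intro c00_lincomb) auto

lemma blocks_disjoint: "k \<noteq> l \<Longrightarrow> {p k..q k} \<inter> {p l..q l} = {}"
  using interlaced_less[OF pq, of k l] interlaced_less[OF pq, of l k]
  by (cases k l rule: linorder_cases) auto

lemma y_disjoint:
  assumes "i < j" "j < n" shows "supp (y i) \<inter> supp (y j) = {}"
proof (rule ccontr)
  assume "\<not> ?thesis"
  then obtain x where "x \<in> supp (y i)" "x \<in> supp (y j)" by blast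
  then obtain k l where kl: "k \<in> supp (b i)" "x \<in> supp (z k)" "l \<in> supp (b j)" "x \<in> supp (z l)"
    using supp_y by blast
  then have "x \<in> {p k..q k} \<inter> {p l..q l}" using z by blast
  then have "k = l" using blocks_disjoint by blast
  then obtain s t where st: "k \<in> supp (c (s * n + i))" "k \<in> supp (c (t * n + j))"
    using b_facts(3) kl(1,3) by blast
  have ne: "s * n + i \<noteq> t * n + j"
  proof
    assume "s * n + i = t * n + j"
    then have "i = j" using layer_mod[of i s] layer_mod[of j t] assms by (metis order.strict_trans)
    then show False using assms by simp
  qed
  have "mm (Suc u) \<le> mm v" if "u < v" for u v using strict_mono_leD[OF mm_strict_mono] that by simp
  moreover have "mm (s * n + i) \<le> k" "k < mm (Suc (s * n + i))" "mm (t * n + j) \<le> k" "k < mm (Suc (t * n + j))"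
    using c_range st by (force)+
  ultimately show False using ne by (metis linorder_neqE_nat not_less order_trans)
qed

text \<open>The supports of the blocks in layer \<open>i\<close> form a family of order
  \<open>w0 + nn i\<close>. Their norms in \<open>y i\<close> add up to at least
  \<open>1 / (2 * th (nn i))\<close>, and \<open>th (nn i) \<le> 2 * \<theta> (w0 + nn i)\<close> by
  the choice of orders; the two factors \<open>1/2\<close> give \<open>1/4\<close>.\<close>

lemma y_lower:
  assumes i: "i < n" shows "1 / 4 \<le> nrm (y i)"
proof -
  have fin: "finite (supp (z k)) \<and> supp (z k) \<noteq> {} \<and> supp (z k) \<subseteq> {1..}" for k
  proof (rule nonzero_supp)
    show "z k \<in> c00" using z by blast
    show "z k \<noteq> (\<lambda>_. 0)" using zhalf[of k] norm_le_l1[of "\<lambda>_. 0"] by (auto simp: supp_def)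
  qed
  have sub: "supp (z k) \<subseteq> {p k..q k}" for k using z by blast
  have inj: "inj_on (\<lambda>k. supp (z k)) (supp (b i))"
  proof (rule inj_onI)
    fix k l assume "supp (z k) = supp (z l)"
    then show "k = l" using blocks_disjoint[of k l] sub[of k] sub[of l] fin[of k] by blast
  qed
  have bne: "supp (b i) \<noteq> {}" using b_sum[of i] by (metis sum.empty zero_neq_one)
  define \<E> where "\<E> = (\<lambda>k. supp (z k)) ` supp (b i)"
  have "admissible_family (w0 + nn i) \<E>"
    unfolding admissible_family_def
  proof (intro conjI ballI impI)
    show "finite \<E>" "\<E> \<noteq> {}" using b_facts(1) bne by (auto simp: \<E>_def)
    show "\<And>E. E \<in> \<E> \<Longrightarrow> finite E" "\<And>E. E \<in> \<E> \<Longrightarrow> E \<noteq> {}" "\<And>E. E \<in> \<E> \<Longrightarrow> E \<subseteq> {1..}"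
      using fin by (auto simp: \<E>_def)
    show "Max E < Min F \<or> Max F < Min E" if "E \<in> \<E>" "F \<in> \<E>" "E \<noteq> F" for E F
    proof -
      obtain k l where kl: "E = supp (z k)" "F = supp (z l)" using \<open>E \<in> \<E>\<close> \<open>F \<in> \<E>\<close> by (auto simp: \<E>_def)
      then have "k \<noteq> l" using \<open>E \<noteq> F\<close> by blast
      have "Max (supp (z m)) \<in> {p m..q m}" "Min (supp (z m)) \<in> {p m..q m}" for m
        using fin[of m] sub[of m] Max_in Min_in by blast+
      then show ?thesis unfolding kl(1,2) using interlaced_less[OF pq, of k l] interlaced_less[OF pq, of l k] \<open>k \<noteq> l\<close>
        by (metis atLeastAtMost_iff linorder_neqE_nat order_le_less_trans order_less_le_trans)
    qed
    have "(\<Union>t\<in>supp a. p ` supp (c (t * n + i))) \<in> schreier (w0 + nn i)"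
    proof (rule schreier_compose)
      have Pm: "strict_mono (\<lambda>t. P t)"
        unfolding strict_mono_def using n mm_strict_mono interlaced_strict_mono[OF pq] by (simp add: strict_mono_less)
      then show "inj_on (\<lambda>t. P t) (supp a)" by (meson inj_on_subset strict_mono_imp_inj_on subset_UNIV)
      show "(\<lambda>t. P t) ` supp a \<in> schreier w0" by (rule a_facts(4))
      fix t
      show "p ` supp (c (t * n + i)) \<in> schreier (nn i) \<and> p ` supp (c (t * n + i)) \<noteq> {} \<and> P t \<le> Min (p ` supp (c (t * n + i)))"
        using c_facts(1,4)[of "t * n + i"] c_nonempty[of "t * n + i"] layer_mod[OF i] cell_range(1)[OF i] by auto
      fix s assume "P t < P s"
      then have "t < s" using strict_mono_less[OF Pm, of t s] by blast
      then have "Suc (t * n + i) \<le> s * n + i" using n by (metis add_less_mono1 less_eq_Suc_le mult_less_mono1 zero_less_one order_less_le_trans)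
      then have "mm (Suc (t * n + i)) \<le> mm (s * n + i)" using strict_mono_leD[OF mm_strict_mono] by blast
      then have "p k < p l" if "k \<in> supp (c (t * n + i))" "l \<in> supp (c (s * n + i))" for k l
      proof -
        have "k < mm (Suc (t * n + i))" "mm (s * n + i) \<le> l"
          using c_range[of "t * n + i"] c_range[of "s * n + i"] that by auto
        then have "k < l" using \<open>mm (Suc (t * n + i)) \<le> mm (s * n + i)\<close> by linarith
        then show ?thesis using interlaced_strict_mono[OF pq] by (simp add: strict_mono_less)
      qed
      then show "Max (p ` supp (c (t * n + i))) < Min (p ` supp (c (s * n + i)))"
        using c_facts(1) c_nonempty by auto
    qed
    moreover have "Min ` \<E> = p ` supp (b i)" unfolding \<E>_def image_image using p_Min by simp
    moreover have "p ` supp (b i) \<subseteq> (\<Union>t\<in>supp a. p ` supp (c (t * n + i)))" using b_facts(3) by blast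
    ultimately show "Min ` \<E> \<in> schreier (w0 + nn i)" using schreier_hereditary by simp
  qed
  then have "\<theta> (w0 + nn i) * (\<Sum>E\<in>\<E>. nrm (restr E (y i))) \<le> nrm (y i)"
    using w0 y_c00 by (intro lower_estimate_family) auto
  moreover have "1 / (2 * th (nn i)) \<le> (\<Sum>E\<in>\<E>. nrm (restr E (y i)))"
  proof -
    have "(\<Sum>E\<in>\<E>. nrm (restr E (y i))) = (\<Sum>k\<in>supp (b i). nrm (restr (supp (z k)) (y i)))"
      unfolding \<E>_def by (simp add: sum.reindex[OF inj])
    also have "\<dots> \<ge> (\<Sum>k\<in>supp (b i). b i k / th (nn i) * (1 / 2))"
    proof (rule sum_mono)
      fix k assume k: "k \<in> supp (b i)"
      have "restr (supp (z k)) (y i) = (\<lambda>x. b i k / th (nn i) * restr (supp (z k)) (z k) x)"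
        unfolding y_def by (rule restr_block_sum[OF pq sub b_facts(1) k sub])
      then have "nrm (restr (supp (z k)) (y i)) = nrm (\<lambda>x. b i k / th (nn i) * restr (supp (z k)) (z k) x)"
        by (rule arg_cong)
      also have "\<dots> = \<bar>b i k / th (nn i)\<bar> * nrm (restr (supp (z k)) (z k))"
        using z by (intro norm_scale c00_restr) auto
      also have "\<dots> = b i k / th (nn i) * nrm (z k)"
        using b_facts(2)[of i k] th_pos[of "nn i"] by (simp add: restr_superset)
      finally have eq: "nrm (restr (supp (z k)) (y i)) = b i k / th (nn i) * nrm (z k)" .
      have "0 \<le> b i k / th (nn i)" using b_facts(2)[of i k] th_pos[of "nn i"] by simp
      then show "b i k / th (nn i) * (1 / 2) \<le> nrm (restr (supp (z k)) (y i))"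
        unfolding eq by (rule mult_left_mono[OF zhalf])
    qed
    finally show ?thesis using b_sum[of i]
      by (simp flip: sum_distrib_right sum_divide_distrib)
  qed
  moreover have "1 / 4 \<le> \<theta> (w0 + nn i) * (1 / (2 * th (nn i)))"
  proof -
    have "th (nn i) \<le> th (nn i - L i)" by (intro th_antimono) simp
    then have "th (nn i) \<le> 2 * \<theta> (w0 + nn i)" using nn(3)[of i] w0 by (simp add: add.commute)
    then show ?thesis using th_pos[of "nn i"] by (simp add: field_simps)
  qed
  moreover have "\<theta> (w0 + nn i) > 0" using theta w0 by simp
  ultimately show ?thesis by (smt (verit) mult_left_mono)
qed

text \<open>The fraction of the best possible value \<open>th (nn i)\<close> that remains on layer
  \<open>i\<close> for a tree that passes level \<open>w0\<close> with the value
  \<open>v\<close>.\<close>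

definition share :: "nat \<Rightarrow> nat \<Rightarrow> real" where
  "share i v = th v * th (nn i - v) / th (nn i)"

lemma share_le_1: "share i v \<le> 1"
  using th_mult_diff_le[of v "nn i"] th_pos[of "nn i"] by (simp add: share_def)

lemma share_nonneg: "0 \<le> share i v"
  using th_pos by (simp add: share_def less_imp_le)

text \<open>Below the window \<open>th v \<le> th w0\<close>, while the other factor loses at most a
  factor 2 against \<open>th (nn i)\<close>. Above it \<open>th v \<le> th w0 * th (nn i)\<close>
  suffices.\<close>

lemma share_small:
  assumes "w0 \<le> v" "\<not> (L i < v \<and> v < L (Suc i))" shows "share i v \<le> 2 * th w0"
proof (cases "v \<le> L i")
  case True
  have "th v * th (nn i - v) \<le> th w0 * th (nn i - L i)"
    using assms(1) True th_pos by (intro mult_mono th_antimono) (auto intro: less_imp_le)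
  also have "\<dots> \<le> th w0 * (2 * th (nn i))"
  proof (rule mult_left_mono)
    have "th (nn i + w0) \<le> th (nn i)" by (intro th_antimono) simp
    then show "th (nn i - L i) \<le> 2 * th (nn i)" using nn(3)[of i] by linarith
  qed (use th_pos[of w0] in simp)
  finally show ?thesis using th_pos[of "nn i"] by (simp add: share_def field_simps)
next
  case False
  then have "L (Suc i) \<le> v" using assms(2) by simp
  then have "th v \<le> th w0 * th (nn i)" using th_antimono[of "L (Suc i)" v] nn(5)[of i] by linarith
  moreover have "th v * th (nn i - v) \<le> th v * 1" using th_le_1 th_pos[of v] by (intro mult_left_mono) auto
  ultimately have "th v * th (nn i - v) \<le> th w0 * th (nn i)" by linarith
  then have "share i v \<le> th w0" using th_pos[of "nn i"] by (simp add: share_def field_simps)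
  then show ?thesis using th_pos[of w0] by linarith
qed

text \<open>The windows are disjoint, so \<open>v\<close> lies in at most one of them; this layer
  accounts for the summand 1.\<close>

lemma share_sum: "w0 \<le> v \<Longrightarrow> (\<Sum>i<n. share i v) \<le> 1 + 2 * n * th w0"
proof -
  assume v: "w0 \<le> v"
  have L: "L (Suc i) \<le> L j" if "i < j" for i j
  proof -
    have "L i \<le> L (Suc i)" for i using nn(2)[of i] nn(4)[of i] by linarith
    then show ?thesis using lift_Suc_mono_le[of L "Suc i" j] that by simp
  qed
  have "(\<Sum>i<n. share i v) \<le> (\<Sum>i<n. 2 * th w0 + of_bool (L i < v \<and> v < L (Suc i)))"
  proof (rule sum_mono)
    fix i show "share i v \<le> 2 * th w0 + of_bool (L i < v \<and> v < L (Suc i))"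
      using share_small[OF v, of i] share_le_1[of i v] th_pos[of w0] by (cases "L i < v \<and> v < L (Suc i)") auto
  qed
  also have "\<dots> = 2 * n * th w0 + (\<Sum>i<n. of_bool (L i < v \<and> v < L (Suc i)))" by (simp add: sum.distrib)
  also have "(\<Sum>i<n. of_bool (L i < v \<and> v < L (Suc i))) \<le> (1::real)"
  proof (cases "\<exists>i. L i < v \<and> v < L (Suc i)")
    case True
    then obtain i0 where i0: "L i0 < v" "v < L (Suc i0)" by blast
    have "i = i0" if "L i < v" "v < L (Suc i)" for i
      using L[of i i0] L[of i0 i] i0 that by (cases i i0 rule: linorder_cases) auto
    then have "(\<Sum>i<n. of_bool (L i < v \<and> v < L (Suc i))) \<le> (\<Sum>i<n. of_bool (i = i0) :: real)"
      by (intro sum_mono) auto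
    also have "\<dots> \<le> 1" by (simp add: of_bool_def sum.delta)
    finally show ?thesis .
  qed (auto simp: of_bool_def intro: order_trans[OF eq_refl[OF sum.neutral]])
  finally show ?thesis by simp
qed

text \<open>The two exceptional sets have order \<open>nn i - 1\<close> and hit mass at most
  \<open>\<delta>\<close> each; with the additive error this makes \<open>3 * \<delta>\<close>,
  which after division by \<open>th (nn i)\<close> is at most \<open>3 * th w0\<close>.\<close>

lemma y_functional:
  assumes f: "f \<in> K" and i: "i < n"
    and ctl: "controlled (nn i) f (\<lambda>k. 2 * th (v (p k)) * th (nn i - v (p k)) + \<delta>)"
  shows "pairing (y i) f \<le> 3 * th w0 + 2 * (\<Sum>k\<in>supp (b i). b i k * share i (v (p k)))"
proof -
  obtain G1 G2 where G: "G1 \<in> schreier (nn i - 1)" "G2 \<in> schreier (nn i - 1)"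
    "\<And>k. {p k..q k} \<inter> (G1 \<union> G2) = {} \<Longrightarrow> \<bar>pairing (z k) f\<bar> \<le> 2 * th (v (p k)) * th (nn i - v (p k)) + \<delta>"
    using ctl unfolding controlled_def by blast
  let ?h = "\<lambda>G k. of_bool ({p k..q k} \<inter> G \<noteq> {}) :: real"
  have each: "pairing (z k) f \<le> ?h G1 k + ?h G2 k + \<delta> + 2 * th (nn i) * share i (v (p k))" for k
  proof (cases "{p k..q k} \<inter> (G1 \<union> G2) = {}")
    case True
    then have "pairing (z k) f \<le> 2 * th (v (p k)) * th (nn i - v (p k)) + \<delta>" using G(3)[OF True] by simp
    then show ?thesis using th_pos[of "nn i"] by (simp add: share_def)
  next
    case False
    have "pairing (z k) f \<le> 1" using pairing_le_norm[OF f, of "z k"] z[of k] by linarith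
    moreover have "1 \<le> ?h G1 k + ?h G2 k" using False by (auto simp: Int_Un_distrib)
    moreover have "0 \<le> 2 * th (nn i) * share i (v (p k))" using share_nonneg th_pos[of "nn i"] by simp
    ultimately show ?thesis using \<delta> by linarith
  qed
  have "th (nn i) * pairing (y i) f = (\<Sum>k\<in>supp (b i). b i k * pairing (z k) f)"
  proof -
    have "pairing (y i) f = (\<Sum>k\<in>supp (b i). b i k / th (nn i) * pairing (z k) f)"
      unfolding y_def using b_facts(1) z by (intro pairing_lincomb) auto
    then show ?thesis using th_pos[of "nn i"] by (simp add: sum_distrib_left)
  qed
  also have "\<dots> \<le> (\<Sum>k\<in>supp (b i). b i k * (?h G1 k + ?h G2 k + \<delta> + 2 * th (nn i) * share i (v (p k))))"
    using each b_facts(2) by (intro sum_mono mult_left_mono)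
  also have "\<dots> = hit_mass p q (b i) G1 + hit_mass p q (b i) G2 + \<delta> + 2 * th (nn i) * (\<Sum>k\<in>supp (b i). b i k * share i (v (p k)))"
    using b_sum[of i]
    by (simp add: distrib_left sum.distrib hit_mass_def sum_distrib_left mult.assoc mult.left_commute flip: sum_distrib_right)
  also have "\<dots> \<le> 3 * (th w0 * th (nn i)) + 2 * th (nn i) * (\<Sum>k\<in>supp (b i). b i k * share i (v (p k)))"
    using b_hit[OF i G(1)] b_hit[OF i G(2)] \<delta>_le[OF i] by linarith
  also have "\<dots> = th (nn i) * (3 * th w0 + 2 * (\<Sum>k\<in>supp (b i). b i k * share i (v (p k))))"
    by (simp add: algebra_simps)
  finally show ?thesis using th_pos[of "nn i"] by simp
qed

text \<open>On a cell that avoids \<open>D\<close> all layers see the same value of the profile, so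
  their shares add up as in \<open>share_sum\<close>. The other cells have mass at most
  \<open>th w0\<close>, since \<open>D\<close> has order \<open>w0 - 1\<close>. The constant 9 is 3
  from \<open>y_functional\<close> plus twice 2 from the small shares and 1 from the cells that meet
  \<open>D\<close>.\<close>

lemma y_upper: "nrm (\<lambda>x. \<Sum>i<n. y i x) \<le> 2 + 9 * n * th w0"
proof (rule norm_leI)
  fix f assume f: "f \<in> K"
  obtain D v where D: "D \<in> schreier (w0 - 1)" and v: "\<And>x. w0 \<le> v x"
    "\<And>a b. a \<le> b \<Longrightarrow> {a<..b} \<inter> D = {} \<Longrightarrow> v a = v b"
    "\<And>n. n \<ge> w0 \<Longrightarrow> controlled n f (\<lambda>k. 2 * th (v (p k)) * th (n - v (p k)) + \<delta>)"
    using order_profile[OF w0 f] by blast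
  let ?h = "\<lambda>t. of_bool ({P t..Q t} \<inter> D \<noteq> {}) :: real"
  have layer: "(\<Sum>k\<in>supp (b i). b i k * share i (v (p k))) \<le> (\<Sum>t\<in>supp a. a t * (share i (v (P t)) + ?h t))"
    if i: "i < n" for i
  proof -
    have "(\<Sum>k\<in>supp (c (t * n + i)). c (t * n + i) k * share i (v (p k))) \<le> share i (v (P t)) + ?h t" for t
    proof -
      have "share i (v (p k)) \<le> share i (v (P t)) + ?h t" if k: "k \<in> supp (c (t * n + i))" for k
      proof (cases "{P t..Q t} \<inter> D = {}")
        case True
        have "P t \<le> p k" "p k \<le> Q t" using cell_range[OF i k] p_le_q[of k] by auto
        then have "{P t<..p k} \<subseteq> {P t..Q t}" by auto
        then have "{P t<..p k} \<inter> D = {}" using True by blast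
        then have "v (P t) = v (p k)" using v(2) \<open>P t \<le> p k\<close> by blast
        then show ?thesis by simp
      next
        case False
        then show ?thesis using share_le_1[of i "v (p k)"] share_nonneg[of i "v (P t)"] by simp
      qed
      then have "(\<Sum>k\<in>supp (c (t * n + i)). c (t * n + i) k * share i (v (p k)))
        \<le> (\<Sum>k\<in>supp (c (t * n + i)). c (t * n + i) k * (share i (v (P t)) + ?h t))"
        using c_facts(2) by (intro sum_mono mult_left_mono) auto
      also have "\<dots> = share i (v (P t)) + ?h t"
        using c_facts(3)[of "t * n + i"] by (simp flip: sum_distrib_right)
      finally show ?thesis .
    qed
    then show ?thesis unfolding b_facts(4) using a_facts(2) by (intro sum_mono mult_left_mono) auto
  qed
  have "pairing (\<lambda>x. \<Sum>i<n. y i x) f = (\<Sum>i<n. pairing (y i) f)"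
    using pairing_lincomb[of "{..<n}" y "\<lambda>_. 1" f] y_c00 by simp
  also have "\<dots> \<le> (\<Sum>i<n. 3 * th w0 + 2 * (\<Sum>t\<in>supp a. a t * (share i (v (P t)) + ?h t)))"
  proof (rule sum_mono)
    fix i assume "i \<in> {..<n}"
    then have i: "i < n" by simp
    have "controlled (nn i) f (\<lambda>k. 2 * th (v (p k)) * th (nn i - v (p k)) + \<delta>)"
      using nn(1)[of i] nn(2)[of i] by (intro v(3)) linarith
    then show "pairing (y i) f \<le> 3 * th w0 + 2 * (\<Sum>t\<in>supp a. a t * (share i (v (P t)) + ?h t))"
      using y_functional[OF f i] layer[OF i] by fastforce
  qed
  also have "\<dots> = 3 * n * th w0 + 2 * (\<Sum>t\<in>supp a. a t * (\<Sum>i<n. share i (v (P t)) + ?h t))"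
  proof -
    have "(\<Sum>i<n. 3 * th w0 + 2 * S i) = 3 * n * th w0 + 2 * (\<Sum>i<n. S i)" for S
      by (simp add: sum.distrib sum_distrib_left)
    moreover have "(\<Sum>i<n. \<Sum>t\<in>supp a. a t * (share i (v (P t)) + ?h t)) =
        (\<Sum>t\<in>supp a. a t * (\<Sum>i<n. share i (v (P t)) + ?h t))"
      by (subst sum.swap) (simp add: sum_distrib_left)
    ultimately show ?thesis by presburger
  qed
  also have "(\<Sum>t\<in>supp a. a t * (\<Sum>i<n. share i (v (P t)) + ?h t)) \<le> (\<Sum>t\<in>supp a. a t * (1 + 2 * n * th w0 + n * ?h t))"
    using share_sum[OF v(1)] a_facts(2) by (intro sum_mono mult_left_mono) (auto simp: sum.distrib)
  also have "\<dots> = 1 + 2 * n * th w0 + n * hit_mass P Q a D"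
    using a_facts(3) unfolding hit_mass_def
    by (simp add: distrib_left sum.distrib sum_distrib_left mult.left_commute flip: sum_distrib_right)
  also have "n * hit_mass P Q a D \<le> n * th w0" using a_hit[OF D] by (intro mult_left_mono) auto
  finally show "pairing (\<lambda>x. \<Sum>i<n. y i x) f \<le> 2 + 9 * n * th w0" by (simp add: algebra_simps)
qed

end

section \<open>Disjoint vectors with a small sum in every block subspace\<close>

context tsirelson_root begin

lemma layers_exist:
  fixes n :: nat
  assumes Y: "tail_rich Y" and w0: "w0 \<ge> 1" and n: "n \<ge> 1"
  shows "\<exists>y. (\<forall>i<n. y i \<in> Y \<and> 1 / 4 \<le> nrm (y i)) \<and>
    (\<forall>i j. i < j \<longrightarrow> j < n \<longrightarrow> supp (y i) \<inter> supp (y j) = {}) \<and>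
    nrm (\<lambda>x. \<Sum>i<n. y i x) \<le> 2 + 9 * n * th w0"
proof -
  obtain nn L where nnL: "\<forall>i. w0 \<le> L i \<and> L i < nn i \<and> th (nn i - L i) \<le> 2 * th (nn i + w0) \<and>
    nn i \<le> L (Suc i) \<and> th (L (Suc i)) \<le> th w0 * th (nn i)"
    using orders_exist[OF w0] by blast
  \<comment> \<open>The orders \<open>nn\<close> increase, so the value at \<open>n\<close> serves
    for all layers \<open>i < n\<close>.\<close>
  define \<delta> where "\<delta> = th w0 * th (nn n)"
  have \<delta>: "\<delta> > 0" using th_pos by (simp add: \<delta>_def)
  have \<delta>_le: "\<delta> \<le> th w0 * th (nn i)" if "i < n" for i
  proof -
    have "nn i \<le> nn (Suc i)" for i using nnL by (meson less_imp_le order_trans)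
    then have "nn i \<le> nn n" using lift_Suc_mono_le[of nn i n] that by simp
    then show ?thesis unfolding \<delta>_def using th_pos[of w0] by (intro mult_left_mono th_antimono) auto
  qed
  obtain z where z: "\<forall>k. z k \<in> Y \<and> 1 / 2 \<le> nrm (z k) \<and> nrm (z k) \<le> 1" "rapid \<delta> z"
    "\<forall>k. supp (z (Suc k)) \<subseteq> {Suc (Max (supp (z k)))..}"
    using rapid_exists[OF Y \<delta>] by blast
  have "Y \<subseteq> c00" using Y by (simp add: tail_rich_def)
  then have zc: "z k \<in> c00" for k using z(1) by blast
  have zs: "finite (supp (z k)) \<and> supp (z k) \<noteq> {} \<and> supp (z k) \<subseteq> {1..}" for k
  proof (rule nonzero_supp[OF zc])
    have "1 / 2 \<le> nrm (z k)" using z(1) by blast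
    then show "z k \<noteq> (\<lambda>_. 0)" using norm_le_l1[of "\<lambda>_. 0"] by (auto simp: supp_def)
  qed
  define p where "p k = Min (supp (z k))" for k
  define q where "q k = Max (supp (z k))" for k
  have pq: "interlaced p q" unfolding p_def q_def by (rule interlaced_supports) (use zs z(3) in blast)+
  \<comment> \<open>The orders run cyclically through the layers, so that \<open>n\<close>
    consecutive combinations contain one of each order and make up a cell.\<close>
  define R where "R = (\<lambda>(l::nat) (x::nat \<times> (nat \<Rightarrow> real)). special_comb p q (nn (l mod n)) \<delta> (fst x) (snd x))"
  have ex: "\<exists>x. R l x \<and> fst x = m" for l m
    using special_comb_exists[OF pq \<delta>, of "nn (l mod n)" m] by (auto simp: R_def)
  have "\<exists>f. \<forall>l. R l (f l) \<and> supp (snd (f l)) \<subseteq> {..<fst (f (Suc l))}"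
  proof (rule dependent_nat_choice)
    show "\<exists>x. R 0 x" using ex by blast
    fix x l assume "R l x"
    then have fin: "finite (supp (snd x))" by (simp add: R_def special_comb_def)
    then obtain m where m: "\<forall>j\<in>supp (snd x). j < m" by (meson finite_nat_set_iff_bounded)
    obtain y where "R (Suc l) y" "fst y = m" using ex by blast
    then show "\<exists>y. R (Suc l) y \<and> supp (snd x) \<subseteq> {..<fst y}" using m by (intro exI[of _ y]) auto
  qed
  then obtain f where f: "\<And>l. R l (f l)" "\<And>l. supp (snd (f l)) \<subseteq> {..<fst (f (Suc l))}" by blast
  define mm where "mm l = fst (f l)" for l
  define c where "c l = snd (f l)" for l
  have c: "special_comb p q (nn (l mod n)) \<delta> (mm l) (c l)" "supp (c l) \<subseteq> {..<mm (Suc l)}" for l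
    using f[of l] by (auto simp: R_def mm_def c_def)
  have mm: "mm l < mm (Suc l)" for l
  proof -
    have "sum (c l) (supp (c l)) = 1" "supp (c l) \<subseteq> {mm l..}" using c(1)[of l] by (auto simp: special_comb_def)
    then obtain k where "k \<in> supp (c l)" "mm l \<le> k" by (cases "supp (c l) = {}") auto
    then show ?thesis using c(2)[of l] by (auto dest: subsetD)
  qed
  then have sm: "strict_mono mm" by (simp add: strict_mono_Suc_iff)
  have "interlaced (\<lambda>t. p (mm (t * n))) (\<lambda>t. q (mm (Suc t * n) - 1))"
    unfolding interlaced_def
  proof (intro conjI allI)
    show "1 \<le> p (mm (0 * n))" using interlaced_ge[OF pq, of "mm (0 * n)"] by simp
    fix t
    have "t * n < Suc t * n" using n by simp
    then have "mm (t * n) < mm (Suc t * n)" by (rule strict_monoD[OF sm])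
    then have "mm (t * n) \<le> mm (Suc t * n) - 1" "mm (Suc t * n) - 1 < mm (Suc t * n)" by linarith+
    moreover have "p (mm (Suc t * n) - 1) \<le> q (mm (Suc t * n) - 1)" using pq by (simp add: interlaced_def)
    moreover have "p (mm (t * n)) \<le> p (mm (Suc t * n) - 1)"
      using strict_mono_leD[OF interlaced_strict_mono[OF pq] calculation(1)] .
    ultimately show "p (mm (t * n)) \<le> q (mm (Suc t * n) - 1)" "q (mm (Suc t * n) - 1) < p (mm (Suc t * n))"
      using interlaced_less[OF pq, of "mm (Suc t * n) - 1" "mm (Suc t * n)"] by linarith+
  qed
  then obtain a where a: "special_comb (\<lambda>t. p (mm (t * n))) (\<lambda>t. q (mm (Suc t * n) - 1)) w0 (th w0) 0 a"
    using special_comb_exists[OF _ th_pos] by blast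
  have zY: "z k \<in> Y" for k using z(1) by blast
  interpret layers \<theta> N z p q \<delta> w0 n nn L mm c a
  proof unfold_locales
    fix k
    have "supp (z k) \<subseteq> {p k..q k}" using zs[of k] by (auto simp: p_def q_def)
    then show "z k \<in> c00 \<and> supp (z k) \<subseteq> {p k..q k} \<and> nrm (z k) \<le> 1" using zc z(1) by blast
  qed (use pq \<delta> z w0 n nnL \<delta>_le c a in \<open>auto simp: p_def\<close>)
  have yY: "y i \<in> Y" for i
    unfolding y_def by (rule tail_rich_lincomb[OF Y b_facts(1)]) (rule zY)
  show ?thesis
    by (intro exI[of _ y] conjI allI impI yY y_lower y_disjoint y_upper)
qed

text \<open>\<open>n\<close> depends on \<open>\<eta>\<close> alone, not on \<open>Y\<close>: the
  application takes for \<open>Y\<close> a span of blocks with indices from \<open>n\<close> on. The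
  bounds \<open>\<eta> / 18\<close> and \<open>4 / \<eta>\<close> give each of the two terms in
  \<open>2 + 9 * n * th w0\<close> one half of \<open>\<eta> * n\<close>.\<close>

lemma disjoint_small_sum:
  assumes "\<eta> > 0"
  shows "\<exists>n::nat. n \<ge> 1 \<and> (\<forall>Y. tail_rich Y \<longrightarrow> (\<exists>y. (\<forall>i<n. y i \<in> Y \<and> 1 / 4 \<le> nrm (y i)) \<and>
    (\<forall>i j. i < j \<longrightarrow> j < n \<longrightarrow> supp (y i) \<inter> supp (y j) = {}) \<and>
    nrm (\<lambda>x. \<Sum>i<n. y i x) \<le> \<eta> * real n))"
proof -
  have "\<theta> \<longlonglongrightarrow> 0" using reg by (simp add: regular_seq_def)
  moreover have "\<eta> / 18 > 0" using assms by simp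
  ultimately have "eventually (\<lambda>w. \<theta> w < \<eta> / 18) sequentially" by (rule order_tendstoD(2))
  then obtain w1 where w1: "\<And>w. w \<ge> w1 \<Longrightarrow> \<theta> w < \<eta> / 18" by (auto simp: eventually_sequentially)
  define w0 where "w0 = max 1 w1"
  have w0: "w0 \<ge> 1" "th w0 < \<eta> / 18" using w1[of w0] by (auto simp: w0_def)
  obtain n1 :: nat where n1: "4 / \<eta> \<le> n1" using real_arch_simple by blast
  define n where "n = max 1 n1"
  have n: "n \<ge> 1" "4 / \<eta> \<le> n" using n1 by (auto simp: n_def)
  have "2 \<le> \<eta> * n / 2" using n(2) assms by (simp add: field_simps)
  moreover have "9 * n * th w0 \<le> 9 * n * (\<eta> / 18)" using w0(2) by (intro mult_left_mono) auto
  ultimately have "2 + 9 * n * th w0 \<le> \<eta> * n" by (simp add: algebra_simps)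
  then have le: "S \<le> \<eta> * n" if "S \<le> 2 + 9 * n * th w0" for S using that by linarith
  show ?thesis
  proof (rule exI[of _ n], rule conjI[OF n(1)], rule allI, rule impI)
    fix Y assume "tail_rich Y"
    then obtain y where "\<forall>i<n. y i \<in> Y \<and> 1 / 4 \<le> nrm (y i)"
      "\<forall>i j. i < j \<longrightarrow> j < n \<longrightarrow> supp (y i) \<inter> supp (y j) = {}" "nrm (\<lambda>x. \<Sum>i<n. y i x) \<le> 2 + 9 * n * th w0"
      using layers_exist[OF _ w0(1) n(1)] by blast
    then show "\<exists>y. (\<forall>i<n. y i \<in> Y \<and> 1 / 4 \<le> nrm (y i)) \<and>
      (\<forall>i j. i < j \<longrightarrow> j < n \<longrightarrow> supp (y i) \<inter> supp (y j) = {}) \<and> nrm (\<lambda>x. \<Sum>i<n. y i x) \<le> \<eta> * n"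
      using le by blast
  qed
qed

end

section \<open>Completions\<close>

definition linear_on_set :: "'a::real_vector set \<Rightarrow> ('a \<Rightarrow> 'b::real_vector) \<Rightarrow> bool" where
  "linear_on_set A f \<longleftrightarrow> (\<forall>x\<in>A. \<forall>y\<in>A. f (x + y) = f x + f y) \<and> (\<forall>x\<in>A. \<forall>c. f (c *\<^sub>R x) = c *\<^sub>R f x)"

lemma linear_on_set_sum:
  assumes "linear_on_set A f" "subspace A" "finite S" "\<And>k. k \<in> S \<Longrightarrow> a k \<in> A"
  shows "f (\<Sum>k\<in>S. d k *\<^sub>R a k) = (\<Sum>k\<in>S. d k *\<^sub>R f (a k))"
  using assms(3,4)
proof (induction S rule: finite_induct)
  case empty
  have "f (0 *\<^sub>R 0) = 0 *\<^sub>R f 0"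
    using assms(1) subspace_0[OF assms(2)] unfolding linear_on_set_def by blast
  then show ?case by simp
next
  case (insert k S)
  have "d k *\<^sub>R a k \<in> A" "(\<Sum>k\<in>S. d k *\<^sub>R a k) \<in> A"
    using insert.prems assms(2) by (auto intro: subspace_scale subspace_sum)
  then have "f (d k *\<^sub>R a k + (\<Sum>k\<in>S. d k *\<^sub>R a k)) = f (d k *\<^sub>R a k) + f (\<Sum>k\<in>S. d k *\<^sub>R a k)"
    using assms(1) unfolding linear_on_set_def by blast
  moreover have "f (d k *\<^sub>R a k) = d k *\<^sub>R f (a k)"
    using assms(1) insert.prems unfolding linear_on_set_def by blast
  ultimately show ?case using insert by simp
qed

lemma linear_on_set_bounded:
  fixes f :: "'a::real_normed_vector \<Rightarrow> 'b::real_normed_vector"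
  assumes f: "linear_on_set A f" and A: "subspace A" and cont: "continuous_on A f"
  shows "\<exists>C\<ge>1. \<forall>x\<in>A. norm (f x) \<le> C * norm x"
proof -
  have f0: "f 0 = 0" using linear_on_set_sum[OF f A, of "{}" "\<lambda>_. 0" "\<lambda>_. 0"] by simp
  have "0 \<in> A" using A by (rule subspace_0)
  then obtain d where d: "d > 0" "\<forall>x\<in>A. dist x 0 < d \<longrightarrow> dist (f x) (f 0) < 1"
    using cont unfolding continuous_on_iff by (meson zero_less_one)
  have "norm (f x) \<le> (2 / d) * norm x" if "x \<in> A" for x
  proof (cases "x = 0")
    case False
    define r where "r = d / (2 * norm x)"
    have r: "r > 0" using d(1) False by (simp add: r_def)
    have "r *\<^sub>R x \<in> A" using A that by (rule subspace_scale)
    moreover have "dist (r *\<^sub>R x) 0 < d" using False d(1) by (simp add: r_def)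
    ultimately have "norm (f (r *\<^sub>R x)) < 1" using d(2) f0 by auto
    moreover have "f (r *\<^sub>R x) = r *\<^sub>R f x" using f that unfolding linear_on_set_def by blast
    ultimately have "r * norm (f x) < 1" using r by simp
    then show ?thesis using False d(1) by (simp add: r_def field_simps)
  qed (simp add: f0)
  then have "\<forall>x\<in>A. norm (f x) \<le> max 1 (2 / d) * norm x"
    by (meson max.cobounded2 mult_right_mono norm_ge_zero order_trans)
  then show ?thesis by (intro exI[of _ "max 1 (2 / d)"]) auto
qed

text \<open>The kernel of one functional has codimension at most one, hence is again
  infinite-dimensional; a finite spanning set of it together with one further vector would span the
  whole subspace.\<close>

lemma infinite_dimensional_kernel:
  fixes q :: "'i \<Rightarrow> 'a::real_vector \<Rightarrow> real"
  assumes "finite I" "subspace A" "infinite_dimensional A" "\<And>i. i \<in> I \<Longrightarrow> linear_on_set A (q i)"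
  shows "\<exists>a\<in>A. a \<noteq> 0 \<and> (\<forall>i\<in>I. q i a = 0)"
  using assms
proof (induction I arbitrary: A rule: finite_induct)
  case empty
  have "A \<noteq> {0}"
  proof
    assume "A = {0}"
    then have "span {} = A" by simp
    then show False using empty.prems(2) unfolding infinite_dimensional_def by blast
  qed
  then show ?case using subspace_0[OF empty.prems(1)] by blast
next
  case (insert i I)
  define A' where "A' = {a \<in> A. q i a = 0}"
  have lin: "q i (x + y) = q i x + q i y" "q i (c *\<^sub>R x) = c * q i x" if "x \<in> A" "y \<in> A" for x y c
    using insert.prems(3)[of i] that by (auto simp: linear_on_set_def)
  have "q i 0 = 0" using lin(2)[of 0 0 0] subspace_0[OF insert.prems(1)] by simp
  then have sub: "subspace A'"
    using insert.prems(1) lin by (auto simp: A'_def subspace_def)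
  have "infinite_dimensional A'"
    unfolding infinite_dimensional_def
  proof
    assume "\<exists>B. finite B \<and> span B = A'"
    then obtain B where B: "finite B" "span B = A'" by blast
    have "\<exists>B. finite B \<and> span B = A"
    proof (cases "\<exists>v\<in>A. q i v \<noteq> 0")
      case False
      then have "A' = A" by (auto simp: A'_def)
      then show ?thesis using B by blast
    next
      case True
      then obtain v where v: "v \<in> A" "q i v \<noteq> 0" by blast
      have "span (insert v B) \<subseteq> A"
        using B v insert.prems(1) span_superset[of B] by (intro span_minimal) (auto simp: A'_def)
      moreover have "x \<in> span (insert v B)" if x: "x \<in> A" for x
      proof -
        define c where "c = q i x / q i v"
        have mem: "x + (- c) *\<^sub>R v \<in> A" using x v insert.prems(1) by (intro subspace_add subspace_scale)
        have "q i (x + (- c) *\<^sub>R v) = q i x + - c * q i v"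
          by (simp only: lin(1)[OF x subspace_scale[OF insert.prems(1) v(1)]] lin(2)[OF v(1) v(1)])
        then have "x + (- c) *\<^sub>R v \<in> span B" using mem v B by (simp add: A'_def c_def)
        then show ?thesis unfolding span_insert by (auto intro!: exI[of _ c])
      qed
      ultimately show ?thesis using B(1) by (intro exI[of _ "insert v B"]) auto
    qed
    then show False using insert.prems(2) unfolding infinite_dimensional_def by blast
  qed
  moreover have "linear_on_set A' (q j)" if "j \<in> I" for j
    using insert.prems(3)[of j] that by (auto simp: linear_on_set_def A'_def)
  ultimately obtain a where "a \<in> A'" "a \<noteq> 0" "\<forall>i\<in>I. q i a = 0" using insert.IH[OF sub] by blast
  then show ?case by (auto simp: A'_def)
qed

lemma infinite_dimensional_image:
  fixes g :: "'a::real_vector \<Rightarrow> 'b::real_vector"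
  assumes g: "linear_on_set Z g" and Z: "subspace Z" and Y: "subspace (g ` Z)" and inf: "infinite_dimensional (g ` Z)"
  shows "infinite_dimensional Z"
  unfolding infinite_dimensional_def
proof
  assume "\<exists>B. finite B \<and> span B = Z"
  then obtain B where B: "finite B" "span B = Z" by blast
  have BZ: "B \<subseteq> Z" using B span_superset by blast
  have "span (g ` B) \<subseteq> g ` Z" using BZ Y by (intro span_minimal) auto
  moreover have "g x \<in> span (g ` B)" if "x \<in> Z" for x
  proof -
    have "x \<in> (\<lambda>u. \<Sum>b\<in>B. u b *\<^sub>R b) ` UNIV" using that B(2) span_finite[OF B(1)] by simp
    then obtain u where u: "x = (\<Sum>b\<in>B. u b *\<^sub>R b)" by blast
    have "g x = (\<Sum>b\<in>B. u b *\<^sub>R g b)"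
      unfolding u using BZ by (intro linear_on_set_sum[OF g Z B(1)]) auto
    moreover have "(\<Sum>b\<in>B. u b *\<^sub>R g b) \<in> span (g ` B)"
      by (intro span_sum span_scale span_base) simp
    ultimately show ?thesis by simp
  qed
  ultimately have "span (g ` B) = g ` Z" by blast
  then show False using inf B(1) unfolding infinite_dimensional_def by blast
qed

section \<open>Coordinate functionals on the completion\<close>

locale c00_embedding = norming +
  fixes J :: "(nat \<Rightarrow> real) \<Rightarrow> 'a::banach"
  assumes J_add: "x \<in> c00 \<Longrightarrow> y \<in> c00 \<Longrightarrow> J (\<lambda>i. x i + y i) = J x + J y"
    and J_scale: "x \<in> c00 \<Longrightarrow> J (\<lambda>i. d * x i) = d *\<^sub>R J x"
    and J_norm: "x \<in> c00 \<Longrightarrow> norm (J x) = norm_of_set K x"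
begin

lemma J_diff: "x \<in> c00 \<Longrightarrow> y \<in> c00 \<Longrightarrow> J (\<lambda>i. x i - y i) = J x - J y"
  using J_add[of x "\<lambda>i. (-1) * y i"] J_scale[of y "-1"] c00_scale[of y "-1"] by simp

lemma c00_diff: "x \<in> c00 \<Longrightarrow> y \<in> c00 \<Longrightarrow> (\<lambda>i. x i - y i) \<in> c00"
  using c00_add[of x "\<lambda>i. (-1) * y i"] c00_scale[of y "-1"] by simp

lemma J_lincomb:
  "finite S \<Longrightarrow> (\<And>k. k \<in> S \<Longrightarrow> x k \<in> c00) \<Longrightarrow> J (\<lambda>i. \<Sum>k\<in>S. d k * x k i) = (\<Sum>k\<in>S. d k *\<^sub>R J (x k))"
proof (induction S rule: finite_induct)
  case empty
  show ?case using J_scale[OF c00_zero, of 0] by simp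
next
  case (insert k S)
  have "J (\<lambda>i. d k * x k i + (\<Sum>k\<in>S. d k * x k i)) = J (\<lambda>i. d k * x k i) + J (\<lambda>i. \<Sum>k\<in>S. d k * x k i)"
    using insert by (intro J_add c00_scale c00_lincomb) auto
  then show ?case using insert J_scale by simp
qed

text \<open>The coordinate functionals extend to the completion; the formula is that of the Hahn-Banach
  (McShane) extension, which needs no limits.\<close>

definition coord :: "nat \<Rightarrow> 'a \<Rightarrow> real" where
  "coord i a = (SUP x\<in>c00. x i - norm (a - J x))"

text \<open>On \<open>c00\<close> the coordinate is 1-Lipschitz, as it is bounded by the norm, and
  the extension keeps the constant. Linearity on the closure and small coordinates of approximants
  are both derived from this estimate.\<close>

lemma coord_approx:
  assumes "x \<in> c00" shows "\<bar>coord i a - x i\<bar> \<le> norm (a - J x)"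
proof -
  have le: "y i - norm (a - J y) \<le> x i + norm (a - J x)" if "x \<in> c00" "y \<in> c00" for x y
  proof -
    have "y i - x i \<le> norm (J (\<lambda>i. y i - x i))"
      using abs_coord_le_norm[OF c00_diff[OF that(2,1)], of i] J_norm[OF c00_diff[OF that(2,1)]] by simp
    also have "\<dots> = norm ((a - J x) - (a - J y))" using J_diff[OF that(2,1)] by simp
    also have "\<dots> \<le> norm (a - J x) + norm (a - J y)" by (rule norm_triangle_ineq4)
    finally show ?thesis by simp
  qed
  have "bdd_above ((\<lambda>x. x i - norm (a - J x)) ` c00)"
    using le[OF assms] by (intro bdd_aboveI2)
  then have "x i - norm (a - J x) \<le> coord i a"
    unfolding coord_def using assms by (intro cSUP_upper) auto
  moreover have "coord i a \<le> x i + norm (a - J x)"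
    unfolding coord_def using le[OF assms] assms by (intro cSUP_least) auto
  ultimately show ?thesis by simp
qed

lemma closure_approx:
  assumes "a \<in> closure (J ` c00)" "e > 0" shows "\<exists>x\<in>c00. norm (a - J x) < e"
  using assms unfolding closure_approachable by (auto simp: dist_norm norm_minus_commute)

lemma coord_linear:
  assumes V: "V \<subseteq> closure (J ` c00)"
  shows "linear_on_set V (coord i)"
  unfolding linear_on_set_def
proof (intro conjI ballI allI)
  fix a b assume "a \<in> V" "b \<in> V"
  then have ab: "a \<in> closure (J ` c00)" "b \<in> closure (J ` c00)" using V by auto
  have "\<bar>coord i (a + b) - (coord i a + coord i b)\<bar> \<le> e" if e: "e > 0" for e
  proof -
    obtain x y where x: "x \<in> c00" "norm (a - J x) < e / 4" and y: "y \<in> c00" "norm (b - J y) < e / 4"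
      using closure_approx[OF ab(1), of "e / 4"] closure_approx[OF ab(2), of "e / 4"] e by auto
    have "norm (a + b - J (\<lambda>i. x i + y i)) = norm ((a - J x) + (b - J y))"
      using J_add[OF x(1) y(1)] by (simp add: algebra_simps)
    also have "\<dots> \<le> norm (a - J x) + norm (b - J y)" by (rule norm_triangle_ineq)
    finally have "\<bar>coord i (a + b) - (x i + y i)\<bar> \<le> norm (a - J x) + norm (b - J y)"
      using coord_approx[OF c00_add[OF x(1) y(1)], of i "a + b"] by simp
    then show ?thesis using coord_approx[OF x(1), of i a] coord_approx[OF y(1), of i b] x(2) y(2) by linarith
  qed
  then have "\<bar>coord i (a + b) - (coord i a + coord i b)\<bar> \<le> 0" by (rule field_le_epsilon) simp
  then show "coord i (a + b) = coord i a + coord i b" by simp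
next
  fix a c assume "a \<in> V"
  then have a: "a \<in> closure (J ` c00)" using V by auto
  have "\<bar>coord i (c *\<^sub>R a) - c * coord i a\<bar> \<le> e" if e: "e > 0" for e
  proof -
    obtain x where x: "x \<in> c00" "norm (a - J x) < e / (2 * \<bar>c\<bar> + 1)"
      using closure_approx[OF a, of "e / (2 * \<bar>c\<bar> + 1)"] e by auto
    have "norm (c *\<^sub>R a - J (\<lambda>i. c * x i)) = \<bar>c\<bar> * norm (a - J x)"
      using J_scale[OF x(1)] by (simp flip: scaleR_diff_right)
    then have 1: "\<bar>coord i (c *\<^sub>R a) - c * x i\<bar> \<le> \<bar>c\<bar> * norm (a - J x)"
      using coord_approx[OF c00_scale[OF x(1)], of i "c *\<^sub>R a" c] by simp
    have "\<bar>c * coord i a - c * x i\<bar> = \<bar>c\<bar> * \<bar>coord i a - x i\<bar>" by (simp add: abs_mult flip: right_diff_distrib)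
    also have "\<dots> \<le> \<bar>c\<bar> * norm (a - J x)" by (intro mult_left_mono coord_approx x) simp
    finally have 2: "\<bar>c * coord i a - c * x i\<bar> \<le> \<bar>c\<bar> * norm (a - J x)" .
    have "2 * \<bar>c\<bar> * norm (a - J x) \<le> (2 * \<bar>c\<bar> + 1) * norm (a - J x)" by (intro mult_right_mono) auto
    also have "\<dots> \<le> (2 * \<bar>c\<bar> + 1) * (e / (2 * \<bar>c\<bar> + 1))" using x(2) by (intro mult_left_mono) auto
    also have "\<dots> = e" using abs_ge_zero[of c] by simp
    finally show ?thesis using 1 2 by linarith
  qed
  then have "\<bar>coord i (c *\<^sub>R a) - c * coord i a\<bar> \<le> 0" by (rule field_le_epsilon) simp
  then show "coord i (c *\<^sub>R a) = c *\<^sub>R coord i a" by simp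
qed

lemma tail_approx:
  assumes a: "a \<in> closure (J ` c00)" "\<And>i. i \<le> m \<Longrightarrow> coord i a = 0" and e: "e > 0"
  shows "\<exists>x\<in>c00. supp x \<subseteq> {m<..} \<and> norm (a - J x) \<le> e"
proof -
  \<comment> \<open>Cutting off the coordinates \<open>0, \<dots>, m\<close>, each smaller than
    \<open>e / (m + 2)\<close>, costs at most \<open>m + 1\<close> such terms; the last one covers
    the approximation itself.\<close>
  obtain x where x: "x \<in> c00" "norm (a - J x) < e / (m + 2)"
    using closure_approx[OF a(1), of "e / (m + 2)"] e by auto
  define x' where "x' = restr {m<..} x"
  have x': "x' \<in> c00" using x(1) c00_restr by (simp add: x'_def)
  have d: "(\<lambda>i. x i - x' i) = restr {..m} x" by (auto simp: x'_def restr_def)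
  have "norm (J x - J x') = norm_of_set K (restr {..m} x)"
    using J_diff[OF x(1) x'] J_norm[OF c00_diff[OF x(1) x']] d by simp
  also have "\<dots> \<le> (\<Sum>i\<in>supp (restr {..m} x). \<bar>restr {..m} x i\<bar>)" by (rule norm_le_l1)
  also have "\<dots> \<le> (\<Sum>i\<le>m. \<bar>restr {..m} x i\<bar>)" by (intro sum_mono2) (auto simp: supp_restr)
  also have "\<dots> \<le> (\<Sum>i\<le>m. e / (m + 2))"
  proof (rule sum_mono)
    fix i assume i: "i \<in> {..m}"
    then show "\<bar>restr {..m} x i\<bar> \<le> e / (m + 2)"
      using coord_approx[OF x(1), of i a] a(2)[of i] x(2) by (simp add: restr_def)
  qed
  also have "\<dots> = (m + 1) * (e / (m + 2))" by simp
  finally have "norm (J x - J x') \<le> (m + 1) * (e / (m + 2))" .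
  moreover have "norm (a - J x') \<le> norm (a - J x) + norm (J x - J x')"
    using norm_triangle_ineq[of "a - J x" "J x - J x'"] by simp
  moreover have "(m + 1) * (e / (m + 2)) + e / (m + 2) = e"
  proof -
    define D where "D = real (m + 2)"
    have D: "D \<noteq> 0" unfolding D_def by linarith
    have "real (m + 1) * c + c = D * c" for c :: real by (simp add: D_def algebra_simps)
    then have "real (m + 1) * (e / D) + e / D = D * (e / D)" .
    also have "\<dots> = e" using D by simp
    finally show ?thesis by (simp only: D_def)
  qed
  ultimately have "norm (a - J x') \<le> e" using x(2) by linarith
  then show ?thesis using x' by (intro bexI[of _ x']) (auto simp: x'_def supp_restr)
qed

end

section \<open>The gliding hump\<close>

definition comb :: "(nat \<Rightarrow> nat \<Rightarrow> real) \<Rightarrow> (nat \<Rightarrow> real) \<Rightarrow> nat \<Rightarrow> real" where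
  "comb u d = (\<lambda>t. \<Sum>k\<in>supp d. d k * u k t)"

lemma comb_superset: "finite S \<Longrightarrow> supp d \<subseteq> S \<Longrightarrow> comb u d t = (\<Sum>k\<in>S. d k * u k t)"
  unfolding comb_def by (rule sum.mono_neutral_left) (auto simp: supp_def)

lemma finite_supp_add: "finite (supp d) \<Longrightarrow> finite (supp d') \<Longrightarrow> finite (supp (\<lambda>k. d k + d' k))"
  by (rule finite_subset[of _ "supp d \<union> supp d'"]) (auto simp: supp_def)

lemma comb_add:
  assumes "finite (supp d)" "finite (supp d')"
  shows "comb u (\<lambda>k. d k + d' k) = (\<lambda>t. comb u d t + comb u d' t)"
proof
  fix t
  have fin: "finite (supp d \<union> supp d')" using assms by simp
  have "supp (\<lambda>k. d k + d' k) \<subseteq> supp d \<union> supp d'" by (auto simp: supp_def)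
  then show "comb u (\<lambda>k. d k + d' k) t = comb u d t + comb u d' t"
    using comb_superset[OF fin, of _ u t] by (simp add: distrib_right sum.distrib)
qed

lemma comb_scale: "finite (supp d) \<Longrightarrow> comb u (\<lambda>k. c * d k) = (\<lambda>t. c * comb u d t)"
  using comb_superset[of "supp d" "\<lambda>k. c * d k" u]
  by (auto simp: fun_eq_iff supp_def comb_def sum_distrib_left mult.assoc)

lemma comb_sum:
  assumes "finite I" "\<And>i. i \<in> I \<Longrightarrow> finite (supp (d i))"
  shows "finite (supp (\<lambda>k. \<Sum>i\<in>I. d i k))" "comb u (\<lambda>k. \<Sum>i\<in>I. d i k) = (\<lambda>t. \<Sum>i\<in>I. comb u (d i) t)"
  using assms
proof (induction I rule: finite_induct)
  case empty
  {
    case 1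
    then show ?case by (simp add: supp_def)
  next
    case 2
    then show ?case by (simp add: comb_def supp_def)
  }
next
  case (insert i I)
  {
    case 1
    then show ?case using insert by (simp add: finite_supp_add)
  next
    case 2
    then show ?case using insert comb_add[of "d i" "\<lambda>k. \<Sum>i\<in>I. d i k" u] by simp
  }
qed

locale two_embeddings = tsirelson_root \<theta> N + T: c00_embedding "\<lambda>k. admissible (schreier k)" \<theta> JT +
    X: c00_embedding A \<theta> JX
  for \<theta> N A and JT :: "(nat \<Rightarrow> real) \<Rightarrow> 'b::banach" and JX :: "(nat \<Rightarrow> real) \<Rightarrow> 'a::banach" +
  assumes A1: "A 1 = allowable (schreier 1)"
begin

abbreviation nrmX where "nrmX \<equiv> norm_of_set (norming_set A \<theta>)"

text \<open>The hump must glide in both spaces with the same vector. The first coordinates of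
  \<open>v\<close> in \<open>X\<close> and those of \<open>\<Phi> v\<close> in \<open>T\<close> are
  finitely many linear functionals on \<open>V\<close> and have a common nonzero zero; the Boolean
  in the index of \<open>q\<close> tells the two spaces apart.\<close>

lemma gliding_hump_step:
  assumes V: "subspace V" "infinite_dimensional V" "V \<subseteq> closure (JX ` c00)"
    and \<Phi>: "linear_on_set V \<Phi>" "\<Phi> ` V \<subseteq> closure (JT ` c00)"
    and inj: "\<And>v. v \<in> V \<Longrightarrow> norm v \<le> C * norm (\<Phi> v)"
    and e: "e > 0"
  shows "\<exists>v x u. v \<in> V \<and> norm (\<Phi> v) = 1 \<and> x \<in> c00 \<and> u \<in> c00 \<and> supp x \<subseteq> {m<..} \<and> supp u \<subseteq> {m<..} \<and>
    norm (v - JX x) \<le> e \<and> norm (\<Phi> v - JT u) \<le> e"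
proof -
  define q where "q = (\<lambda>(b, i) v. if b then X.coord i v else T.coord i (\<Phi> v))"
  have "linear_on_set V (q j)" for j
  proof -
    have "linear_on_set V (X.coord i)" for i by (rule X.coord_linear[OF V(3)])
    moreover have "linear_on_set V (\<lambda>v. T.coord i (\<Phi> v))" for i
    proof -
      have lT: "linear_on_set (closure (JT ` c00)) (T.coord i)" by (rule T.coord_linear) simp
      have "\<Phi> x \<in> closure (JT ` c00)" if "x \<in> V" for x using \<Phi>(2) that by blast
      then show ?thesis using lT \<Phi>(1) unfolding linear_on_set_def by simp
    qed
    ultimately show ?thesis unfolding q_def by (cases j; cases "fst j") simp_all
  qed
  then obtain v0 where v0: "v0 \<in> V" "v0 \<noteq> 0" "\<forall>j\<in>UNIV \<times> {..m}. q j v0 = 0"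
    using infinite_dimensional_kernel[of "UNIV \<times> {..m}" V q] V(1,2) by auto
  have \<Phi>0: "norm (\<Phi> v0) > 0" using inj[OF v0(1)] v0(2) by auto
  define v where "v = (1 / norm (\<Phi> v0)) *\<^sub>R v0"
  have v: "v \<in> V" unfolding v_def using V(1) v0(1) by (rule subspace_scale)
  have \<Phi>v: "\<Phi> v = (1 / norm (\<Phi> v0)) *\<^sub>R \<Phi> v0" unfolding v_def using \<Phi>(1) v0(1) by (simp add: linear_on_set_def)
  have n1: "norm (\<Phi> v) = 1" unfolding \<Phi>v using \<Phi>0 by simp
  have qv: "q j v = 0" if "j \<in> UNIV \<times> {..m}" for j
  proof -
    have "q j v0 = 0" using v0(3) that by blast
    then show ?thesis using \<open>\<And>j. linear_on_set V (q j)\<close>[of j] v0(1) unfolding v_def linear_on_set_def by simp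
  qed
  have "\<exists>x\<in>c00. supp x \<subseteq> {m<..} \<and> norm (v - JX x) \<le> e"
    using V(3) v qv[of "(True, _)"] by (intro X.tail_approx e) (auto simp: q_def)
  moreover have "\<exists>u\<in>c00. supp u \<subseteq> {m<..} \<and> norm (\<Phi> v - JT u) \<le> e"
    using \<Phi>(2) v qv[of "(False, _)"] by (intro T.tail_approx e) (auto simp: q_def)
  ultimately show ?thesis using v n1 by blast
qed

lemma gliding_hump:
  assumes V: "subspace V" "infinite_dimensional V" "V \<subseteq> closure (JX ` c00)"
    and \<Phi>: "linear_on_set V \<Phi>" "\<Phi> ` V \<subseteq> closure (JT ` c00)"
    and inj: "\<And>v. v \<in> V \<Longrightarrow> norm v \<le> C * norm (\<Phi> v)"
    and e: "e > 0"
  shows "\<exists>v x u m. strict_mono (m :: nat \<Rightarrow> nat) \<and> (\<forall>k. v k \<in> V \<and> norm (\<Phi> (v k)) = 1 \<and> x k \<in> c00 \<and> u k \<in> c00 \<and>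
    supp (x k) \<subseteq> {Suc (m k)..m (Suc k)} \<and> supp (u k) \<subseteq> {Suc (m k)..m (Suc k)} \<and>
    norm (v k - JX (x k)) \<le> e * (1 / 2) ^ Suc k \<and> norm (\<Phi> (v k) - JT (u k)) \<le> e * (1 / 2) ^ Suc k)"
proof -
  define P where "P = (\<lambda>k s. case s of (v, x, u, m) \<Rightarrow> v \<in> V \<and> norm (\<Phi> v) = 1 \<and> x \<in> c00 \<and> u \<in> c00 \<and>
    supp x \<subseteq> {Suc m..} \<and> supp u \<subseteq> {Suc m..} \<and>
    norm (v - JX x) \<le> e * (1 / 2) ^ Suc k \<and> norm (\<Phi> v - JT u) \<le> e * (1 / 2) ^ Suc k)"
  define Q where "Q = (\<lambda>s s'. case s of (v :: 'a, x, u, m :: nat) \<Rightarrow> case s' of (v' :: 'a, x' :: nat \<Rightarrow> real, u' :: nat \<Rightarrow> real, m') \<Rightarrow>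
    m < m' \<and> supp x \<subseteq> {..m'} \<and> supp u \<subseteq> {..m'})"
  have ex: "\<exists>v x u. P k (v, x, u, m)" for k m
    using gliding_hump_step[OF V \<Phi> inj, of "e * (1 / 2) ^ Suc k" m] e
    unfolding P_def by (simp add: atLeast_Suc_greaterThan)
  have "\<exists>f. \<forall>k. P k (f k) \<and> Q (f k) (f (Suc k))"
  proof (rule dependent_nat_choice)
    show "\<exists>s. P 0 s" using ex by blast
    fix s k assume "P k s"
    obtain v x u m where s: "s = (v, x, u, m)" by (cases s)
    have "finite (supp x \<union> supp u)" using \<open>P k s\<close> finite_supp by (auto simp: P_def s)
    then obtain M where M: "\<forall>i\<in>supp x \<union> supp u. i < M" by (meson finite_nat_set_iff_bounded)
    obtain v' x' u' where "P (Suc k) (v', x', u', max (Suc m) M)" using ex by blast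
    then show "\<exists>s'. P (Suc k) s' \<and> Q s s'"
      using M by (intro exI[of _ "(v', x', u', max (Suc m) M)"]) (auto simp: Q_def s less_imp_le le_max_iff_disj)
  qed
  then obtain f where f: "\<And>k. P k (f k)" "\<And>k. Q (f k) (f (Suc k))" by blast
  define v where "v k = fst (f k)" for k
  define x where "x k = fst (snd (f k))" for k
  define u where "u k = fst (snd (snd (f k)))" for k
  define m where "m k = snd (snd (snd (f k)))" for k
  have fk: "f k = (v k, x k, u k, m k)" for k by (simp add: v_def x_def u_def m_def)
  have "strict_mono m" unfolding strict_mono_Suc_iff using f(2) by (simp add: Q_def fk)
  moreover have "v k \<in> V \<and> norm (\<Phi> (v k)) = 1 \<and> x k \<in> c00 \<and> u k \<in> c00 \<and>
    supp (x k) \<subseteq> {Suc (m k)..m (Suc k)} \<and> supp (u k) \<subseteq> {Suc (m k)..m (Suc k)} \<and>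
    norm (v k - JX (x k)) \<le> e * (1 / 2) ^ Suc k \<and> norm (\<Phi> (v k) - JT (u k)) \<le> e * (1 / 2) ^ Suc k" for k
    using f(1)[of k] f(2)[of k] by (auto simp: P_def Q_def fk)
  ultimately show ?thesis by blast
qed

lemma no_common_subspace:
  assumes V: "subspace V" "infinite_dimensional V" "V \<subseteq> closure (JX ` c00)"
    and \<Phi>: "linear_on_set V \<Phi>" "\<Phi> ` V \<subseteq> closure (JT ` c00)"
    and C: "C \<ge> 1" "\<And>v. v \<in> V \<Longrightarrow> norm v \<le> C * norm (\<Phi> v)" "\<And>v. v \<in> V \<Longrightarrow> norm (\<Phi> v) \<le> C * norm v"
  shows False
proof -
  \<comment> \<open>The perturbation of a combination is at most \<open>2 * e\<close> times its norm
    in \<open>T\<close>. This is at most a quarter of that norm, even after multiplication by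
    \<open>C\<close>.\<close>
  define e where "e = 1 / (8 * C)"
  have e: "e > 0" "e \<le> 1 / 8" "e * C = 1 / 8" using C(1) by (auto simp: e_def field_simps)
  obtain v x u m where m: "strict_mono (m :: nat \<Rightarrow> nat)" and hump:
    "\<forall>k. v k \<in> V \<and> norm (\<Phi> (v k)) = 1 \<and> x k \<in> c00 \<and> u k \<in> c00 \<and>
    supp (x k) \<subseteq> {Suc (m k)..m (Suc k)} \<and> supp (u k) \<subseteq> {Suc (m k)..m (Suc k)} \<and>
    norm (v k - JX (x k)) \<le> e * (1 / 2) ^ Suc k \<and> norm (\<Phi> (v k) - JT (u k)) \<le> e * (1 / 2) ^ Suc k"
    using gliding_hump[OF V \<Phi> C(2) e(1)] by blast
  have vV: "v k \<in> V" and v1: "norm (\<Phi> (v k)) = 1" and xc: "x k \<in> c00" and uc: "u k \<in> c00"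
    and xs: "supp (x k) \<subseteq> {Suc (m k)..m (Suc k)}" and us: "supp (u k) \<subseteq> {Suc (m k)..m (Suc k)}"
    and xv: "norm (v k - JX (x k)) \<le> e * (1 / 2) ^ Suc k" and uv: "norm (\<Phi> (v k) - JT (u k)) \<le> e * (1 / 2) ^ Suc k" for k
    using hump by blast+
  have pq: "interlaced (\<lambda>k. Suc (m k)) (\<lambda>k. m (Suc k))"
    using m by (auto simp: interlaced_def strict_mono_Suc_iff Suc_le_eq)
  have mk: "k \<le> m k" for k using m by (rule strict_mono_imp_increasing)
  have unorm: "1 / 2 \<le> nrm (u k)" for k
  proof -
    have "e * (1 / 2) ^ Suc k \<le> e * 1" using e by (intro mult_left_mono power_le_one) auto
    then have "norm (\<Phi> (v k) - JT (u k)) \<le> 1 / 2" using uv[of k] e(2) by linarith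
    then have "norm (\<Phi> (v k)) - norm (JT (u k)) \<le> 1 / 2" using norm_triangle_ineq2 order_trans by blast
    then show ?thesis using v1[of k] T.J_norm[OF uc, of k] by simp
  qed
  have uc0: "u k \<noteq> (\<lambda>_. 0)" for k using unorm[of k] norm_le_l1[of "\<lambda>_. 0"] by (auto simp: supp_def)
  have combc: "comb u d \<in> c00" "comb x d \<in> c00" if "finite (supp d)" for d
    unfolding comb_def using that uc xc by (auto intro!: c00_lincomb)
  \<comment> \<open>Restricting to one block does not increase the norm, and each \<open>u k\<close>
    has norm at least \<open>1/2\<close>. Bounded coefficients turn the summable errors into one
    relative to the norm of the combination.\<close>
  have coeff: "\<bar>d k\<bar> \<le> 2 * nrm (comb u d)" if d: "finite (supp d)" for d k
  proof (cases "k \<in> supp d")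
    case True
    have "restr (supp (u k)) (comb u d) = (\<lambda>i. d k * restr (supp (u k)) (u k) i)"
      unfolding comb_def by (rule restr_block_sum[OF pq us d True us])
    then have "nrm (restr (supp (u k)) (comb u d)) = \<bar>d k\<bar> * nrm (u k)"
      using norm_scale[OF uc] by (simp add: restr_superset)
    then have "\<bar>d k\<bar> * nrm (u k) \<le> nrm (comb u d)" using norm_restr_le[OF combc(1)[OF d]] by metis
    moreover have "\<bar>d k\<bar> * (1 / 2) \<le> \<bar>d k\<bar> * nrm (u k)" using unorm by (intro mult_left_mono) auto
    ultimately show ?thesis by linarith
  next
    case False
    then show ?thesis using norm_nonneg[OF combc(1)[OF d]] by (simp add: supp_def)
  qed
  have small: "(\<Sum>k\<in>supp d. \<bar>d k\<bar> * (e * (1 / 2) ^ Suc k)) \<le> 2 * e * nrm (comb u d)" if d: "finite (supp d)" for d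
  proof -
    have "(\<Sum>k\<in>supp d. \<bar>d k\<bar> * (e * (1 / 2) ^ Suc k)) \<le> (\<Sum>k\<in>supp d. 2 * nrm (comb u d) * (e * (1 / 2) ^ Suc k))"
      using coeff[OF d] e by (intro sum_mono mult_right_mono) auto
    also have "\<dots> = 2 * e * nrm (comb u d) * (\<Sum>k\<in>supp d. (1 / 2) ^ Suc k)"
      by (simp add: sum_distrib_left mult_ac)
    also have "\<dots> \<le> 2 * e * nrm (comb u d) * 1"
    proof (rule mult_left_mono)
      have "(\<Sum>k\<in>supp d. (1 / 2 :: real) ^ Suc k) \<le> (\<Sum>k. (1 / 2) ^ Suc k)"
        using d by (intro sum_le_suminf power_half_series[THEN sums_summable]) auto
      then show "(\<Sum>k\<in>supp d. (1 / 2 :: real) ^ Suc k) \<le> 1" using power_half_series by (simp add: sums_iff)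
      show "0 \<le> 2 * e * nrm (comb u d)" using e norm_nonneg[OF combc(1)[OF d]] by simp
    qed
    finally show ?thesis by simp
  qed
  define vv where "vv d = (\<Sum>k\<in>supp d. d k *\<^sub>R v k)" for d
  have vvV: "vv d \<in> V" for d unfolding vv_def using vV V(1) by (intro subspace_sum subspace_scale) auto
  have approx: "norm (vv d - JX (comb x d)) \<le> 2 * e * nrm (comb u d)"
    "norm (\<Phi> (vv d) - JT (comb u d)) \<le> 2 * e * nrm (comb u d)" if d: "finite (supp d)" for d
  proof -
    have bound: "norm ((\<Sum>k\<in>supp d. d k *\<^sub>R a k) - (\<Sum>k\<in>supp d. d k *\<^sub>R b k)) \<le> 2 * e * nrm (comb u d)"
      if "\<And>k. norm (a k - b k) \<le> e * (1 / 2) ^ Suc k" for a b :: "nat \<Rightarrow> 'c::real_normed_vector"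
    proof -
      have "norm ((\<Sum>k\<in>supp d. d k *\<^sub>R a k) - (\<Sum>k\<in>supp d. d k *\<^sub>R b k)) = norm (\<Sum>k\<in>supp d. d k *\<^sub>R (a k - b k))"
        by (simp add: scaleR_diff_right sum_subtractf)
      also have "\<dots> \<le> (\<Sum>k\<in>supp d. \<bar>d k\<bar> * (e * (1 / 2) ^ Suc k))"
        by (intro order_trans[OF norm_sum] sum_mono) (simp only: norm_scaleR, intro mult_left_mono that abs_ge_zero)
      finally show ?thesis using small[OF d] by linarith
    qed
    show "norm (vv d - JX (comb x d)) \<le> 2 * e * nrm (comb u d)"
      using bound[OF xv] X.J_lincomb[OF d xc, of d] unfolding vv_def comb_def by simp
    show "norm (\<Phi> (vv d) - JT (comb u d)) \<le> 2 * e * nrm (comb u d)"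
      using bound[OF uv] T.J_lincomb[OF d uc, of d] linear_on_set_sum[OF \<Phi>(1) V(1) d vV, of d] unfolding vv_def comb_def by simp
  qed
  have upper: "nrmX (comb x d) \<le> 2 * C * nrm (comb u d)" and lower: "nrm (comb u d) \<le> 2 * C * nrmX (comb x d)"
    if d: "finite (supp d)" for d
  proof -
    define a where "a = nrm (comb u d)"
    have a: "a \<ge> 0" unfolding a_def using norm_nonneg[OF combc(1)[OF d]] .
    have JX: "norm (JX (comb x d)) = nrmX (comb x d)" and JT: "norm (JT (comb u d)) = a"
      using X.J_norm[OF combc(2)[OF d]] T.J_norm[OF combc(1)[OF d]] by (auto simp: a_def)
    have x1: "\<bar>norm (vv d) - nrmX (comb x d)\<bar> \<le> 2 * e * a"
      using norm_triangle_ineq3[of "vv d" "JX (comb x d)"] approx(1)[OF d] JX by (simp add: a_def)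
    have u1: "\<bar>norm (\<Phi> (vv d)) - a\<bar> \<le> 2 * e * a"
      using norm_triangle_ineq3[of "\<Phi> (vv d)" "JT (comb u d)"] approx(2)[OF d] JT by (simp add: a_def)
    have ea: "2 * e * a \<le> (1 / 4) * a" using e(2) a by (intro mult_right_mono) auto
    have "norm (\<Phi> (vv d)) \<le> (5 / 4) * a" using u1 ea by linarith
    then have "C * norm (\<Phi> (vv d)) \<le> C * ((5 / 4) * a)" using C(1) by (intro mult_left_mono) auto
    then have "norm (vv d) \<le> (5 / 4) * (C * a)" using C(2)[OF vvV, of d] by simp
    moreover have "1 * a \<le> C * a" using C(1) a by (intro mult_right_mono) auto
    ultimately have "nrmX (comb x d) \<le> (5 / 4) * (C * a) + (1 / 4) * (C * a)" using x1 ea by linarith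
    moreover have "0 \<le> C * a" using C(1) a by simp
    ultimately have "nrmX (comb x d) \<le> 2 * (C * a)" by linarith
    then show "nrmX (comb x d) \<le> 2 * C * nrm (comb u d)" by (simp add: a_def)
    have "C * norm (vv d) \<le> C * (nrmX (comb x d) + 2 * e * a)" using x1 C(1) by (intro mult_left_mono) auto
    also have "\<dots> = C * nrmX (comb x d) + 2 * (e * C) * a" by (simp add: algebra_simps)
    also have "\<dots> = C * nrmX (comb x d) + a / 4" unfolding e(3) by simp
    finally have "a \<le> C * nrmX (comb x d) + a / 4 + a / 4" using C(3)[OF vvV, of d] u1 ea by linarith
    then have "a \<le> 2 * (C * nrmX (comb x d))" by linarith
    then show "nrm (comb u d) \<le> 2 * C * nrmX (comb x d)" by (simp add: a_def)
  qed
  have t1: "\<theta> 1 > 0" using theta[of 1] by simp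
  \<comment> \<open>In the end \<open>\<theta> 1 * n / (8 * C)\<close> is at most
    \<open>2 * C * \<eta> * n\<close>; this \<open>\<eta>\<close> makes the latter half of the
    former.\<close>
  define \<eta> where "\<eta> = \<theta> 1 / (32 * C ^ 2)"
  have \<eta>: "\<eta> > 0" using t1 C(1) by (simp add: \<eta>_def)
  obtain n :: nat where n: "n \<ge> 1" and main: "\<forall>Y. tail_rich Y \<longrightarrow> (\<exists>y. (\<forall>i<n. y i \<in> Y \<and> 1 / 4 \<le> nrm (y i)) \<and>
    (\<forall>i j. i < j \<longrightarrow> j < n \<longrightarrow> supp (y i) \<inter> supp (y j) = {}) \<and>
    nrm (\<lambda>x. \<Sum>i<n. y i x) \<le> \<eta> * real n)"
    using disjoint_small_sum[OF \<eta>] by blast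
  \<comment> \<open>Since \<open>k \<le> m k\<close>, starting at index \<open>n\<close> puts the
    corresponding vectors in \<open>X\<close> beyond \<open>n\<close>, as the lower estimate
    requires.\<close>
  define Y where "Y = {comb u d | d. finite (supp d) \<and> supp d \<subseteq> {n..}}"
  have "tail_rich Y"
    unfolding tail_rich_def
  proof (intro conjI ballI allI)
    show "Y \<subseteq> c00" using combc(1) by (auto simp: Y_def)
    fix y1 assume "y1 \<in> Y"
    then obtain d1 where d1: "y1 = comb u d1" "finite (supp d1)" "supp d1 \<subseteq> {n..}" by (auto simp: Y_def)
    show "(\<lambda>i. c * y1 i) \<in> Y" for c
    proof -
      have "supp (\<lambda>k. c * d1 k) \<subseteq> supp d1" by (auto simp: supp_def)
      then have "finite (supp (\<lambda>k. c * d1 k))" "supp (\<lambda>k. c * d1 k) \<subseteq> {n..}"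
        using d1(2,3) finite_subset by auto
      moreover have "(\<lambda>i. c * y1 i) = comb u (\<lambda>k. c * d1 k)" unfolding d1(1) using comb_scale[OF d1(2), of u c] by simp
      ultimately show ?thesis unfolding Y_def by blast
    qed
    fix y2 assume "y2 \<in> Y"
    then obtain d2 where d2: "y2 = comb u d2" "finite (supp d2)" "supp d2 \<subseteq> {n..}" by (auto simp: Y_def)
    have "supp (\<lambda>k. d1 k + d2 k) \<subseteq> supp d1 \<union> supp d2" by (auto simp: supp_def)
    then have "supp (\<lambda>k. d1 k + d2 k) \<subseteq> {n..}" using d1(3) d2(3) by blast
    moreover have "finite (supp (\<lambda>k. d1 k + d2 k))" using finite_supp_add[OF d1(2) d2(2)] .
    moreover have "(\<lambda>i. y1 i + y2 i) = comb u (\<lambda>k. d1 k + d2 k)"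
      unfolding d1(1) d2(1) using comb_add[OF d1(2) d2(2), of u] by simp
    ultimately show "(\<lambda>i. y1 i + y2 i) \<in> Y" unfolding Y_def by blast
  next
    fix M
    define k where "k = max n M"
    have s: "supp (\<lambda>j. of_bool (j = k)) = {k}" by (auto simp: supp_def)
    have "comb u (\<lambda>j. of_bool (j = k)) = u k" unfolding comb_def s by simp
    then have "u k \<in> Y" unfolding Y_def using s
      by (intro CollectI exI[of _ "\<lambda>j. of_bool (j = k)"]) (simp add: k_def)
    moreover have "supp (u k) \<subseteq> {M..}" using us[of k] mk[of k] by (auto simp: k_def)
    ultimately show "\<exists>x\<in>Y. x \<noteq> (\<lambda>_. 0) \<and> supp x \<subseteq> {M..}" using uc0 by blast
  qed
  then obtain y where y: "\<forall>i<n. y i \<in> Y \<and> 1 / 4 \<le> nrm (y i)"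
    "\<forall>i j. i < j \<longrightarrow> j < n \<longrightarrow> supp (y i) \<inter> supp (y j) = {}" "nrm (\<lambda>x. \<Sum>i<n. y i x) \<le> \<eta> * real n"
    using main by blast
  have "\<forall>i. \<exists>d. i < n \<longrightarrow> y i = comb u d \<and> finite (supp d) \<and> supp d \<subseteq> {n..}"
    using y(1) unfolding Y_def by blast
  then obtain d where d: "\<And>i. i < n \<Longrightarrow> y i = comb u (d i) \<and> finite (supp (d i)) \<and> supp (d i) \<subseteq> {n..}" by metis
  \<comment> \<open>The same coefficients on the blocks of the other space, so that the norms
    compare by \<open>upper\<close> and \<open>lower\<close>.\<close>
  define X where "X i = comb x (d i)" for i
  have Xsupp: "\<exists>k\<in>supp (d i). t \<in> supp (x k)" if "t \<in> supp (X i)" for i t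
  proof -
    have "(\<Sum>k\<in>supp (d i). d i k * x k t) \<noteq> 0" using that by (simp add: X_def comb_def supp_def)
    then obtain k where "k \<in> supp (d i)" "d i k * x k t \<noteq> 0"
      by (rule sum.not_neutral_contains_not_neutral)
    then show ?thesis by (auto simp: supp_def)
  qed
  have X4: "1 / (8 * C) \<le> nrmX (X i)" if "i < n" for i
  proof -
    have "1 / 4 \<le> 2 * C * nrmX (X i)"
      using y(1) d[OF that] lower[of "d i"] that unfolding X_def by force
    then show ?thesis using C(1) by (simp add: field_simps)
  qed
  have "\<theta> 1 * (\<Sum>i<n. nrmX (X i)) \<le> nrmX (\<lambda>t. \<Sum>i<n. X i t)"
  proof (rule X.disjoint_lower_estimate[OF A1 n])
    fix i assume i: "i < n"
    have "X i \<in> c00" unfolding X_def using d[OF i] combc(2) by blast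
    moreover have "supp (X i) \<noteq> {}"
    proof
      assume "supp (X i) = {}"
      then have "nrmX (X i) \<le> 0" using X.norm_le_l1[of "X i"] by simp
      moreover have "0 < 1 / (8 * C)" using C(1) by simp
      ultimately show False using X4[OF i] by linarith
    qed
    moreover have "supp (X i) \<subseteq> {n..}"
    proof
      fix t assume "t \<in> supp (X i)"
      then obtain k where k: "k \<in> supp (d i)" "t \<in> supp (x k)" using Xsupp by blast
      then have "n \<le> k" "Suc (m k) \<le> t" using d[OF i] xs[of k] by auto
      then show "t \<in> {n..}" using mk[of k] by simp
    qed
    ultimately show "X i \<in> c00 \<and> supp (X i) \<noteq> {} \<and> supp (X i) \<subseteq> {n..}" by blast
  next
    fix i j assume ij: "i < j" "j < n"
    then have i: "i < n" by simp
    show "supp (X i) \<inter> supp (X j) = {}"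
    proof (rule ccontr)
      assume "supp (X i) \<inter> supp (X j) \<noteq> {}"
      then obtain t where "t \<in> supp (X i)" "t \<in> supp (X j)" by blast
      then obtain k l where k: "k \<in> supp (d i)" "t \<in> supp (x k)" and l: "l \<in> supp (d j)" "t \<in> supp (x l)"
        using Xsupp by blast
      have "t \<in> {Suc (m k)..m (Suc k)}" "t \<in> {Suc (m l)..m (Suc l)}" using xs k l by blast+
      then have "k = l" using interlaced_less[OF pq, of k l] interlaced_less[OF pq, of l k]
        by (cases k l rule: linorder_cases) auto
      \<comment> \<open>Disjointness of the \<open>y i\<close> is carried over to the
        \<open>X i\<close> through the coefficients: an index with nonzero coefficient puts the
        whole support of \<open>u k\<close> into that of \<open>y i'\<close>, so two of the vectors
        cannot share it.\<close>
      have nz: "y i' s \<noteq> 0" if "i' < n" "k \<in> supp (d i')" "s \<in> supp (u k)" for i' s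
      proof -
        have "finite (supp (d i'))" "y i' = comb u (d i')" using d[OF that(1)] by auto
        then have "restr (supp (u k)) (y i') = (\<lambda>t. d i' k * restr (supp (u k)) (u k) t)"
          unfolding comb_def using restr_block_sum[OF pq us _ that(2) us, of "d i'"] by simp
        from fun_cong[OF this, of s] show ?thesis using that(2,3) by (simp add: restr_def) (simp add: supp_def)
      qed
      obtain s where s: "s \<in> supp (u k)" using nonzero_supp[OF uc uc0] by blast
      then have "s \<in> supp (y i) \<inter> supp (y j)"
        using nz[OF i k(1) s] nz[OF ij(2) _ s] l(1) \<open>k = l\<close> by (simp add: supp_def)
      then show False using y(2) ij by blast
    qed
  qed
  also have "(\<lambda>t. \<Sum>i<n. X i t) = comb x (\<lambda>k. \<Sum>i<n. d i k)"
    unfolding X_def using comb_sum(2)[of "{..<n}" d x] d by simp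
  also have "nrmX \<dots> \<le> 2 * C * nrm (comb u (\<lambda>k. \<Sum>i<n. d i k))"
    using comb_sum(1)[of "{..<n}" d] d by (intro upper) simp
  also have "comb u (\<lambda>k. \<Sum>i<n. d i k) = (\<lambda>t. \<Sum>i<n. y i t)"
    using comb_sum(2)[of "{..<n}" d u] d by (auto simp: fun_eq_iff intro!: sum.cong)
  also have "2 * C * nrm (\<lambda>t. \<Sum>i<n. y i t) \<le> 2 * C * (\<eta> * n)"
    using y(3) C(1) by (intro mult_left_mono) auto
  finally have 1: "\<theta> 1 * (\<Sum>i<n. nrmX (X i)) \<le> 2 * C * (\<eta> * n)" .
  have "n * (1 / (8 * C)) \<le> (\<Sum>i<n. nrmX (X i))"
    using sum_mono[of "{..<n}" "\<lambda>_. 1 / (8 * C)" "\<lambda>i. nrmX (X i)"] X4 by simp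
  then have "\<theta> 1 * (n * (1 / (8 * C))) \<le> \<theta> 1 * (\<Sum>i<n. nrmX (X i))" using t1 by (intro mult_left_mono) auto
  then have "\<theta> 1 * (n * (1 / (8 * C))) \<le> 2 * C * (\<eta> * n)" using 1 by linarith
  also have "2 * C * (\<eta> * n) = \<theta> 1 * (n * (1 / (16 * C)))"
    using C(1) by (simp add: \<eta>_def power2_eq_square field_simps)
  finally have "n * (1 / (8 * C)) \<le> n * (1 / (16 * C))" by (rule mult_left_le_imp_le) (rule t1)
  then have "1 / (8 * C) \<le> 1 / (16 * C)" by (rule mult_left_le_imp_le) (use n in simp)
  then show False using C(1) by (simp add: field_simps)
qed

end

section \<open>Isomorphisms of subspaces and the conclusion\<close>

lemma isomorphic_subspaces_maps:
  assumes Y: "subspace Y" and Z: "subspace Z" and iso: "isomorphic_subspaces Y Z"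
  obtains f g C where "linear_on_set Y f" "linear_on_set Z g" "f ` Y = Z" "g ` Z = Y"
    "C \<ge> 1" "\<And>x. x \<in> Y \<Longrightarrow> g (f x) = x" "\<And>z. z \<in> Z \<Longrightarrow> f (g z) = z"
    "\<And>x. x \<in> Y \<Longrightarrow> norm (f x) \<le> C * norm x" "\<And>z. z \<in> Z \<Longrightarrow> norm (g z) \<le> C * norm z"
proof -
  obtain f g where h: "homeomorphism Y Z f g" and f: "linear_on_set Y f"
    using iso unfolding isomorphic_subspaces_def linear_on_set_def by blast
  have im: "f ` Y = Z" "g ` Z = Y" and inv: "\<And>x. x \<in> Y \<Longrightarrow> g (f x) = x" "\<And>z. z \<in> Z \<Longrightarrow> f (g z) = z"
    and cont: "continuous_on Y f" "continuous_on Z g"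
    using h by (auto simp: homeomorphism_def)
  have g: "linear_on_set Z g"
    unfolding linear_on_set_def
  proof (intro conjI ballI allI)
    fix u v assume uv: "u \<in> Z" "v \<in> Z"
    then have gY: "g u \<in> Y" "g v \<in> Y" using im by auto
    then have "f (g u + g v) = u + v" using f inv(2) uv unfolding linear_on_set_def by simp
    then show "g (u + v) = g u + g v" using inv(1)[OF subspace_add[OF Y gY]] by simp
  next
    fix u c assume u: "u \<in> Z"
    then have gY: "g u \<in> Y" using im by auto
    then have "f (c *\<^sub>R g u) = c *\<^sub>R u" using f inv(2) u unfolding linear_on_set_def by simp
    then show "g (c *\<^sub>R u) = c *\<^sub>R g u" using inv(1)[OF subspace_scale[OF Y gY, of c]] by simp
  qed
  obtain C1 where C1: "C1 \<ge> 1" "\<forall>x\<in>Y. norm (f x) \<le> C1 * norm x"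
    using linear_on_set_bounded[OF f Y cont(1)] by blast
  obtain C2 where C2: "C2 \<ge> 1" "\<forall>x\<in>Z. norm (g x) \<le> C2 * norm x"
    using linear_on_set_bounded[OF g Z cont(2)] by blast
  have le: "norm (f x) \<le> max C1 C2 * norm x" if "x \<in> Y" for x
  proof -
    have "C1 * norm x \<le> max C1 C2 * norm x" by (intro mult_right_mono) auto
    then show ?thesis using C1(2) that by force
  qed
  have le': "norm (g x) \<le> max C1 C2 * norm x" if "x \<in> Z" for x
  proof -
    have "C2 * norm x \<le> max C1 C2 * norm x" by (intro mult_right_mono) auto
    then show ?thesis using C2(2) that by force
  qed
  show thesis
    by (rule that[OF f g im _ inv le le']) (use C1(1) in auto)
qed

context two_embeddings begin

text \<open>\<open>no_common_subspace\<close> takes its subspace in \<open>X\<close> and maps it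
  into \<open>T\<close>. For a subspace of \<open>T\<close> the inverse isomorphism is used, after
  infinite dimension has been passed on to the image in \<open>X\<close>.\<close>

lemma totally_incomparable_closures: "totally_incomparable (closure (JX ` c00)) (closure (JT ` c00))"
  unfolding totally_incomparable_def
proof (intro conjI notI)
  assume "embeds_inf_dim_subspace (closure (JX ` c00)) (closure (JT ` c00))"
  then obtain Y Z where YZ: "Y \<subseteq> closure (JX ` c00)" "subspace Y" "infinite_dimensional Y"
    "Z \<subseteq> closure (JT ` c00)" "subspace Z" "isomorphic_subspaces Y Z"
    unfolding embeds_inf_dim_subspace_def by blast
  obtain f g C where fg: "linear_on_set Y f" "linear_on_set Z g" "f ` Y = Z" "g ` Z = Y"
    "C \<ge> 1" "\<And>x. x \<in> Y \<Longrightarrow> g (f x) = x" "\<And>z. z \<in> Z \<Longrightarrow> f (g z) = z"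
    "\<And>x. x \<in> Y \<Longrightarrow> norm (f x) \<le> C * norm x" "\<And>z. z \<in> Z \<Longrightarrow> norm (g z) \<le> C * norm z"
    using isomorphic_subspaces_maps[OF YZ(2,5,6)] by blast
  show False
  proof (rule no_common_subspace[OF YZ(2,3,1) fg(1) _ fg(5) _ fg(8)])
    show "f ` Y \<subseteq> closure (JT ` c00)" using fg(3) YZ(4) by simp
    fix v assume "v \<in> Y"
    then show "norm v \<le> C * norm (f v)" using fg(9)[of "f v"] fg(3,6) by auto
  qed
next
  assume "embeds_inf_dim_subspace (closure (JT ` c00)) (closure (JX ` c00))"
  then obtain Y Z where YZ: "Y \<subseteq> closure (JT ` c00)" "subspace Y" "infinite_dimensional Y"
    "Z \<subseteq> closure (JX ` c00)" "subspace Z" "isomorphic_subspaces Y Z"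
    unfolding embeds_inf_dim_subspace_def by blast
  obtain f g C where fg: "linear_on_set Y f" "linear_on_set Z g" "f ` Y = Z" "g ` Z = Y"
    "C \<ge> 1" "\<And>x. x \<in> Y \<Longrightarrow> g (f x) = x" "\<And>z. z \<in> Z \<Longrightarrow> f (g z) = z"
    "\<And>x. x \<in> Y \<Longrightarrow> norm (f x) \<le> C * norm x" "\<And>z. z \<in> Z \<Longrightarrow> norm (g z) \<le> C * norm z"
    using isomorphic_subspaces_maps[OF YZ(2,5,6)] by blast
  have inf: "infinite_dimensional Z"
    by (rule infinite_dimensional_image[OF fg(2) YZ(5)]) (use fg(4) YZ(2,3) in auto)
  show False
  proof (rule no_common_subspace[OF YZ(5) inf YZ(4) fg(2) _ fg(5) _ fg(9)])
    show "g ` Z \<subseteq> closure (JT ` c00)" using fg(4) YZ(1) by simp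
    fix v assume "v \<in> Z"
    then show "norm v \<le> C * norm (g v)" using fg(8)[of "g v"] fg(4,7) by auto
  qed
qed

end

theorem corollary1p26:
  fixes \<theta> :: "nat \<Rightarrow> real" and X :: "'a::banach set" and T :: "'b::banach set"
  assumes "regular_seq \<theta>"
    and "(\<lambda>n. \<theta> n powr (1 / real n)) \<longlonglongrightarrow> 1"
    and "modified_space schreier \<theta> X \<or> (\<exists>m\<ge>1. boundedly_modified_space m schreier \<theta> X)"
    and "mixed_tsirelson_space schreier \<theta> T"
  shows "totally_incomparable X T"
proof -
  \<comment> \<open>Here \<open>m \<ge> 1\<close> matters: it makes the first condition
    \<open>allowable\<close>, which yields the estimate for disjoint vectors.\<close>
  obtain A where cond: "schreier_condition A" "A 1 = allowable (schreier 1)"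
    and X: "completion_of_c00 (norm_of_set (norming_set A \<theta>)) X"
    using assms(3)
  proof
    assume "modified_space schreier \<theta> X"
    then show thesis
      by (intro that[of "\<lambda>k. allowable (schreier k)"])
        (auto simp: modified_space_def modified_norm_def schreier_condition_def)
  next
    assume "\<exists>m\<ge>1. boundedly_modified_space m schreier \<theta> X"
    then obtain m where "m \<ge> 1" "boundedly_modified_space m schreier \<theta> X" by blast
    then show thesis
      by (intro that[of "\<lambda>k. if k \<le> m then allowable (schreier k) else admissible (schreier k)"])
        (auto simp: boundedly_modified_space_def boundedly_modified_norm_def schreier_condition_def)
  qed
  obtain JX :: "(nat \<Rightarrow> real) \<Rightarrow> 'a" where JX:
    "\<forall>x\<in>c00. \<forall>y\<in>c00. JX (\<lambda>i. x i + y i) = JX x + JX y" "\<forall>x\<in>c00. \<forall>c. JX (\<lambda>i. c * x i) = c *\<^sub>R JX x"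
    "\<forall>x\<in>c00. norm (JX x) = norm_of_set (norming_set A \<theta>) x" "X = closure (JX ` c00)"
    using X unfolding completion_of_c00_def by blast
  obtain N where N: "mixed_tsirelson_norm schreier \<theta> N" "completion_of_c00 N T"
    using assms(4) unfolding mixed_tsirelson_space_def by blast
  obtain JT :: "(nat \<Rightarrow> real) \<Rightarrow> 'b" where JT:
    "\<forall>x\<in>c00. \<forall>y\<in>c00. JT (\<lambda>i. x i + y i) = JT x + JT y" "\<forall>x\<in>c00. \<forall>c. JT (\<lambda>i. c * x i) = c *\<^sub>R JT x"
    "\<forall>x\<in>c00. norm (JT x) = N x" "T = closure (JT ` c00)"
    using N(2) unfolding completion_of_c00_def by blast
  interpret tsirelson_root \<theta> N
    by unfold_locales (use assms N in auto)
  interpret two_embeddings \<theta> N A JT JX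
    by unfold_locales (use cond JX JT N_eq_norm_of_set theta in \<open>auto simp del: schreier.simps\<close>)
  show ?thesis unfolding JX(4) JT(4) by (rule totally_incomparable_closures)
qed

end
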